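(* Let $d\ge2$. Let $(f_n)_{n\in\mathbb N}$ be a sequence of admissible functions such that: (a) for every $n\in\mathbb N$, $f_n\in L^{1,+}_{\rm loc}(E_n)$, where $E_n\uparrow E$ as $n\to\infty$; (b) there is an admissible function $f\in L^{1,+}_{\rm loc}(E)$ with $(I^1f)(1/2)>0$ such that $\lim_{n\to\infty}\int_{-\infty}^x|f_n(h)-f(h)|\,dh=0$ for all $x\in E$; (c) for some fixed $x_0'\in\mathbb R$ and some $\delta>0$, $\sup_{n\in\mathbb N}\int_{-\infty}^{x_0'}|h|^{\frac d2+\delta}f_n(h)\,dh<\infty$. Let $\eta_n:=\eta_{f_n}$, $n\in\mathbb N$, and $\eta:=\eta_f$. Assume additionally that either of the following two conditions holds: (i) there exist $n_0\in\mathbb N$, constants $C\in(0,\infty)$, $\alpha>0$, $\varepsilon>0$, and $x_0\in E$ such that for all $n\ge n_0$ and all $x\ge x_0$ $$(I^1f_n)(x+4d+2)\le C\,(I^1f_n)(x),\qquad (I^1f_n)(x)\ge\alpha x^\varepsilon$$ (the second inequality being required for those $x\ge x_0$ with $x\ge 0$); (ii) for some $p>1$, $\sup_{n\in\mathbb N}a_n^p<\infty$, where $a_n=\int_{\mathbb R}f_n(x)\,dx$. Then the distributions of the typical cells satisfy $$\mathbb P^0_{\mathcal L(\eta_n)}\underset{n\to\infty}\longrightarrow\mathbb P^0_{\mathcal L(\eta)}\qquad\text{weakly on }\mathcal C'.$$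
   Context: Points of $\mathbb R^d\times\mathbb R$ are written $(v,h)$. Put $\mathrm{pow}(w,(v,h))=\|w-v\|^2+h$. For a countable set $A\subset\mathbb R^d\times\mathbb R$ and $(v,h)\in A$ the Laguerre cell is $C((v,h),A)=\{w\in\mathbb R^d:\mathrm{pow}(w,(v,h))\le \mathrm{pow}(w,(v',h'))\ \forall (v',h')\in A\}$, and the Laguerre diagram $\mathcal L(A)$ is the collection of all Laguerre cells with non-empty interior. A tessellation in $\mathbb R^d$ is a locally finite system of convex polytopes (cells) with non-empty, pairwise disjoint interiors covering $\mathbb R^d$, such that the intersection of two distinct cells is empty or a face of both; it is normal if each $k$-dimensional face lies in precisely $d+1-k$ cells, $0\le k\le d-1$. For an interval $E\subset\mathbb R$, $L^{1,+}_{\rm loc}(E)$ is the set of functions $f:\mathrm{int}\,E\to[0,\infty)$ with $\int_K f\,dx<\infty$ for all compact $K\subset E$; such $f$ is regarded as $0$ outside $E$. For $\alpha>0$, $(I^\alpha f)(x)=\frac1{\Gamma(\alpha)}\int_{-\infty}^x f(t)(x-t)^{\alpha-1}\,dt$. For $f\in L^{1,+}_{\rm loc}(E)$, $\eta_f$ is the Poisson point process in $\mathbb R^d\times\mathbb R$ with intensity measure $\Lambda_f(\cdot)=\int_{\mathbb R^d}\int_E f(h)\mathbf 1((v,h)\in\cdot)\,dh\,dv$, assumed non-trivial ($\Lambda_f([0,1]^d\times\mathbb R)>0$). A function $f\in L^{1,+}_{\rm loc}(E)$ is admissible if: $E=[a,\infty)$ for some $a\in\mathbb R$, or $E=(-\infty,b)$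 for some $b\in\mathbb R$, or $E=\mathbb R$; $(I^{d/2+1}f)(t)<\infty$ for all $t\in E$; and, if $E=(-\infty,b)$, there are $\varepsilon>0$, $n_0\in\mathbb N$ with $(I^{d/2+1}f)(b-1/n)\ge n^\varepsilon$ for all $n>n_0$. For admissible $f$, $\mathcal L(\eta_f)$ is almost surely a normal (stationary) random tessellation. $\mathcal C'$ is the space of non-empty compact subsets of $\mathbb R^d$ with the Hausdorff metric. A center function is a measurable map $z$ assigning to a cell $c$ of a tessellation $T$ a point $z(c,T)\in\mathbb R^d$ with $z(c+v,T+v)=z(c,T)+v$ for all $v\in\mathbb R^d$. For a stationary random tessellation $\mathcal T$ its cell intensity is $\gamma_d(\mathcal T)=\mathbb E\sum_{t\in\mathcal T}\mathbf 1(z(t,\mathcal T)\in[0,1]^d)$ (independent of $z$), and, if $\gamma_d(\mathcal T)\in(0,\infty)$, the typical cell is the random polytope with distribution $$\mathbb P^0_{\mathcal T}(\cdot)=\frac1{\gamma_d(\mathcal T)}\,\mathbb E\sum_{t\in\mathcal T}\mathbf 1(t-z(t,\mathcal T)\in\cdot)\,\mathbf 1(z(t,\mathcal T)\in[0,1]^d).$$ A different choice of $z$ changes the typical cell only by a translation; typical cells are considered up to translation, and for definiteness $z(c,T)$ is taken to be the lexicographically smallest vertex of $c$. *)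

theory Defs
  imports "HOL-Probability.Probability" "HOL-Library.Fun_Lexorder"
begin

section \<open>Non-empty compact sets with the Hausdorff metric\<close>

definition hausdorff_dist :: "'a::metric_space set \<Rightarrow> 'a set \<Rightarrow> real" where
  "hausdorff_dist A B = max (SUP a\<in>A. infdist a B) (SUP b\<in>B. infdist b A)"

lemma hausdorff_dist_le_iff:
  fixes A B :: "'a::metric_space set"
  assumes "compact A" "A \<noteq> {}" "compact B" "B \<noteq> {}"
  shows "hausdorff_dist A B \<le> e \<longleftrightarrow> (\<forall>a\<in>A. infdist a B \<le> e) \<and> (\<forall>b\<in>B. infdist b A \<le> e)"
proof -
  have bdd: "bdd_above ((\<lambda>x. infdist x D) ` C)" if "compact C" for C D :: "'a set"
    by (intro bounded_imp_bdd_above compact_imp_bounded compact_continuous_image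
        continuous_intros that)
  show ?thesis
    unfolding hausdorff_dist_def max.bounded_iff
    using cSUP_le_iff[OF \<open>A \<noteq> {}\<close> bdd[OF \<open>compact A\<close>]] cSUP_le_iff[OF \<open>B \<noteq> {}\<close> bdd[OF \<open>compact B\<close>]]
    by blast
qed

typedef (overloaded) 'a ncompact = "{K :: 'a::metric_space set. compact K \<and> K \<noteq> {}}"
  by (rule exI[of _ "{undefined}"]) simp

lemma Rep_ncompact_compact: "compact (Rep_ncompact K)"
  and Rep_ncompact_nonempty: "Rep_ncompact K \<noteq> {}"
  using Rep_ncompact[of K] by auto

instantiation ncompact :: (metric_space) metric_space
begin

definition dist_ncompact :: "'a ncompact \<Rightarrow> 'a ncompact \<Rightarrow> real" where
  "dist_ncompact K L = hausdorff_dist (Rep_ncompact K) (Rep_ncompact L)"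

definition uniformity_ncompact :: "('a ncompact \<times> 'a ncompact) filter" where
  "uniformity_ncompact = (INF e\<in>{0 <..}. principal {(x, y). dist x y < e})"

definition open_ncompact :: "'a ncompact set \<Rightarrow> bool" where
  "open_ncompact U \<longleftrightarrow> (\<forall>x\<in>U. eventually (\<lambda>(x', y). x' = x \<longrightarrow> y \<in> U) uniformity)"

lemma dist_ncompact_le_iff:
  "dist K L \<le> e \<longleftrightarrow> (\<forall>a\<in>Rep_ncompact K. infdist a (Rep_ncompact L) \<le> e) \<and>
      (\<forall>b\<in>Rep_ncompact L. infdist b (Rep_ncompact K) \<le> e)" for K L :: "'a ncompact"
  unfolding dist_ncompact_def
  by (rule hausdorff_dist_le_iff) (rule Rep_ncompact_compact Rep_ncompact_nonempty)+

instance
proof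
  fix K L J :: "'a ncompact"
  show "uniformity = (INF e\<in>{0 <..}. principal {(x::'a ncompact, y). dist x y < e})"
    by (rule uniformity_ncompact_def)
  show "open U = (\<forall>x\<in>U. \<forall>\<^sub>F (x', y) in uniformity. x' = x \<longrightarrow> y \<in> U)" for U :: "'a ncompact set"
    by (rule open_ncompact_def)
  have nonneg: "dist K L \<ge> 0" for K L :: "'a ncompact"
  proof -
    obtain a where "a \<in> Rep_ncompact K"
      using Rep_ncompact_nonempty by blast
    then have "infdist a (Rep_ncompact L) \<le> dist K L"
      using dist_ncompact_le_iff[of K L "dist K L"] by simp
    then show ?thesis
      using infdist_nonneg order_trans by blast
  qed
  show "dist K L = 0 \<longleftrightarrow> K = L"
  proof
    assume "dist K L = 0"
    then have *: "\<forall>a\<in>Rep_ncompact K. infdist a (Rep_ncompact L) \<le> 0"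
      "\<forall>b\<in>Rep_ncompact L. infdist b (Rep_ncompact K) \<le> 0"
      using dist_ncompact_le_iff[of K L 0] by auto
    have mem: "x \<in> Rep_ncompact D" if "infdist x (Rep_ncompact D) \<le> 0" for x and D :: "'a ncompact"
      using that in_closed_iff_infdist_zero[OF compact_imp_closed[OF Rep_ncompact_compact]
          Rep_ncompact_nonempty] infdist_nonneg antisym by metis
    have "Rep_ncompact K = Rep_ncompact L"
      using * mem by blast
    then show "K = L"
      by (simp add: Rep_ncompact_inject)
  next
    assume "K = L"
    then have "dist K L \<le> 0"
      unfolding dist_ncompact_le_iff by simp
    then show "dist K L = 0"
      using nonneg antisym by blast
  qed
  show "dist K L \<le> dist K J + dist L J"
  proof -
    have half: "infdist a (Rep_ncompact L) \<le> dist K J + dist L J"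
      if a: "a \<in> Rep_ncompact K" for a and K L :: "'a ncompact"
    proof -
      obtain c where c: "c \<in> Rep_ncompact J" "infdist a (Rep_ncompact J) = dist a c"
      proof -
        have "continuous_on (Rep_ncompact J) (dist a)"
          by (intro continuous_intros)
        then obtain c where c: "c \<in> Rep_ncompact J" "\<And>y. y \<in> Rep_ncompact J \<Longrightarrow> dist a c \<le> dist a y"
          using continuous_attains_inf[OF Rep_ncompact_compact[of J] Rep_ncompact_nonempty[of J]]
          by blast
        have "infdist a (Rep_ncompact J) = dist a c"
          unfolding infdist_notempty[OF Rep_ncompact_nonempty]
          by (rule cInf_eq_minimum) (use c in auto)
        with c(1) that show thesis
          by blast
      qed
      have "infdist a (Rep_ncompact L) \<le> infdist c (Rep_ncompact L) + dist a c"
        by (rule infdist_triangle)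
      moreover have "infdist c (Rep_ncompact L) \<le> dist L J"
        using dist_ncompact_le_iff[of L J "dist L J"] c by simp
      moreover have "dist a c \<le> dist K J"
        using dist_ncompact_le_iff[of K J "dist K J"] a c(2)[symmetric] by simp
      ultimately show ?thesis
        by simp
    qed
    show ?thesis
      unfolding dist_ncompact_le_iff using half[of _ K L] half[of _ L K] by (simp add: add.commute)
  qed
qed

end

text \<open>Weak convergence of probability measures. It is a property of the tail of the sequence, so
  that finitely many members may fail to be probability measures.\<close>

definition weakly_converges :: "(nat \<Rightarrow> 'a::topological_space measure) \<Rightarrow> 'a measure \<Rightarrow> bool" where
  "weakly_converges P Q \<longleftrightarrow>
     prob_space Q \<and> sets Q = sets borel \<and>
     (\<forall>\<^sub>F n in sequentially. prob_space (P n) \<and> sets (P n) = sets borel) \<and>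
     (\<forall>g :: 'a \<Rightarrow> real. continuous_on UNIV g \<and> bounded (range g) \<longrightarrow>
        (\<lambda>n. \<integral>x. g x \<partial>P n) \<longlonglongrightarrow> (\<integral>x. g x \<partial>Q))"


section \<open>Admissible functions\<close>

text \<open>A function on \<^term>\<open>interior E\<close> is represented by its extension by zero.\<close>

definition L1loc_plus :: "real set \<Rightarrow> (real \<Rightarrow> real) set" where
  "L1loc_plus E = {f \<in> borel_measurable borel.
     (\<forall>x. 0 \<le> f x) \<and> (\<forall>x. x \<notin> interior E \<longrightarrow> f x = 0) \<and>
     (\<forall>K. compact K \<and> K \<subseteq> E \<longrightarrow> (\<integral>\<^sup>+x\<in>K. ennreal (f x) \<partial>lborel) < \<infinity>)}"

definition frac_int :: "real \<Rightarrow> (real \<Rightarrow> real) \<Rightarrow> real \<Rightarrow> ennreal" where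
  "frac_int \<alpha> f x =
     ennreal (1 / Gamma \<alpha>) * (\<integral>\<^sup>+t\<in>{..x}. ennreal (f t * (x - t) powr (\<alpha> - 1)) \<partial>lborel)"

definition admissible :: "nat \<Rightarrow> real set \<Rightarrow> (real \<Rightarrow> real) \<Rightarrow> bool" where
  "admissible d E f \<longleftrightarrow>
     f \<in> L1loc_plus E \<and>
     ((\<exists>a. E = {a..}) \<or> (\<exists>b. E = {..<b}) \<or> E = UNIV) \<and>
     (\<forall>t\<in>E. frac_int (real d / 2 + 1) f t < \<infinity>) \<and>
     (\<forall>b. E = {..<b} \<longrightarrow>
        (\<exists>\<epsilon>>0. \<exists>n0::nat. \<forall>n>n0. ennreal (real n powr \<epsilon>) \<le> frac_int (real d / 2 + 1) f (b - 1 / real n)))"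


section \<open>Poisson point processes\<close>

definition points_in :: "'b set \<Rightarrow> 'b set \<Rightarrow> ennreal" where
  "points_in B A = emeasure (count_space UNIV) (A \<inter> B)"

text \<open>Simple point processes are represented by their random supports. This loses nothing for a
  diffuse intensity measure, as the Poisson process is then almost surely simple.\<close>

definition poisson_process :: "'w measure \<Rightarrow> ('w \<Rightarrow> 'b set) \<Rightarrow> 'b measure \<Rightarrow> bool" where
  "poisson_process M X \<Lambda> \<longleftrightarrow>
     prob_space M \<and>
     (\<forall>\<omega>\<in>space M. countable (X \<omega>) \<and> X \<omega> \<subseteq> space \<Lambda>) \<and>
     (\<forall>B\<in>sets \<Lambda>. (\<lambda>\<omega>. points_in B (X \<omega>)) \<in> borel_measurable M) \<and>
     (\<forall>B\<in>sets \<Lambda>. emeasure \<Lambda> B < \<infinity> \<longrightarrow>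
        (\<forall>k. measure M {\<omega> \<in> space M. points_in B (X \<omega>) = of_nat k} =
           measure \<Lambda> B ^ k / fact k * exp (- measure \<Lambda> B))) \<and>
     (\<forall>B\<in>sets \<Lambda>. emeasure \<Lambda> B = \<infinity> \<longrightarrow> (AE \<omega> in M. points_in B (X \<omega>) = \<infinity>)) \<and>
     (\<forall>(m::nat) B. (\<forall>i<m. B i \<in> sets \<Lambda>) \<and> disjoint_family_on B {..<m} \<longrightarrow>
        prob_space.indep_vars M (\<lambda>_. borel) (\<lambda>i \<omega>. points_in (B i) (X \<omega>)) {..<m})"

text \<open>No integration range for \<open>h\<close> is needed: members of \<^term>\<open>L1loc_plus E\<close> vanish off \<open>E\<close>.\<close>

definition Lambda :: "(real \<Rightarrow> real) \<Rightarrow> ('a::euclidean_space \<times> real) measure" where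
  "Lambda f = density (lborel \<Otimes>\<^sub>M lborel) (\<lambda>(v, h). ennreal (f h))"


section \<open>Laguerre diagrams\<close>

definition pow_fun :: "'a::real_inner \<Rightarrow> 'a \<times> real \<Rightarrow> real" where
  "pow_fun w p = (norm (w - fst p))\<^sup>2 + snd p"

definition laguerre_cell :: "'a::real_inner \<times> real \<Rightarrow> ('a \<times> real) set \<Rightarrow> 'a set" where
  "laguerre_cell p A = {w. \<forall>q\<in>A. pow_fun w p \<le> pow_fun w q}"

definition laguerre_diagram :: "('a::real_inner \<times> real) set \<Rightarrow> 'a set set" where
  "laguerre_diagram A = {laguerre_cell p A | p. p \<in> A \<and> interior (laguerre_cell p A) \<noteq> {}}"


section \<open>Cell intensity and typical cell\<close>

text \<open>In this section a random tessellation is a map \<open>T\<close> from a probability space \<open>M\<close> to sets of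
  cells, and \<open>z c (T \<omega>)\<close> is the center of the cell \<open>c\<close>.\<close>

definition cell_intensity ::
  "('a::euclidean_space set \<Rightarrow> 'a set set \<Rightarrow> 'a) \<Rightarrow> 'w measure \<Rightarrow> ('w \<Rightarrow> 'a set set) \<Rightarrow> ennreal" where
  "cell_intensity z M T =
     (\<integral>\<^sup>+\<omega>. (\<integral>\<^sup>+t. indicator (cbox 0 One) (z t (T \<omega>)) \<partial>count_space (T \<omega>)) \<partial>M)"

text \<open>If \<^term>\<open>cell_intensity z M T\<close> is \<open>0\<close> or \<open>\<infinity>\<close>, where the typical cell is undefined, the
  following is the null measure, so in particular not a probability measure.\<close>

definition typical_cell_distr ::
  "('a::euclidean_space set \<Rightarrow> 'a set set \<Rightarrow> 'a) \<Rightarrow> 'w measure \<Rightarrow> ('w \<Rightarrow> 'a set set) \<Rightarrow> 'a ncompact measure"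
  where
  "typical_cell_distr z M T = measure_of UNIV (sets borel) (\<lambda>A.
     (\<integral>\<^sup>+\<omega>. (\<integral>\<^sup>+t. indicator (Rep_ncompact ` A) ((\<lambda>x. x - z t (T \<omega>)) ` t) *
                 indicator (cbox 0 One) (z t (T \<omega>)) \<partial>count_space (T \<omega>)) \<partial>M)
     / cell_intensity z M T)"

definition lex_min_vertex ::
  "(real ^ 'd::{finite,linorder}) set \<Rightarrow> (real ^ 'd::{finite,linorder}) set set \<Rightarrow> real ^ 'd::{finite,linorder}" where
  "lex_min_vertex c T = (THE x. x extreme_point_of c \<and>
     (\<forall>y. y extreme_point_of c \<and> y \<noteq> x \<longrightarrow> less_fun (($) x) (($) y)))"

end

theory Submission
  imports Defs
begin

text \<open>
  The convergence even holds for every Borel set of compact sets, because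
  \<open>\<integral>_{-\<infinity>}^x |f_n - f| \<longrightarrow> 0\<close> makes the Poisson processes converge in total variation on regions of
  finite intensity. The distribution of the typical cell is a ratio of expectations of counts \<open>N\<close> of those cells whose
  lexicographically smallest vertex lies in the unit cube and which satisfy a further condition.
  With high probability \<open>N\<close> depends only on the points in a fixed region of finite intensity:
  a point in a box around the unit cube bounds the power function on the cube from above, and points
  in all \<open>2^d\<close> orthants far away from the origin bound the cells that meet the cube. Hence
  \<open>\<E> N(\<eta>_n) \<longrightarrow> \<E> N(\<eta>)\<close> once the variables \<open>N(\<eta>_n)\<close> are uniformly integrable.

  For the latter, exhaust the space by boxes \<open>Q_j\<close>. If \<open>\<eta>_n\<close> has no point in \<open>Q_j\<close> but has one in \<open>Q_{j+1}\<close>,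
  then \<open>N\<close> is at most the number of points of \<open>\<eta>_n\<close> in the paraboloid region \<open>K_{j+1} - Q_j\<close>, which is independent
  of the event that \<open>Q_j\<close> is empty. So this event contributes at most \<open>\<Lambda>_n(K_{j+1}) exp(-\<Lambda>_n(Q_j))\<close>
  to \<open>\<E> N\<close>. Under (i) the choice \<open>Q_j = [-1,1]^d \<times> (-\<infinity>, j_0 + j]\<close> makes these bounds summable uniformly in \<open>n\<close>,
  and under (ii) the choice \<open>Q_j = [-j-1,j+1]^d \<times> (-\<infinity>, 1/2]\<close> does. Both conditions exclude \<open>E = (-\<infinity>, b)\<close>, since
  they force \<open>f_n\<close> to have finite mass below every level.
\<close>

section \<open>Total variation between Poisson processes\<close>

text \<open>No region of finite intensity determines the cells at the unit cube with certainty: a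
  cell may reach far, and every point it competes with there matters. So the orthant points bound
  the cells first, and only then a window is chosen that holds all competitors on the bounded set.
  Total variation on windows asks for no continuity of the counted property; the price is that the
  smallest vertex and the centred cell must be shown measurable. The shift \<open>4 d + 2\<close> in
  (i) comes from the boxes: the unit cube lies in the ball of radius \<open>sqrt d\<close> about 0,
  so a point of \<open>[-1,1]^d \<times> (-\<infinity>, s]\<close> has power at most
  \<open>(2 sqrt d)^2 + s = 4 d + s\<close> there, and the step from \<open>Q_j\<close> to
  \<open>Q_{j+1}\<close> raises \<open>s\<close> by 1. The exponent in (c) comes from the slice of
  the paraboloid region at height \<open>h\<close>, whose volume is of order
  \<open>|h|^(d/2)\<close> for deep \<open>h\<close>; the surplus \<open>\<delta>\<close> makes deep
  points negligible uniformly in \<open>n\<close>. Positivity of the limiting cell intensity needs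
  an argument of its own.\<close>

lemma (in finite_measure) measure_diff_le_sym_diff:
  assumes [measurable]: "S \<in> sets M" "B \<in> sets M"
  shows "\<bar>measure M S - measure M B\<bar> \<le> measure M (sym_diff S B)"
proof -
  have "measure M S \<le> measure M (B \<union> sym_diff S B)" "measure M B \<le> measure M (S \<union> sym_diff S B)"
    by (auto intro!: finite_measure_mono)
  moreover have "measure M (B \<union> sym_diff S B) \<le> measure M B + measure M (sym_diff S B)"
    "measure M (S \<union> sym_diff S B) \<le> measure M S + measure M (sym_diff S B)"
    by (intro measure_Un_le; simp)+
  ultimately show ?thesis by linarith
qed

text \<open>The sets that can be approximated are closed under complements, which preserve symmetric
  differences, and under countable unions: continuity from below leaves a finite union, whose
  members are approximated one by one.\<close>

lemma algebra_approximation: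
  assumes alg: "algebra \<Omega> A" and M: "finite_measure M" "space M = \<Omega>" "sets M = sigma_sets \<Omega> A"
    and S: "S \<in> sigma_sets \<Omega> A" and e: "e > 0"
  shows "\<exists>B\<in>A. measure M (sym_diff S B) < e"
proof -
  interpret algebra \<Omega> A by fact
  interpret finite_measure M by fact
  have A_M[measurable]: "B \<in> A \<Longrightarrow> B \<in> sets M" for B
    using M by auto
  from S have "\<forall>e>0. \<exists>B\<in>A. measure M (sym_diff S B) < e"
  proof (induction S)
    case (Basic a)
    then show ?case by (intro allI impI bexI[of _ a]) auto
  next
    case Empty
    then show ?case by (intro allI impI bexI[of _ "{}"]) auto
  next
    case (Compl a)
    show ?case
    proof (intro allI impI)
      fix e :: real assume "e > 0"
      then obtain B where B: "B \<in> A" "measure M (sym_diff a B) < e" using Compl by blast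
      have "a \<subseteq> \<Omega>" "B \<subseteq> \<Omega>"
        using sets.sets_into_space[of a M] sets_into_space[OF B(1)] Compl(1) M by auto
      then have "sym_diff (\<Omega> - a) (\<Omega> - B) = sym_diff a B" by auto
      with B show "\<exists>B\<in>A. measure M (sym_diff (\<Omega> - a) B) < e"
        by (intro bexI[of _ "\<Omega> - B"]) auto
    qed
  next
    case (Union a)
    show ?case
    proof (intro allI impI)
      fix e :: real assume e: "e > 0"
      have [measurable]: "a i \<in> sets M" for i using Union(1) M by auto
      have "(\<lambda>n. measure M (\<Union>i<n. a i)) \<longlonglongrightarrow> measure M (\<Union>n. \<Union>i<n. a i)"
        by (rule finite_Lim_measure_incseq) (force simp: incseq_def)+
      also have "(\<Union>n. \<Union>i<n. a i) = (\<Union>i. a i)" by auto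
      finally obtain n where n: "measure M (\<Union>i. a i) - measure M (\<Union>i<n. a i) < e / 2"
        using e unfolding LIMSEQ_def dist_real_def
        by (metis abs_minus_commute abs_le_D1 half_gt_zero order_le_less_trans order_refl)
      \<comment> \<open>The errors of the \<open>n\<close> members add up to at most
        \<open>e / 2\<close>; the summand 1 covers \<open>n = 0\<close>.\<close>
      have "\<exists>B\<in>A. measure M (sym_diff (a i) B) < e / 2 / (real n + 1)" for i
        using Union(2)[of i] e by auto
      then obtain B where B: "\<And>i. B i \<in> A" "\<And>i. measure M (sym_diff (a i) (B i)) < e / 2 / (real n + 1)"
        by metis
      have [measurable]: "B i \<in> sets M" for i using B by auto
      let ?B = "\<Union>i<n. B i"
      have "measure M (sym_diff (\<Union>i. a i) ?B)
        \<le> measure M (((\<Union>i. a i) - (\<Union>i<n. a i)) \<union> (\<Union>i<n. sym_diff (a i) (B i)))"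
        by (intro finite_measure_mono) auto
      also have "\<dots> \<le> measure M ((\<Union>i. a i) - (\<Union>i<n. a i)) + measure M (\<Union>i<n. sym_diff (a i) (B i))"
        by (intro measure_Un_le) auto
      also have "measure M ((\<Union>i. a i) - (\<Union>i<n. a i)) = measure M (\<Union>i. a i) - measure M (\<Union>i<n. a i)"
        by (intro finite_measure_Diff) auto
      also have "measure M (\<Union>i<n. sym_diff (a i) (B i)) \<le> (\<Sum>i<n. measure M (sym_diff (a i) (B i)))"
        by (intro finite_measure_subadditive_finite) auto
      also have "\<dots> \<le> (\<Sum>i<n. e / 2 / (real n + 1))"
        by (intro sum_mono less_imp_le B)
      also have "\<dots> \<le> e / 2"
        using e by (simp add: field_simps)
      finally show "\<exists>B\<in>A. measure M (sym_diff (\<Union> (range a)) B) < e"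
        using n B by (intro bexI[of _ ?B]) auto
    qed
  qed
  with e show ?thesis by blast
qed

text \<open>One member of the algebra approximates \<open>S\<close> with respect to the sum
  \<open>P\<close> of both measures, hence with respect to each of them, and the bound survives up
  to an arbitrary \<open>e\<close>.\<close>

lemma measure_diff_le_sigma_algebra:
  assumes alg: "algebra \<Omega> A"
    and M: "finite_measure M" "space M = \<Omega>" "sets M = sigma_sets \<Omega> A"
    and N: "finite_measure N" "space N = \<Omega>" "sets N = sigma_sets \<Omega> A"
    and le: "\<And>B. B \<in> A \<Longrightarrow> \<bar>measure M B - measure N B\<bar> \<le> d"
    and S: "S \<in> sigma_sets \<Omega> A"
  shows "\<bar>measure M S - measure N S\<bar> \<le> d"
proof (rule field_le_epsilon)
  fix e :: real assume e: "e > 0"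
  interpret M: finite_measure M by fact
  interpret N: finite_measure N by fact
  interpret algebra \<Omega> A by fact
  define P where "P = measure_of \<Omega> (sigma_sets \<Omega> A) (\<lambda>X. emeasure M X + emeasure N X)"
  have sub: "sigma_sets \<Omega> A \<subseteq> Pow \<Omega>"
    by (metis M(2,3) sets.space_closed)
  have setsP: "sets P = sigma_sets \<Omega> A" "space P = \<Omega>"
    unfolding P_def using sub M(3) sets.sigma_sets_eq[of M] M(2) by (auto simp: sets_measure_of space_measure_of)
  have emP: "emeasure P X = emeasure M X + emeasure N X" if "X \<in> sigma_sets \<Omega> A" for X
  proof (rule emeasure_measure_of[OF P_def sub])
    show "positive (sets P) (\<lambda>X. emeasure M X + emeasure N X)" by (auto simp: positive_def)
    show "countably_additive (sets P) (\<lambda>X. emeasure M X + emeasure N X)"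
      unfolding countably_additive_def setsP
      by (auto simp: suminf_add[symmetric] suminf_emeasure M(3) N(3))
    show "X \<in> sets P" using that setsP by simp
  qed
  have fP: "finite_measure P"
    by (rule finite_measureI) (use emP[of \<Omega>] M N setsP M.emeasure_finite N.emeasure_finite in \<open>auto simp: top\<close>)
  interpret P: finite_measure P by fact
  obtain B where B: "B \<in> A" "measure P (sym_diff S B) < e"
    using algebra_approximation[OF alg fP setsP(2,1) S e] by blast
  have BS: "B \<in> sets M" "S \<in> sets M" "B \<in> sets N" "S \<in> sets N" using B S M N by auto
  have sd: "sym_diff S B \<in> sigma_sets \<Omega> A" using BS M(3) by (metis sets.Diff sets.Un)
  have "measure P (sym_diff S B) = measure M (sym_diff S B) + measure N (sym_diff S B)"
    using emP[OF sd] by (simp add: M.emeasure_eq_measure N.emeasure_eq_measure P.emeasure_eq_measure 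
        flip: ennreal_plus)
  moreover have "\<bar>measure M S - measure M B\<bar> \<le> measure M (sym_diff S B)"
    "\<bar>measure N S - measure N B\<bar> \<le> measure N (sym_diff S B)"
    using BS by (auto intro!: M.measure_diff_le_sym_diff N.measure_diff_le_sym_diff)
  ultimately show "\<bar>measure M S - measure N S\<bar> \<le> d + e"
    using le[OF B(1)] B(2) by linarith
qed

text \<open>The factors are exchanged one at a time through the mixed product of \<open>M1\<close>
  and \<open>N2\<close>. Each exchange integrates a difference over sections that is bounded
  pointwise.\<close>

lemma pair_measure_diff_le:
  assumes "prob_space M1" "prob_space N1" "prob_space M2" "prob_space N2"
    and sets [measurable_cong]: "sets N1 = sets M1" "sets N2 = sets M2"
    and d1: "\<And>A. A \<in> sets M1 \<Longrightarrow> \<bar>measure M1 A - measure N1 A\<bar> \<le> d1"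
    and d2: "\<And>A. A \<in> sets M2 \<Longrightarrow> \<bar>measure M2 A - measure N2 A\<bar> \<le> d2"
    and S [measurable]: "S \<in> sets (M1 \<Otimes>\<^sub>M M2)"
  shows "\<bar>measure (M1 \<Otimes>\<^sub>M M2) S - measure (N1 \<Otimes>\<^sub>M N2) S\<bar> \<le> d1 + d2"
proof -
  interpret M1: prob_space M1 by fact
  interpret N1: prob_space N1 by fact
  interpret M2: prob_space M2 by fact
  interpret N2: prob_space N2 by fact
  interpret A: pair_prob_space M1 M2 ..
  interpret B: pair_prob_space N1 N2 ..
  interpret C: pair_prob_space M1 N2 ..
  have SC: "S \<in> sets (M1 \<Otimes>\<^sub>M N2)" "S \<in> sets (N1 \<Otimes>\<^sub>M N2)"
    using S sets_pair_measure_cong[OF refl sets(2), of M1] sets_pair_measure_cong[OF sets] by auto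
  have sp: "space N1 = space M1" "space N2 = space M2"
    using sets sets_eq_imp_space_eq by blast+
  have m1 [measurable]: "(\<lambda>x. measure M2 (Pair x -` S)) \<in> borel_measurable M1"
    "(\<lambda>x. measure N2 (Pair x -` S)) \<in> borel_measurable M1"
    using M2.measurable_emeasure_Pair[OF S] N2.measurable_emeasure_Pair[OF SC(1)] unfolding measure_def by auto
  have m2 [measurable]: "(\<lambda>y. measure M1 ((\<lambda>x. (x, y)) -` S)) \<in> borel_measurable N2"
    "(\<lambda>y. measure N1 ((\<lambda>x. (x, y)) -` S)) \<in> borel_measurable N2"
    using C.measurable_emeasure_Pair2[OF SC(1)] B.measurable_emeasure_Pair2[OF SC(2)] unfolding measure_def by auto
  have e1: "measure (M1 \<Otimes>\<^sub>M M2) S = (\<integral>x. measure M2 (Pair x -` S) \<partial>M1)"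
    using M2.emeasure_pair_measure_alt[OF S]
    by (simp add: M2.emeasure_eq_measure A.emeasure_eq_measure measure_nonneg integral_eq_nn_integral)
      (metis enn2real_ennreal measure_nonneg)
  have e2: "measure (M1 \<Otimes>\<^sub>M N2) S = (\<integral>x. measure N2 (Pair x -` S) \<partial>M1)"
    using N2.emeasure_pair_measure_alt[OF SC(1)]
    by (simp add: N2.emeasure_eq_measure C.emeasure_eq_measure measure_nonneg integral_eq_nn_integral)
      (metis enn2real_ennreal measure_nonneg)
  have e3: "measure (M1 \<Otimes>\<^sub>M N2) S = (\<integral>y. measure M1 ((\<lambda>x. (x, y)) -` S) \<partial>N2)"
    using C.emeasure_pair_measure_alt2[OF SC(1)]
    by (simp add: M1.emeasure_eq_measure C.emeasure_eq_measure measure_nonneg integral_eq_nn_integral)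
      (metis enn2real_ennreal measure_nonneg)
  have e4: "measure (N1 \<Otimes>\<^sub>M N2) S = (\<integral>y. measure N1 ((\<lambda>x. (x, y)) -` S) \<partial>N2)"
    using B.emeasure_pair_measure_alt2[OF SC(2)]
    by (simp add: N1.emeasure_eq_measure B.emeasure_eq_measure measure_nonneg integral_eq_nn_integral)
      (metis enn2real_ennreal measure_nonneg)
  have i1: "integrable M1 (\<lambda>x. measure M2 (Pair x -` S))" "integrable M1 (\<lambda>x. measure N2 (Pair x -` S))"
    by (auto intro!: M1.integrable_const_bound[where B=1])
  have i2: "integrable N2 (\<lambda>y. measure M1 ((\<lambda>x. (x, y)) -` S))" "integrable N2 (\<lambda>y. measure N1 ((\<lambda>x. (x, y)) -` S))"
    by (auto intro!: N2.integrable_const_bound[where B=1])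
  have "\<bar>measure (M1 \<Otimes>\<^sub>M M2) S - measure (M1 \<Otimes>\<^sub>M N2) S\<bar>
      = \<bar>\<integral>x. measure M2 (Pair x -` S) - measure N2 (Pair x -` S) \<partial>M1\<bar>"
    unfolding e1 e2 using i1 by simp
  also have "\<dots> \<le> (\<integral>x. \<bar>measure M2 (Pair x -` S) - measure N2 (Pair x -` S)\<bar> \<partial>M1)"
    by (rule integral_abs_bound)
  also have "\<dots> \<le> (\<integral>x. d2 \<partial>M1)"
    using i1 by (intro integral_mono d2 sets_Pair1[OF S]) auto
  finally have 1: "\<bar>measure (M1 \<Otimes>\<^sub>M M2) S - measure (M1 \<Otimes>\<^sub>M N2) S\<bar> \<le> d2" 
    by (simp add: M1.prob_space)
  have "\<bar>measure (M1 \<Otimes>\<^sub>M N2) S - measure (N1 \<Otimes>\<^sub>M N2) S\<bar>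
      = \<bar>\<integral>y. measure M1 ((\<lambda>x. (x, y)) -` S) - measure N1 ((\<lambda>x. (x, y)) -` S) \<partial>N2\<bar>"
    unfolding e3 e4 using i2 by simp
  also have "\<dots> \<le> (\<integral>y. \<bar>measure M1 ((\<lambda>x. (x, y)) -` S) - measure N1 ((\<lambda>x. (x, y)) -` S)\<bar> \<partial>N2)"
    by (rule integral_abs_bound)
  also have "\<dots> \<le> (\<integral>y. d1 \<partial>N2)"
    using i2 by (intro integral_mono d1 sets_Pair2[OF S]) auto
  finally have 2: "\<bar>measure (M1 \<Otimes>\<^sub>M N2) S - measure (N1 \<Otimes>\<^sub>M N2) S\<bar> \<le> d1"
    by (simp add: N2.prob_space)
  from 1 2 show ?thesis by linarith
qed

lemma PiM_measure_diff_le: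
  assumes "finite I"
    and "\<And>i. i \<in> I \<Longrightarrow> prob_space (M i)" "\<And>i. i \<in> I \<Longrightarrow> prob_space (N i)"
    and sets: "\<And>i. i \<in> I \<Longrightarrow> sets (N i) = sets (M i)"
    and d: "\<And>i A. i \<in> I \<Longrightarrow> A \<in> sets (M i) \<Longrightarrow> \<bar>measure (M i) A - measure (N i) A\<bar> \<le> d i"
    and S: "S \<in> sets (PiM I M)"
  shows "\<bar>measure (PiM I M) S - measure (PiM I N) S\<bar> \<le> (\<Sum>i\<in>I. d i)"
  using assms
proof (induction I arbitrary: S)
  case empty
  then show ?case by (auto simp: PiM_empty)
next
  case (insert i I)
  let ?g = "\<lambda>(x, X). X(i := x)"
  have PI: "prob_space (PiM I M)" "prob_space (PiM I N)"
    using insert.prems by (auto intro!: prob_space_PiM)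
  have setsP: "sets (PiM I N) = sets (PiM I M)"
    using insert.prems by (intro sets_PiM_cong) auto
  have gM: "?g \<in> M i \<Otimes>\<^sub>M PiM I M \<rightarrow>\<^sub>M PiM (insert i I) M"
    by measurable
  have gN: "?g \<in> N i \<Otimes>\<^sub>M PiM I N \<rightarrow>\<^sub>M PiM (insert i I) N"
    by measurable
  have SN: "S \<in> sets (PiM (insert i I) N)"
    using insert.prems sets_PiM_cong[of "insert i I" "insert i I" M N] by auto
  have sp: "space (N i \<Otimes>\<^sub>M PiM I N) = space (M i \<Otimes>\<^sub>M PiM I M)"
    using insert.prems by (intro sets_eq_imp_space_eq sets_pair_measure_cong setsP) auto
  have "measure (PiM (insert i I) M) S = measure (M i \<Otimes>\<^sub>M PiM I M) (?g -` S \<inter> space (M i \<Otimes>\<^sub>M PiM I M))"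
    using distr_pair_PiM_eq_PiM[of I M i] insert.prems by (metis gM insertI1 insertI2 measure_distr)
  moreover have "measure (PiM (insert i I) N) S = measure (N i \<Otimes>\<^sub>M PiM I N) (?g -` S \<inter> space (M i \<Otimes>\<^sub>M PiM I M))"
    using distr_pair_PiM_eq_PiM[of I N i] insert.prems SN sp by (metis gN insertI1 insertI2 measure_distr)
  moreover have "\<bar>measure (M i \<Otimes>\<^sub>M PiM I M) (?g -` S \<inter> space (M i \<Otimes>\<^sub>M PiM I M))
    - measure (N i \<Otimes>\<^sub>M PiM I N) (?g -` S \<inter> space (M i \<Otimes>\<^sub>M PiM I M))\<bar> \<le> d i + (\<Sum>i\<in>I. d i)"
    using insert.prems PI setsP
    by (intro pair_measure_diff_le insert.IH measurable_sets[OF gM]) auto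
  ultimately show ?case
    using insert.hyps by simp
qed

text \<open>Unlike \<^const>\<open>poisson_pmf\<close>, this includes the rate \<open>0\<close>.\<close>

definition poi :: "real \<Rightarrow> nat pmf" where
  "poi a = (if 0 < a then poisson_pmf a else return_pmf 0)"

lemma pmf_poi: "0 \<le> a \<Longrightarrow> pmf (poi a) k = a ^ k / fact k * exp (- a)"
  by (cases "k = 0") (auto simp: poi_def indicator_def)

text \<open>Pointwise \<open>exp (- (b - a)) * pmf (poi a) k \<le> pmf (poi b) k\<close>, because
  \<open>a ^ k \<le> b ^ k\<close>. Summation over \<open>A\<close> and
  \<open>exp (- x) \<ge> 1 - x\<close> give one side; the same estimate for \<open>- A\<close> gives
  the other.\<close>

lemma poi_diff_le:
  assumes "0 \<le> a" "a \<le> b"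
  shows "\<bar>measure (poi a) A - measure (poi b) A\<bar> \<le> b - a"
proof -
  have *: "measure (poi a) A - (b - a) \<le> measure (poi b) A" for A
  proof -
    have le: "exp (- (b - a)) * pmf (poi a) k \<le> pmf (poi b) k" for k
    proof -
      have "exp (- (b - a)) * pmf (poi a) k = a ^ k / fact k * exp (- b)"
        using assms by (simp add: pmf_poi exp_diff exp_minus field_simps)
      also have "\<dots> \<le> b ^ k / fact k * exp (- b)"
        using assms by (intro mult_right_mono divide_right_mono power_mono) auto
      finally show ?thesis using assms by (simp add: pmf_poi)
    qed
    have "ennreal (exp (- (b - a))) * emeasure (poi a) A
      = (\<integral>\<^sup>+k. ennreal (exp (- (b - a)) * pmf (poi a) k) * indicator A k \<partial>count_space UNIV)"
      by (subst nn_integral_indicator[symmetric], simp)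
        (simp add: nn_integral_measure_pmf nn_integral_cmult[symmetric] ennreal_mult mult.assoc)
    also have "\<dots> \<le> (\<integral>\<^sup>+k. ennreal (pmf (poi b) k) * indicator A k \<partial>count_space UNIV)"
      using le by (intro nn_integral_mono mult_right_mono ennreal_leI) auto
    also have "\<dots> = emeasure (poi b) A"
      by (subst nn_integral_indicator[symmetric], simp) (simp add: nn_integral_measure_pmf)
    finally have "exp (- (b - a)) * measure (poi a) A \<le> measure (poi b) A"
      by (simp add: measure_pmf.emeasure_eq_measure flip: ennreal_mult)
    moreover have "(1 - (b - a)) * measure (poi a) A \<le> exp (- (b - a)) * measure (poi a) A"
      using exp_ge_add_one_self[of "- (b - a)"] by (intro mult_right_mono) (simp_all del: minus_diff_eq)
    moreover have "(b - a) * measure (poi a) A \<le> (b - a) * 1"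
      using assms by (intro mult_left_mono) auto
    ultimately show ?thesis by (simp add: algebra_simps)
  qed
  have "measure (poi a) (-A) = 1 - measure (poi a) A" for a
    using measure_pmf.prob_compl[of A "poi a"] by (simp add: Compl_eq_Diff_UNIV)
  with *[of A] *[of "-A"] show ?thesis by auto
qed

lemma nn_integral_poi: "0 \<le> a \<Longrightarrow> (\<integral>\<^sup>+k. of_nat k \<partial>measure_pmf (poi a)) = ennreal a"
proof -
  assume a: "0 \<le> a"
  have "(\<integral>\<^sup>+k. of_nat k \<partial>measure_pmf (poi a)) = (\<Sum>k. ennreal (a ^ k / fact k * exp (- a) * real k))"
    using a by (simp add: nn_integral_measure_pmf nn_integral_count_space_nat pmf_poi
       ennreal_mult' ennreal_of_nat_eq_real_of_nat del: times_divide_eq_left times_divide_eq_right)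
  also have "\<dots> = ennreal a"
  proof (rule suminf_ennreal_eq)
    have "(\<lambda>k. a ^ k /\<^sub>R fact k) sums exp a" by (rule exp_converges)
    then have "(\<lambda>k. (a * exp (- a)) * (a ^ k / fact k)) sums ((a * exp (- a)) * exp a)"
      by (intro sums_mult) (simp add: field_simps)
    moreover have "(a * exp (- a)) * (a ^ k / fact k) = a ^ Suc k / fact (Suc k) * exp (- a) * real (Suc k)" for k
    proof -
      have "x * e * (y / F) = x * y / ((real k + 1) * F) * e * (real k + 1)" if "F > 0" for x y e F :: real
        using that by (simp add: divide_simps)
      from this[of "fact k" a "exp (- a)" "a ^ k"] show ?thesis
        by (simp add: algebra_simps)
    qed
    moreover have "(a * exp (- a)) * exp a = a"
      by (simp add: mult.assoc flip: exp_add)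
    ultimately show "(\<lambda>k. a ^ k / fact k * exp (- a) * real k) sums a"
      using sums_Suc_iff[of "\<lambda>k. a ^ k / fact k * exp (- a) * real k" a] by (simp only:) simp
  qed (use a in auto)
  finally show ?thesis .
qed

text \<open>For \<open>m < k\<close> the value \<open>k\<close> is at most
  \<open>k * (k - 1) / m\<close>, and the second factorial moment of the Poisson distribution is the
  square of \<open>a\<close>. This controls the expected count on the event that there are too many
  candidate cells.\<close>

lemma nn_integral_poi_tail:
  assumes a: "0 \<le> a" and m: "0 < m"
  shows "(\<integral>\<^sup>+k. (if m < k then of_nat k else 0) \<partial>measure_pmf (poi a)) \<le> ennreal (a\<^sup>2 / real m)"
proof -
  have "(\<integral>\<^sup>+k. (if m < k then of_nat k else 0) \<partial>measure_pmf (poi a))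
    \<le> (\<integral>\<^sup>+k. ennreal (1 / real m * (real k * (real k - 1))) \<partial>measure_pmf (poi a))"
  proof (rule nn_integral_mono)
    fix k :: nat
    show "(if m < k then of_nat k else 0) \<le> ennreal (1 / real m * (real k * (real k - 1)))"
    proof (cases "m < k")
      case True
      then have "real m * real k \<le> (real k - 1) * real k" using m by (intro mult_right_mono) auto
      then show ?thesis
        using True m by (simp add: ennreal_of_nat_eq_real_of_nat field_simps)
    qed auto
  qed
  also have "\<dots> = (\<Sum>k. ennreal (a ^ k / fact k * exp (- a) * (1 / real m * (real k * (real k - 1)))))"
    using a by (simp add: nn_integral_measure_pmf nn_integral_count_space_nat pmf_poi ennreal_mult'[symmetric])
  also have "\<dots> = ennreal (a\<^sup>2 / real m)"
  proof (rule suminf_ennreal_eq)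
    have "(\<lambda>k. a ^ k /\<^sub>R fact k) sums exp a" by (rule exp_converges)
    then have "(\<lambda>k. (a\<^sup>2 / real m * exp (- a)) * (a ^ k / fact k)) sums ((a\<^sup>2 / real m * exp (- a)) * exp a)"
      by (intro sums_mult) (simp add: field_simps)
    moreover have "(a\<^sup>2 / real m * exp (- a)) * exp a = a\<^sup>2 / real m"
      by (simp add: mult.assoc flip: exp_add)
    ultimately have "(\<lambda>k. (a\<^sup>2 / real m * exp (- a)) * (a ^ k / fact k)) sums (a\<^sup>2 / real m)"
      by (simp only:)
    moreover have "(a\<^sup>2 / real m * exp (- a)) * (a ^ k / fact k) = a ^ Suc (Suc k) / fact (Suc (Suc k)) * exp (- a) *
        (1 / real m * (real (Suc (Suc k)) * (real (Suc (Suc k)) - 1)))" for k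
    proof -
      have "x / real m * e * (y / F) =
          x * y / ((real k + 2) * (real k + 1) * F) * e * (1 / real m * ((real k + 2) * (real k + 1)))"
        if "F > 0" for x y e F :: real
        using m that by (simp add: divide_simps)
      from this[of "fact k" "a\<^sup>2" "exp (- a)" "a ^ k"] show ?thesis
        by (simp add: power2_eq_square algebra_simps)
    qed
    ultimately have "(\<lambda>k. a ^ Suc (Suc k) / fact (Suc (Suc k)) * exp (- a) *
        (1 / real m * (real (Suc (Suc k)) * (real (Suc (Suc k)) - 1)))) sums (a\<^sup>2 / real m)"
      by simp
    \<comment> \<open>The terms for \<open>k = 0\<close> and \<open>k = 1\<close> vanish, so the
      series may be shifted by two.\<close>
    then show "(\<lambda>k. a ^ k / fact k * exp (- a) * (1 / real m * (real k * (real k - 1)))) sums (a\<^sup>2 / real m)"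
      by (subst (asm) sums_Suc_iff, subst (asm) sums_Suc_iff) simp
    fix k :: nat
    show "0 \<le> a ^ k / fact k * exp (- a) * (1 / real m * (real k * (real k - 1)))"
      using a by (cases k) auto
  qed
  finally show ?thesis .
qed

text \<open>The usual sigma-algebra on counting measures, generated by the counts of Borel sets,
  carried over to supports.\<close>

definition configs :: "'b::topological_space set measure" where
  "configs = sigma UNIV {{X. points_in B X \<in> V} | B V. B \<in> sets borel \<and> V \<in> sets borel}"

lemma space_configs [simp]: "space configs = UNIV"
  by (simp add: configs_def)

lemma sets_configs: 
  "sets configs = sigma_sets UNIV {{X. points_in B X \<in> V} | B V. B \<in> sets borel \<and> V \<in> sets borel}"
  by (simp add: configs_def)

lemma measurable_points_in [measurable]:
  "B \<in> sets borel \<Longrightarrow> points_in B \<in> borel_measurable configs"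
  by (rule measurableI) (auto simp: sets_configs vimage_def intro!: sigma_sets.Basic)

lemma measurable_configsI:
  fixes X :: "'w \<Rightarrow> 'b::topological_space set"
  assumes "\<And>B. B \<in> sets borel \<Longrightarrow> (\<lambda>\<omega>. points_in B (X \<omega>)) \<in> borel_measurable M"
  shows "X \<in> M \<rightarrow>\<^sub>M configs"
  unfolding configs_def
proof (rule measurable_measure_of)
  fix A :: "'b set set" assume "A \<in> {{X. points_in B X \<in> V} | B V. B \<in> sets borel \<and>
      V \<in> sets (borel :: ennreal measure)}"
  then obtain B V where "A = {X. points_in B X \<in> V}" "B \<in> sets borel" "V \<in> sets (borel :: ennreal measure)" by blast
  then show "X -` A \<inter> space M \<in> sets M"
    using measurable_sets[OF assms, of B V] by (simp add: vimage_def)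
qed auto

lemma points_in_Int: "points_in B (X \<inter> K) = points_in (K \<inter> B) X"
  by (simp add: points_in_def Int_assoc)

lemma measurable_Int_configs [measurable]:
  "K \<in> sets borel \<Longrightarrow> (\<lambda>X. X \<inter> K) \<in> configs \<rightarrow>\<^sub>M configs"
  by (rule measurable_configsI) (simp add: points_in_Int)

lemma points_in_eq_sum:
  assumes "finite I" "disjoint_family_on B I" "C \<inter> X = (\<Union>i\<in>I. B i) \<inter> X"
  shows "points_in C X = (\<Sum>i\<in>I. points_in (B i) X)"
proof -
  have "points_in C X = emeasure (count_space UNIV) (\<Union>i\<in>I. X \<inter> B i)"
    using assms(3) by (auto simp: points_in_def intro!: arg_cong[where f="emeasure _"])
  also have "\<dots> = (\<Sum>i\<in>I. points_in (B i) X)"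
    unfolding points_in_def
    by (intro sum_emeasure[symmetric] assms) (use assms in \<open>auto simp: disjoint_family_on_def\<close>)
  finally show ?thesis .
qed

section \<open>Distribution of the counts of a Poisson process\<close>

context
  fixes M :: "'w measure" and X :: "'w \<Rightarrow> 'b::topological_space set" and \<Lambda> :: "'b measure"
  assumes PP: "poisson_process M X \<Lambda>" and sets_L: "sets \<Lambda> = sets borel"
begin

lemma poisson_prob_space: "prob_space M"
  using PP by (simp add: poisson_process_def)

lemma poisson_countable: "\<omega> \<in> space M \<Longrightarrow> countable (X \<omega>)"
  using PP by (simp add: poisson_process_def)

lemma poisson_measurable [measurable]: "X \<in> M \<rightarrow>\<^sub>M configs"
  using PP sets_L by (intro measurable_configsI) (auto simp: poisson_process_def)

lemma poisson_indep:
  fixes m :: nat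
  assumes "\<And>i. i < m \<Longrightarrow> B i \<in> sets borel" "disjoint_family_on B {..<m}"
  shows "prob_space.indep_vars M (\<lambda>_. borel) (\<lambda>i \<omega>. points_in (B i) (X \<omega>)) {..<m}"
proof -
  have "\<And>m B. (\<forall>i<m. B i \<in> sets \<Lambda>) \<and> disjoint_family_on B {..<m} \<Longrightarrow>
      prob_space.indep_vars M (\<lambda>_. borel) (\<lambda>i \<omega>. points_in (B i) (X \<omega>)) {..<m::nat}"
    using PP unfolding poisson_process_def by blast
  then show ?thesis using assms sets_L by simp
qed

lemma poisson_infinite:
  assumes "B \<in> sets borel" "emeasure \<Lambda> B = \<infinity>"
  shows "AE \<omega> in M. points_in B (X \<omega>) = \<infinity>"
  using PP sets_L assms by (auto simp: poisson_process_def)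

text \<open>\<open>poisson_process\<close> prescribes the probabilities of the finite counts. Summed
  over the counts in \<open>V\<close> they give an inequality, and likewise for \<open>- V\<close>;
  both sides having total mass 1, equality follows. In particular an infinite count has probability
  0.\<close>

lemma poisson_distr:
  assumes B: "B \<in> sets borel" and fin: "emeasure \<Lambda> B < \<infinity>"
  shows "distr M borel (\<lambda>\<omega>. points_in B (X \<omega>)) = distr (measure_pmf (poi (measure \<Lambda> B))) borel of_nat"
proof (rule measure_eqI)
  interpret prob_space M by (rule poisson_prob_space)
  note B [measurable]
  let ?c = "\<lambda>\<omega>. points_in B (X \<omega>)" and ?p = "poi (measure \<Lambda> B)"
  have c [measurable]: "?c \<in> borel_measurable M" 
    using measurable_compose[OF poisson_measurable measurable_points_in[OF B]] .
  have le: "measure ?p {k. of_nat k \<in> V} \<le> prob {\<omega> \<in> space M. ?c \<omega> \<in> V}" if [measurable]: "V \<in> sets borel"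
      for V :: "ennreal set"
  proof -
    let ?K = "{k::nat. of_nat k \<in> V}"
    have "emeasure ?p ?K = (\<integral>\<^sup>+k. emeasure M {\<omega> \<in> space M. ?c \<omega> = of_nat k} \<partial>count_space ?K)"
      using PP B fin sets_L 
      by (simp add: nn_integral_pmf[symmetric] pmf_poi emeasure_eq_measure poisson_process_def)
    also have "\<dots> = emeasure M (\<Union>k\<in>?K. {\<omega> \<in> space M. ?c \<omega> = of_nat k})"
      by (intro emeasure_UN_countable[symmetric]) (auto simp: disjoint_family_on_def)
    also have "\<dots> \<le> emeasure M {\<omega> \<in> space M. ?c \<omega> \<in> V}"
      by (intro emeasure_mono) auto
    finally show ?thesis
      by (simp add: emeasure_eq_measure measure_pmf.emeasure_eq_measure)
  qed
  fix V :: "ennreal set" assume "V \<in> sets (distr M borel ?c)"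
  then have V [measurable]: "V \<in> sets borel" by simp
  have "prob {\<omega> \<in> space M. ?c \<omega> \<in> - V} = 1 - prob {\<omega> \<in> space M. ?c \<omega> \<in> V}"
  proof -
    have "{\<omega> \<in> space M. ?c \<omega> \<in> - V} = space M - {\<omega> \<in> space M. ?c \<omega> \<in> V}" by auto
    then show ?thesis by (simp add: prob_compl)
  qed
  moreover have "measure ?p {k. of_nat k \<in> - V} = 1 - measure ?p {k. of_nat k \<in> V}"
    using measure_pmf.prob_compl[of "{k. of_nat k \<in> V}" ?p] by (simp add: set_diff_eq)
  ultimately have "prob {\<omega> \<in> space M. ?c \<omega> \<in> V} = measure ?p {k. of_nat k \<in> V}"
    using le[of V] le[of "- V"] V by auto
  then show "emeasure (distr M borel ?c) V = emeasure (distr ?p borel of_nat) V"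
    by (simp add: emeasure_distr vimage_def emeasure_eq_measure measure_pmf.emeasure_eq_measure Int_def conj_commute)
qed simp

lemma poisson_nn_integral:
  assumes B: "B \<in> sets borel" "emeasure \<Lambda> B < \<infinity>" and g [measurable]: "g \<in> borel_measurable borel"
  shows "(\<integral>\<^sup>+\<omega>. g (points_in B (X \<omega>)) \<partial>M) = (\<integral>\<^sup>+k. g (of_nat k) \<partial>measure_pmf (poi (measure \<Lambda> B)))"
proof -
  note B(1) [measurable]
  have c [measurable]: "(\<lambda>\<omega>. points_in B (X \<omega>)) \<in> borel_measurable M" 
    using measurable_compose[OF poisson_measurable measurable_points_in[OF B(1)]] .
  have "(\<integral>\<^sup>+\<omega>. g (points_in B (X \<omega>)) \<partial>M) = (\<integral>\<^sup>+x. g x \<partial>distr M borel (\<lambda>\<omega>. points_in B (X \<omega>)))"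
    by (simp add: nn_integral_distr)
  then show ?thesis
    unfolding poisson_distr[OF B] by (simp add: nn_integral_distr)
qed

lemma poisson_mean:
  assumes B: "B \<in> sets borel" "emeasure \<Lambda> B < \<infinity>"
  shows "(\<integral>\<^sup>+\<omega>. points_in B (X \<omega>) \<partial>M) = emeasure \<Lambda> B"
  using poisson_nn_integral[OF B, of "\<lambda>x. x"] B by (simp add: nn_integral_poi emeasure_eq_ennreal_measure)

lemma poisson_void:
  assumes B: "B \<in> sets borel" "emeasure \<Lambda> B < \<infinity>"
  shows "measure M {\<omega> \<in> space M. points_in B (X \<omega>) = 0} = exp (- measure \<Lambda> B)"
  using PP sets_L B by (auto simp: poisson_process_def dest!: spec[of _ 0] bspec[of _ _ B])

lemma poisson_AE_finite:
  assumes B: "B \<in> sets borel" "emeasure \<Lambda> B < \<infinity>"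
  shows "AE \<omega> in M. points_in B (X \<omega>) < \<infinity>"
proof -
  note B(1) [measurable]
  have c [measurable]: "(\<lambda>\<omega>. points_in B (X \<omega>)) \<in> borel_measurable M" 
    using measurable_compose[OF poisson_measurable measurable_points_in[OF B(1)]] .
  show ?thesis
    using nn_integral_noteq_infinite[OF c] poisson_mean[OF B] B by (auto simp: less_top)
qed

end

text \<open>The bound is first shown for events that depend on the counts of finitely many sets. Passing to the atoms
  of these sets, both laws become products of Poisson distributions.\<close>

lemma poisson_law_diff_le:
  fixes X :: "'w \<Rightarrow> 'b::topological_space set" and Y :: "'v \<Rightarrow> 'b set"
  assumes PX: "poisson_process M X L1" and PY: "poisson_process N Y L2"
    and sets_L1: "sets L1 = sets borel" and sets_L2: "sets L2 = sets borel"
    and K [measurable]: "K \<in> sets borel" and fin: "emeasure L1 K < \<infinity>" "emeasure L2 K < \<infinity>"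
    and sets_D: "sets D = sets borel" and finD: "emeasure D K < \<infinity>"
    and le: "\<And>B. B \<in> sets borel \<Longrightarrow> B \<subseteq> K \<Longrightarrow> \<bar>measure L1 B - measure L2 B\<bar> \<le> measure D B"
    and S: "S \<in> sets configs"
  shows "\<bar>measure M {\<omega> \<in> space M. X \<omega> \<inter> K \<in> S} - measure N {\<omega> \<in> space N. Y \<omega> \<inter> K \<in> S}\<bar> \<le> measure D K"
proof -
  interpret M: prob_space M using PX by (rule poisson_prob_space) fact
  interpret N: prob_space N using PY by (rule poisson_prob_space) fact
  have X [measurable]: "X \<in> M \<rightarrow>\<^sub>M configs" using PX sets_L1 by (rule poisson_measurable)
  have Y [measurable]: "Y \<in> N \<rightarrow>\<^sub>M configs" using PY sets_L2 by (rule poisson_measurable)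
  \<comment> \<open>\<open>gen C\<close> generates the events that depend on the counts of the sets
    in \<open>C\<close>. Over all finite \<open>C\<close> these events form the algebra
    \<open>A\<close>, because two finite families have a common finite extension.\<close>
  define gen where "gen C = {{Z :: 'b set. points_in B Z \<in> V} | B V. B \<in> C \<and> V \<in> sets borel}" for C
  define A where "A = (\<Union>C\<in>{C. finite C \<and> C \<subseteq> sets borel}. sigma_sets UNIV (gen C))"
  have genI: "sigma_algebra UNIV (sigma_sets UNIV (gen C))" for C
    by (rule sigma_algebra_sigma_sets) auto
  have genU: "sigma_sets UNIV (gen C) \<subseteq> sigma_sets UNIV (gen C')" if "C \<subseteq> C'" for C C'
    using that by (intro sigma_sets_mono') (auto simp: gen_def)
  have alg: "algebra UNIV A"
    unfolding algebra_iff_Un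
  proof (intro conjI ballI)
    show "{} \<in> A" unfolding A_def by (auto intro!: exI[of _ "{}"] sigma_sets.Empty)
  next
    fix a assume "a \<in> A" then show "UNIV - a \<in> A" 
      unfolding A_def by (auto intro: sigma_sets.Compl)
  next
    fix a b assume "a \<in> A" "b \<in> A"
    then obtain C C' where C: "finite C" "C \<subseteq> sets borel" "finite C'" "C' \<subseteq> sets borel" 
      "a \<in> sigma_sets UNIV (gen C)" "b \<in> sigma_sets UNIV (gen C')"
      unfolding A_def by blast
    then have "a \<in> sigma_sets UNIV (gen (C \<union> C'))" "b \<in> sigma_sets UNIV (gen (C \<union> C'))"
      using genU[of C "C \<union> C'"] genU[of C' "C \<union> C'"] by blast+
    then have "a \<union> b \<in> sigma_sets UNIV (gen (C \<union> C'))"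
      by (rule sigma_sets_Un)
    then show "a \<union> b \<in> A" unfolding A_def using C by (intro UN_I[of "C \<union> C'"]) auto
  qed auto
  have gen_configs: "sets configs = sigma_sets UNIV (gen (sets borel))"
    unfolding sets_configs gen_def ..
  have sigma_A: "sets configs = sigma_sets UNIV A"
  proof
    have "gen (sets borel) \<subseteq> A"
    proof
      fix a assume "a \<in> gen (sets borel)"
      then obtain B V where "a = {Z. points_in B Z \<in> V}" "B \<in> sets borel" "V \<in> sets borel"
        unfolding gen_def by blast
      then show "a \<in> A" unfolding A_def gen_def 
        by (intro UN_I[of "{B}"]) (auto intro!: sigma_sets.Basic)
    qed
    then show "sets configs \<subseteq> sigma_sets UNIV A"
      unfolding gen_configs by (rule sigma_sets_mono')
    have "A \<subseteq> sets configs"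
      unfolding A_def gen_configs using genU by blast
    then show "sigma_sets UNIV A \<subseteq> sets configs"
      by (metis sets.sigma_sets_subset space_configs)
  qed
  have fin_law: "finite_measure (distr M configs (\<lambda>\<omega>. X \<omega> \<inter> K))" "finite_measure (distr N configs (\<lambda>\<omega>. Y \<omega> \<inter> K))"
    by (intro prob_space.finite_measure M.prob_space_distr N.prob_space_distr; measurable)+
  have bound: "\<bar>measure (distr M configs (\<lambda>\<omega>. X \<omega> \<inter> K)) b - measure (distr N configs (\<lambda>\<omega>. Y \<omega> \<inter> K)) b\<bar> \<le> measure D K"
    if "b \<in> A" for b
  proof -
    from that obtain C where C: "finite C" "C \<subseteq> sets borel" and b: "b \<in> sigma_sets UNIV (gen C)"
      unfolding A_def by blast
    have b_sets [measurable]: "b \<in> sets configs" using \<open>b \<in> A\<close> sigma_A by auto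
    obtain h where h: "bij_betw h {..<card (Pow C)} (Pow C)"
      using ex_bij_betw_nat_finite[of "Pow C"] C by (auto simp: atLeast0LessThan)
    define m where "m = card (Pow C)"
    note h = h[folded m_def]
    \<comment> \<open>The characterisation of independence by a product law is stated for a nonempty
      index set; \<open>Pow C\<close> always contains the empty set.\<close>
    have m: "{..<m} \<noteq> {}" using C unfolding m_def by (auto simp: card_Pow lessThan_empty_iff)
    \<comment> \<open>\<open>h\<close> enumerates the subsets of \<open>C\<close>, and
      \<open>a i\<close> is the atom of those points of \<open>K\<close> that lie in exactly the
      members of \<open>C\<close> belonging to \<open>h i\<close>.\<close>
    define a where "a i = K \<inter> {x. \<forall>c\<in>C. x \<in> c \<longleftrightarrow> c \<in> h i}" for i
    have a_sets [measurable]: "a i \<in> sets borel" for i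
    proof -
      have "a i = K \<inter> (\<Inter>c\<in>C. if c \<in> h i then c else - c) \<inter> UNIV"
        unfolding a_def by auto
      moreover have "(\<Inter>c\<in>C. if c \<in> h i then c else - c) \<in> sets borel"
      proof (cases "C = {}")
        case False
        then show ?thesis using C by (intro sets.finite_INT) auto
      qed simp
      ultimately show ?thesis by simp
    qed
    have dj: "disjoint_family_on a {..<m}"
      unfolding disjoint_family_on_def
    proof (intro ballI impI)
      fix i j assume ij: "i \<in> {..<m}" "j \<in> {..<m}" "i \<noteq> j"
      then have "h i \<noteq> h j" "h i \<subseteq> C" "h j \<subseteq> C"
        using h by (auto simp: bij_betw_def inj_on_def)
      then show "a i \<inter> a j = {}" unfolding a_def by blast
    qed
    have cnt: "points_in c (Z \<inter> K) = (\<Sum>i\<in>{i\<in>{..<m}. c \<in> h i}. points_in (a i) Z)" if "c \<in> C" for c Z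
      unfolding points_in_Int
    proof (rule points_in_eq_sum)
      show "disjoint_family_on a {i \<in> {..<m}. c \<in> h i}"
        by (rule disjoint_family_on_mono[OF _ dj]) auto
      have ex: "\<exists>i<m. h i = {c\<in>C. x \<in> c}" for x
      proof -
        have "{c\<in>C. x \<in> c} \<in> h ` {..<m}" using h by (auto simp: bij_betw_def)
        then show ?thesis by auto
      qed
      show "(K \<inter> c) \<inter> Z = (\<Union>i\<in>{i \<in> {..<m}. c \<in> h i}. a i) \<inter> Z"
      proof (intro set_eqI iffI)
        fix x assume x: "x \<in> (K \<inter> c) \<inter> Z"
        obtain i where i: "i < m" "h i = {c\<in>C. x \<in> c}" using ex by blast
        then have "x \<in> a i" "c \<in> h i" using x that by (auto simp: a_def)
        then show "x \<in> (\<Union>i\<in>{i \<in> {..<m}. c \<in> h i}. a i) \<inter> Z" using i x by blast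
      next
        fix x assume "x \<in> (\<Union>i\<in>{i \<in> {..<m}. c \<in> h i}. a i) \<inter> Z"
        then show "x \<in> (K \<inter> c) \<inter> Z" using that unfolding a_def by blast
      qed
    qed simp
    let ?P = "\<Pi>\<^sub>M i\<in>{..<m}. (borel :: ennreal measure)"
    \<comment> \<open>Counts of members of \<open>C\<close> are sums of atom counts, so every event
      generated by \<open>C\<close> is a measurable condition \<open>T\<close> on the vector of atom
      counts. Induction over the generation of \<open>b\<close> builds \<open>T\<close>.\<close>
    have "\<exists>T\<in>sets ?P. \<forall>Z. Z \<inter> K \<in> b \<longleftrightarrow> (\<lambda>i\<in>{..<m}. points_in (a i) Z) \<in> T"
      using b
    proof (induction b)
      case (Basic b)
      then obtain c V where c: "b = {Z. points_in c Z \<in> V}" "c \<in> C" and [measurable]: "V \<in> sets borel"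
        unfolding gen_def by blast
      show ?case
      proof (intro bexI allI)
        show "{f\<in>space ?P. (\<Sum>i\<in>{i\<in>{..<m}. c \<in> h i}. f i) \<in> V} \<in> sets ?P"
          by measurable
        show "Z \<inter> K \<in> b \<longleftrightarrow> (\<lambda>i\<in>{..<m}. points_in (a i) Z) \<in> {f\<in>space ?P. (\<Sum>i\<in>{i\<in>{..<m}. c \<in> h i}. f i) \<in> V}" for Z
          using c cnt by (simp add: space_PiM)
      qed
    next
      case Empty
      then show ?case by (intro bexI[of _ "{}"]) auto
    next
      case (Compl b)
      then obtain T where T: "T \<in> sets ?P" "\<And>Z. Z \<inter> K \<in> b \<longleftrightarrow> (\<lambda>i\<in>{..<m}. points_in (a i) Z) \<in> T" by blast
      moreover have "(\<lambda>i\<in>{..<m}. points_in (a i) Z) \<in> space ?P" for Z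
        by (simp add: space_PiM)
      ultimately have "Z \<inter> K \<in> UNIV - b \<longleftrightarrow> (\<lambda>i\<in>{..<m}. points_in (a i) Z) \<in> space ?P - T" for Z
        by (simp only: Diff_iff UNIV_I T(2))
      with T(1) show ?case by blast
    next
      case (Union B)
      then obtain T where T: "\<And>j. T j \<in> sets ?P" "\<And>j Z. Z \<inter> K \<in> B j \<longleftrightarrow> (\<lambda>i\<in>{..<m}. points_in (a i) Z) \<in> T j" by metis
      have "Z \<inter> K \<in> (\<Union>j. B j) \<longleftrightarrow> (\<lambda>i\<in>{..<m}. points_in (a i) Z) \<in> (\<Union>j. T j)" for Z
        by (simp only: UN_iff T(2))
      moreover have "(\<Union>j. T j) \<in> sets ?P" using T(1) by auto
      ultimately show ?case by blast
    qed
    then obtain T where T: "T \<in> sets ?P" and bT: "\<And>Z. Z \<inter> K \<in> b \<longleftrightarrow> (\<lambda>i\<in>{..<m}. points_in (a i) Z) \<in> T"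
      by blast
    have law: "measure (distr M' configs (\<lambda>\<omega>. X' \<omega> \<inter> K)) b =
        measure (PiM {..<m} (\<lambda>i. distr M' borel (\<lambda>\<omega>. points_in (a i) (X' \<omega>)))) T"
      if PX': "poisson_process M' X' L'" and sets_L': "sets L' = sets borel" for M' and X' :: "'z \<Rightarrow> 'b set" and L'
    proof -
      interpret prob_space M' using PX' sets_L' by (rule poisson_prob_space)
      have X' [measurable]: "X' \<in> M' \<rightarrow>\<^sub>M configs" using PX' sets_L' by (rule poisson_measurable)
      have ind: "indep_vars (\<lambda>_. borel) (\<lambda>i \<omega>. points_in (a i) (X' \<omega>)) {..<m}"
        by (rule poisson_indep[OF PX' sets_L' _ dj]) simp
      have "measure (distr M' configs (\<lambda>\<omega>. X' \<omega> \<inter> K)) b =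
          measure (distr M' ?P (\<lambda>\<omega>. \<lambda>i\<in>{..<m}. points_in (a i) (X' \<omega>))) T"
        using T by (subst (1 2) measure_distr) (auto simp: bT vimage_def)
      also have "distr M' ?P (\<lambda>\<omega>. \<lambda>i\<in>{..<m}. points_in (a i) (X' \<omega>)) =
          PiM {..<m} (\<lambda>i. distr M' borel (\<lambda>\<omega>. points_in (a i) (X' \<omega>)))"
        by (rule indep_vars_iff_distr_eq_PiM'[THEN iffD1, OF m _ ind]) measurable
      finally show ?thesis .
    qed
    have aK: "a i \<subseteq> K" for i unfolding a_def by auto
    have fin_a: "emeasure L1 (a i) < \<infinity>" "emeasure L2 (a i) < \<infinity>" for i
      using emeasure_mono[OF aK, of L1] emeasure_mono[OF aK, of L2] fin sets_L1 sets_L2 K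
          by (auto intro: le_less_trans)
    have "\<bar>measure (distr M configs (\<lambda>\<omega>. X \<omega> \<inter> K)) b - measure (distr N configs (\<lambda>\<omega>. Y \<omega> \<inter> K)) b\<bar>
      \<le> (\<Sum>i<m. measure D (a i))"
      unfolding law[OF PX sets_L1] law[OF PY sets_L2]
    proof (rule PiM_measure_diff_le)
      show "T \<in> sets (PiM {..<m} (\<lambda>i. distr M borel (\<lambda>\<omega>. points_in (a i) (X \<omega>))))"
        using T by (simp cong: sets_PiM_cong)
      fix i V assume "i \<in> {..<m}" and "V \<in> sets (distr M borel (\<lambda>\<omega>. points_in (a i) (X \<omega>)))"
      then have V: "V \<in> sets borel" by simp
      have "\<bar>measure (poi (measure L1 (a i))) {k. of_nat k \<in> V} - measure (poi (measure L2 (a i))) {k. of_nat k \<in> V}\<bar>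
         \<le> \<bar>measure L1 (a i) - measure L2 (a i)\<bar>"
        using poi_diff_le[of "measure L1 (a i)" "measure L2 (a i)" "{k. of_nat k \<in> V}"]
          poi_diff_le[of "measure L2 (a i)" "measure L1 (a i)" "{k. of_nat k \<in> V}"]
        by (cases "measure L1 (a i) \<le> measure L2 (a i)") (auto simp: abs_minus_commute)
      also have "\<dots> \<le> measure D (a i)" by (rule le[OF a_sets aK])
      finally show "\<bar>measure (distr M borel (\<lambda>\<omega>. points_in (a i) (X \<omega>))) V -
          measure (distr N borel (\<lambda>\<omega>. points_in (a i) (Y \<omega>))) V\<bar>
        \<le> measure D (a i)"
        unfolding poisson_distr[OF PX sets_L1 a_sets fin_a(1)] poisson_distr[OF PY sets_L2 a_sets fin_a(2)]
        using V by (simp add: measure_distr vimage_def)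
    qed (auto intro!: M.prob_space_distr N.prob_space_distr)
    \<comment> \<open>The atoms are disjoint subsets of \<open>K\<close>, so the errors of the
      coordinates add up to at most the measure of \<open>K\<close> under \<open>D\<close>, however
      many sets \<open>C\<close> contains.\<close>
    also have "\<dots> = measure D (\<Union>i<m. a i)"
    proof (rule measure_finite_Union[OF _ _ dj, symmetric])
      show "a ` {..<m} \<subseteq> sets D" unfolding sets_D using a_sets by blast
      fix i
      have "emeasure D (a i) < \<infinity>"
        by (rule le_less_trans[OF emeasure_mono[OF aK] finD]) (use sets_D K in simp)
      then show "emeasure D (a i) \<noteq> \<infinity>" by simp
    qed simp
    also have "\<dots> \<le> measure D K"
    proof (rule measure_mono_fmeasurable)
      show "(\<Union>i<m. a i) \<subseteq> K" using aK by blast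
      show "(\<Union>i<m. a i) \<in> sets D" unfolding sets_D using a_sets by blast
      show "K \<in> fmeasurable D" using finD sets_D K by (simp add: fmeasurable_def)
    qed
    finally show ?thesis .
  qed
  have "\<bar>measure (distr M configs (\<lambda>\<omega>. X \<omega> \<inter> K)) S - measure (distr N configs (\<lambda>\<omega>. Y \<omega> \<inter> K)) S\<bar> \<le> measure D K"
    by (rule measure_diff_le_sigma_algebra[OF alg fin_law(1) _ _ fin_law(2) _ _ bound])
      (use S sigma_A in auto)
  moreover have "measure (distr M configs (\<lambda>\<omega>. X \<omega> \<inter> K)) S = measure M {\<omega> \<in> space M. X \<omega> \<inter> K \<in> S}"
    using S by (subst measure_distr) (auto intro!: arg_cong[where f="measure M"])
  moreover have "measure (distr N configs (\<lambda>\<omega>. Y \<omega> \<inter> K)) S = measure N {\<omega> \<in> space N. Y \<omega> \<inter> K \<in> S}"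
    using S by (subst measure_distr) (auto intro!: arg_cong[where f="measure N"])
  ultimately show ?thesis by simp
qed

section \<open>Counting points subject to a condition on the configuration\<close>

text \<open>A Dynkin argument in \<open>D\<close>. For a rectangle the count is a product; the
  complement needs a subtraction, which is why the count in \<open>K\<close> is kept finite and the
  value 0 is put elsewhere.\<close>

lemma borel_measurable_count_bounded:
  fixes D :: "('b::topological_space \<times> 'b set) set"
  assumes K [measurable]: "K \<in> sets borel" and D: "D \<in> sets (borel \<Otimes>\<^sub>M configs)"
  shows "(\<lambda>X. if points_in K X < \<infinity> then points_in {p\<in>K. (p, X) \<in> D} X else 0) \<in> borel_measurable configs"
proof -
  let ?E = "{a \<times> b | a b. a \<in> sets (borel :: 'b measure) \<and> b \<in> sets (configs :: 'b set measure)}"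
  have [measurable]: "Measurable.pred configs (\<lambda>X. points_in K X < \<infinity>)"
    by measurable
  have D': "D \<in> sigma_sets (space borel \<times> space configs) ?E"
    using D by (simp add: sets_pair_measure)
  show ?thesis
    using Int_stable_pair_measure_generator pair_measure_closed D'
  proof (induction rule: sigma_sets_induct_disjoint)
    case (basic A)
    then obtain a b where A: "A = a \<times> b" and [measurable]: "a \<in> sets borel" "b \<in> sets configs" by auto
    have eq: "points_in {p\<in>K. (p, X) \<in> A} X = indicator b X * points_in (K \<inter> a) X" for X
      by (auto simp: A points_in_def indicator_def intro!: arg_cong[where f="emeasure _"])
    show ?case unfolding eq by measurable
  next
    case empty
    have eq: "points_in {p\<in>K. (p, X) \<in> {}} X = 0" for X by (simp add: points_in_def)
    show ?case unfolding eq by simp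
  next
    case (compl A)
    have eq: "points_in {p\<in>K. (p, X) \<in> space borel \<times> space configs - A} X =
        points_in K X - points_in {p\<in>K. (p, X) \<in> A} X" if "points_in K X < \<infinity>" for X
    proof -
      have fin: "points_in {p\<in>K. (p, X) \<in> A} X \<le> points_in K X"
        unfolding points_in_def by (rule emeasure_mono) auto
      have "points_in {p\<in>K. (p, X) \<in> space borel \<times> space configs - A} X =
        emeasure (count_space UNIV) (X \<inter> K - X \<inter> {p\<in>K. (p, X) \<in> A})"
        unfolding points_in_def by (auto intro!: arg_cong[where f="emeasure _"])
      also have "\<dots> = points_in K X - points_in {p\<in>K. (p, X) \<in> A} X"
        unfolding points_in_def
        by (rule emeasure_Diff) (use fin that in \<open>auto simp: points_in_def top_unique\<close>)
      finally show ?thesis .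
    qed
    have "(\<lambda>X. (if points_in K X < \<infinity> then points_in K X else 0) - (if points_in K X <
        \<infinity> then points_in {p\<in>K. (p, X) \<in> A} X else 0)) \<in> borel_measurable configs"
      using compl by measurable
    moreover have eq2: "(if points_in K X < \<infinity> then points_in {p\<in>K. (p, X) \<in> space borel \<times> space configs - A} X else 0)
        = (if points_in K X < \<infinity> then points_in K X else 0) - (if points_in K X <
            \<infinity> then points_in {p\<in>K. (p, X) \<in> A} X else 0)" for X
    proof (cases "points_in K X < \<infinity>")
      case True
      show ?thesis by (simp only: if_P[OF True] eq[OF True])
    next
      case False
      show ?thesis unfolding if_not_P[OF False] by simp
    qed
    ultimately show ?case
      by (subst eq2)
  next
    case (union A)
    have "(\<lambda>X. \<Sum>i. (if points_in K X < \<infinity> then points_in {p\<in>K. (p, X) \<in> A i} X else 0)) \<in> borel_measurable configs"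
      using union by measurable
    moreover have eq: "points_in {p\<in>K. (p, X) \<in> (\<Union>i. A i)} X = (\<Sum>i. points_in {p\<in>K. (p, X) \<in> A i} X)" for X
    proof -
      have "(\<Sum>i. emeasure (count_space UNIV) (X \<inter> {p\<in>K. (p, X) \<in> A i})) =
          emeasure (count_space UNIV) (\<Union>i. X \<inter> {p\<in>K. (p, X) \<in> A i})"
        using union(1) by (intro suminf_emeasure) (auto simp: disjoint_family_on_def)
      then show ?thesis
        unfolding points_in_def by (auto intro!: arg_cong[where f="emeasure _"])
    qed
    moreover have "(if points_in K X < \<infinity> then points_in {p\<in>K. (p, X) \<in> (\<Union>i. A i)} X else 0)
        = (\<Sum>i. (if points_in K X < \<infinity> then points_in {p\<in>K. (p, X) \<in> A i} X else 0))" for X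
      using eq by simp
    ultimately show ?case
      by simp
  qed
qed

text \<open>Summing the bounded version over a partition lets the total count be infinite, as long
  as each piece holds finitely many points.\<close>

lemma borel_measurable_count:
  fixes D :: "('b::topological_space \<times> 'b set) set"
  assumes K: "\<And>j::nat. K j \<in> sets borel" "disjoint_family K" "(\<Union>j. K j) = UNIV"
    and D: "D \<in> sets (borel \<Otimes>\<^sub>M configs)"
  shows "(\<lambda>X. if \<forall>j. points_in (K j) X < \<infinity> then points_in {p. (p, X) \<in> D} X else 0) \<in> borel_measurable configs"
proof -
  note K(1) [measurable]
  let ?g = "\<lambda>j X. if points_in (K j) X < \<infinity> then points_in {p\<in>K j. (p, X) \<in> D} X else 0"
  have [measurable]: "?g j \<in> borel_measurable configs" for j
    using K(1) D by (rule borel_measurable_count_bounded)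
  have m: "(\<lambda>X. if \<forall>j. points_in (K j) X < \<infinity> then \<Sum>j. ?g j X else 0) \<in> borel_measurable configs"
    by measurable
  have "points_in {p. (p, X) \<in> D} X = (\<Sum>j. points_in {p\<in>K j. (p, X) \<in> D} X)" for X
  proof -
    have "(\<Sum>j. emeasure (count_space UNIV) (X \<inter> {p\<in>K j. (p, X) \<in> D})) =
        emeasure (count_space UNIV) (\<Union>j. X \<inter> {p\<in>K j. (p, X) \<in> D})"
      using K(2) by (intro suminf_emeasure) (auto simp: disjoint_family_on_def)
    also have "(\<Union>j. X \<inter> {p\<in>K j. (p, X) \<in> D}) = X \<inter> {p. (p, X) \<in> D}"
      using K(3) by auto
    finally show ?thesis unfolding points_in_def by simp
  qed
  then have "?thesis \<longleftrightarrow> (\<lambda>X. if \<forall>j. points_in (K j) X < \<infinity> then \<Sum>j. ?g j X else 0) \<in> borel_measurable configs"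
    by (intro measurable_cong) auto
  then show ?thesis
    using m by blast
qed


section \<open>Localisation of Laguerre cells\<close>

text \<open>Cells are counted through their nuclei, which makes the count a functional of the point
  configuration. For a condition that forces nonempty interior it is the number of cells, see
  \<open>sum_laguerre_diagram\<close>.\<close>

definition cell_count :: "('a::euclidean_space set \<Rightarrow> bool) \<Rightarrow> ('a \<times> real) set \<Rightarrow> ennreal" where
  "cell_count \<Psi> X = points_in {p. \<Psi> (laguerre_cell p X)} X"

text \<open>The points whose power with respect to some \<open>w\<close> with \<open>norm w \<le> c\<close> is at most \<open>L\<close>: the paraboloid
  region \<open>K\<close> of the introduction.\<close>

definition low_power :: "real \<Rightarrow> real \<Rightarrow> ('a::euclidean_space \<times> real) set" where
  "low_power c L = {(v, h). h \<le> L \<and> norm v \<le> c + sqrt (L - h)}"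

text \<open>The boxes \<open>Q_j\<close> of the introduction have this form, with half-width
  \<open>r\<close> and top \<open>s\<close>.\<close>

definition column_below :: "real \<Rightarrow> real \<Rightarrow> ('a::euclidean_space \<times> real) set" where
  "column_below r s = {(v, h). (\<forall>b\<in>Basis. \<bar>v \<bullet> b\<bar> \<le> r) \<and> h \<le> s}"

text \<open>\<open>S\<close> is a sign pattern. The single parameter \<open>R'\<close> bounds both
  the coordinates and the height, so that one limit exhausts the orthant.\<close>

definition orthant :: "'a set \<Rightarrow> real \<Rightarrow> real \<Rightarrow> ('a::euclidean_space \<times> real) set" where
  "orthant S R R' = {(v, h). (\<forall>b\<in>Basis. if b \<in> S then R \<le> v \<bullet> b \<and> v \<bullet> b \<le> R' else - R' \<le> v \<bullet> b \<and> v \<bullet> b \<le> - R) \<and>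
      h \<le> R'}"

lemma low_powerI:
  assumes "norm w \<le> c" "pow_fun w p \<le> L"
  shows "p \<in> low_power c L"
proof -
  obtain v h where p: "p = (v, h)" by force
  have *: "(norm (w - v))\<^sup>2 \<le> L - h"
    using assms(2) by (simp add: p pow_fun_def)
  then have "0 \<le> L - h" by (meson order_trans zero_le_power2)
  moreover have "norm (w - v) \<le> sqrt (L - h)"
    using * by (rule real_le_rsqrt)
  moreover have "norm v \<le> norm w + norm (w - v)"
    by (metis norm_minus_commute norm_triangle_sub add.commute)
  ultimately show ?thesis using assms(1) by (auto simp: low_power_def p)
qed

lemma low_power_mono: "c \<le> c' \<Longrightarrow> L \<le> L' \<Longrightarrow> low_power c L \<subseteq> low_power c' L'"
  unfolding low_power_def by (auto intro: order_trans[OF _ add_mono[OF _ real_sqrt_le_mono]])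

lemma norm_le_box:
  fixes v :: "'a::euclidean_space"
  assumes "\<And>b. b \<in> Basis \<Longrightarrow> \<bar>v \<bullet> b\<bar> \<le> r"
  shows "norm v \<le> sqrt DIM('a) * r"
proof -
  have "infnorm v \<le> r"
    unfolding infnorm_def using assms by (intro cSup_least) auto
  then show ?thesis
    using order_trans[OF norm_le_infnorm[of v] mult_left_mono[of "infnorm v" r "sqrt DIM('a)"]] by simp
qed

lemma pow_fun_column_le:
  assumes "q \<in> column_below r s" "norm w \<le> m"
  shows "pow_fun w (q :: 'a::euclidean_space \<times> real) \<le> (m + sqrt DIM('a) * r)\<^sup>2 + s"
proof -
  obtain v h where q: "q = (v, h)" by force
  have "norm (w - v) \<le> norm w + norm v" by (rule norm_triangle_ineq4)
  also have "\<dots> \<le> m + sqrt DIM('a) * r"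
    using assms norm_le_box[of v r] by (auto simp: column_below_def q intro!: add_mono)
  finally have "(norm (w - v))\<^sup>2 \<le> (m + sqrt DIM('a) * r)\<^sup>2" by (intro power_mono) auto
  then show ?thesis using assms by (auto simp: pow_fun_def q column_below_def)
qed

text \<open>The nucleus of a cell containing \<open>w\<close> has at \<open>w\<close> at most the
  power of the point \<open>q\<close> in the box, and that power is bounded on the ball.\<close>

lemma cell_count_le_points_in:
  assumes "\<And>C. \<Psi> C \<Longrightarrow> C \<inter> cball 0 c \<noteq> {}"
    and "X \<inter> column_below r s \<noteq> {}"
  shows "cell_count \<Psi> (X :: ('a::euclidean_space \<times> real) set) \<le>
      points_in (low_power c ((c + sqrt DIM('a) * r)\<^sup>2 + s)) X"
proof -
  obtain q where q: "q \<in> X" "q \<in> column_below r s" using assms by auto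
  have "p \<in> low_power c ((c + sqrt DIM('a) * r)\<^sup>2 + s)" if p: "p \<in> X" "\<Psi> (laguerre_cell p X)" for p
  proof -
    obtain w where w: "w \<in> laguerre_cell p X" "norm w \<le> c"
      using assms(1)[OF p(2)] by auto
    then have "pow_fun w p \<le> pow_fun w q" using q by (auto simp: laguerre_cell_def)
    then show ?thesis
      using pow_fun_column_le[OF q(2) w(2)] by (intro low_powerI[OF w(2)]) linarith
  qed
  then show ?thesis
    unfolding cell_count_def points_in_def by (intro emeasure_mono) auto
qed

text \<open>The event on which the cells meeting \<^term>\<open>cball 0 c\<close> are determined by a region of finite intensity.
  The second condition bounds the centres of these cells.\<close>

definition good_config :: "real \<Rightarrow> real \<Rightarrow> real \<Rightarrow> real \<Rightarrow> real \<Rightarrow> real \<Rightarrow> ('a::euclidean_space \<times> real) set \<Rightarrow> bool" where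
  "good_config c r s H R R' X \<longleftrightarrow> X \<inter> column_below r s \<noteq> {} \<and>
    X \<inter> (low_power c ((c + sqrt DIM('a) * r)\<^sup>2 + s) \<inter> UNIV \<times> {..< -H}) = {} \<and>
    (\<forall>S\<in>Pow Basis. X \<inter> orthant S R R' \<noteq> {})"

text \<open>For \<open>w\<close> in the cell let \<open>S\<close> be its sign pattern. The point
  \<open>u\<close> found in the corresponding orthant lies beyond the centre \<open>v\<close> in
  every coordinate, in the direction of \<open>w\<close>, by at least 1. So
  \<open>w \<bullet> (u - v)\<close> is at least the sum norm of \<open>w\<close>, while the
  inequality between the powers of \<open>p\<close> and \<open>(u, k)\<close> at \<open>w\<close>
  bounds it by a constant.\<close>

lemma good_config_cell_bounded:
  fixes X :: "('a::euclidean_space \<times> real) set"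
  assumes good: "good_config c r s H R R' X"
    and R: "c + sqrt ((c + sqrt DIM('a) * r)\<^sup>2 + s + H) + 1 \<le> R"
    and p: "p \<in> X" "laguerre_cell p X \<inter> cball 0 c \<noteq> {}"
  shows "laguerre_cell p X \<subseteq> cball 0 ((real DIM('a) * R'\<^sup>2 + R' + H) / 2)"
proof
  fix w assume w: "w \<in> laguerre_cell p X"
  let ?L = "(c + sqrt DIM('a) * r)\<^sup>2 + s"
  obtain q0 where q0: "q0 \<in> X" "q0 \<in> column_below r s" using good by (auto simp: good_config_def)
  obtain w0 where w0: "w0 \<in> laguerre_cell p X" "norm w0 \<le> c" using p by auto
  have "pow_fun w0 p \<le> pow_fun w0 q0" using w0 q0 by (auto simp: laguerre_cell_def)
  also have "\<dots> \<le> ?L" using pow_fun_column_le[OF q0(2) w0(2)] .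
  finally have pK: "p \<in> low_power c ?L" using low_powerI[OF w0(2)] by blast
  obtain v h where vh: "p = (v, h)" by force
  have h: "- H \<le> h" using good p(1) pK by (force simp: good_config_def vh)
  have "norm v \<le> c + sqrt (?L - h)" using pK by (auto simp: low_power_def vh)
  also have "\<dots> \<le> c + sqrt (?L + H)" using h by simp
  \<comment> \<open>The summand 1 in the bound for \<open>R\<close> leaves this margin between the
    centre and the orthant points.\<close>
  finally have v: "norm v \<le> R - 1" using R by (simp add: algebra_simps)
  define S where "S = {b\<in>Basis. 0 \<le> w \<bullet> b}"
  have "S \<in> Pow Basis" unfolding S_def by auto
  then have "X \<inter> orthant S R R' \<noteq> {}" using good by (simp add: good_config_def)
  then obtain u k where uk: "(u, k) \<in> X" "(u, k) \<in> orthant S R R'" by force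
  have u: "\<bar>w \<bullet> b\<bar> \<le> (w \<bullet> b) * ((u - v) \<bullet> b)" if b: "b \<in> Basis" for b
  proof -
    have "\<bar>v \<bullet> b\<bar> \<le> R - 1" using Basis_le_norm[OF b, of v] v by linarith
    moreover have "if b \<in> S then R \<le> u \<bullet> b else u \<bullet> b \<le> - R"
      using uk b by (auto simp: orthant_def)
    ultimately have "if b \<in> S then 1 \<le> (u - v) \<bullet> b else (u - v) \<bullet> b \<le> - 1"
      by (auto simp: inner_diff_left abs_le_iff split: if_splits)
    then show ?thesis
      using b mult_left_mono[of 1 "(u - v) \<bullet> b" "w \<bullet> b"] mult_left_mono_neg[of "(u - v) \<bullet> b" "- 1" "w \<bullet> b"]
      by (auto simp: S_def split: if_splits)
  qed
  have "norm w \<le> (\<Sum>b\<in>Basis. \<bar>w \<bullet> b\<bar>)" by (rule norm_le_l1)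
  also have "\<dots> \<le> (\<Sum>b\<in>Basis. (w \<bullet> b) * ((u - v) \<bullet> b))" by (intro sum_mono u)
  also have "\<dots> = w \<bullet> (u - v)" by (rule euclidean_inner[symmetric])
  finally have 1: "norm w \<le> w \<bullet> (u - v)" .
  have "pow_fun w p \<le> pow_fun w (u, k)" using w uk by (auto simp: laguerre_cell_def)
  then have "2 * (w \<bullet> (u - v)) \<le> u \<bullet> u - v \<bullet> v + k - h"
    by (simp add: pow_fun_def vh power2_norm_eq_inner inner_diff_left inner_diff_right inner_commute algebra_simps)
  moreover have "u \<bullet> u \<le> real DIM('a) * R'\<^sup>2"
  proof -
    have ub: "\<bar>u \<bullet> b\<bar> \<le> R'" if "b \<in> Basis" for b
    proof -
      have "0 \<le> norm v" by simp
      then have "0 \<le> R" using v by linarith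
      moreover have "if b \<in> S then R \<le> u \<bullet> b \<and> u \<bullet> b \<le> R' else - R' \<le> u \<bullet> b \<and> u \<bullet> b \<le> - R"
        using uk that by (auto simp: orthant_def)
      ultimately show ?thesis by (auto split: if_splits)
    qed
    have "u \<bullet> u = (\<Sum>b\<in>Basis. (u \<bullet> b)\<^sup>2)" by (subst euclidean_inner) (simp add: power2_eq_square)
    also have "\<dots> \<le> (\<Sum>b\<in>(Basis::'a set). R'\<^sup>2)"
      using ub by (intro sum_mono) (metis abs_ge_zero power2_abs power_mono)
    finally show ?thesis by simp
  qed
  moreover have "0 \<le> v \<bullet> v" "k \<le> R'" using uk by (auto simp: orthant_def)
  ultimately have "2 * norm w \<le> real DIM('a) * R'\<^sup>2 + R' + H" using 1 h by linarith
  then show "w \<in> cball 0 ((real DIM('a) * R'\<^sup>2 + R' + H) / 2)" by simp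
qed

text \<open>A point whose power at \<open>w\<close> exceeds \<open>L\<close> imposes no condition
  there, because \<open>q\<close> already imposes a stronger one.\<close>

lemma laguerre_cell_Int_low_power:
  assumes q: "q \<in> X" "\<And>w. norm w \<le> m \<Longrightarrow> pow_fun w q \<le> L"
  shows "laguerre_cell p (X \<inter> low_power m L) \<inter> cball 0 m = laguerre_cell p X \<inter> cball 0 m"
proof -
  have "w \<in> laguerre_cell p X" if w: "w \<in> laguerre_cell p (X \<inter> low_power m L)" "norm w \<le> m" for w
    unfolding laguerre_cell_def
  proof (intro CollectI ballI)
    fix u assume uk: "u \<in> X"
    show "pow_fun w p \<le> pow_fun w u"
    proof (cases "pow_fun w u \<le> L")
      case True
      then show ?thesis using w uk low_powerI[OF w(2) True] by (auto simp: laguerre_cell_def)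
    next
      case False
      have "q \<in> X \<inter> low_power m L" using q low_powerI[OF w(2)] w(2) by blast
      then have "pow_fun w p \<le> pow_fun w q" using w by (auto simp: laguerre_cell_def)
      then show ?thesis using q(2)[OF w(2)] False by linarith
    qed
  qed
  then show ?thesis by (auto simp: laguerre_cell_def)
qed

lemma orthant_subset_low_power:
  assumes "0 \<le> m" "(sqrt DIM('a) * R')\<^sup>2 + R' \<le> L" "0 \<le> R"
  shows "orthant S R R' \<subseteq> (low_power m L :: ('a::euclidean_space \<times> real) set)"
proof
  fix q :: "'a \<times> real" assume "q \<in> orthant S R R'"
  then obtain v h where q: "q = (v, h)" "h \<le> R'"
    and v: "\<And>b. b \<in> Basis \<Longrightarrow> if b \<in> S then R \<le> v \<bullet> b \<and> v \<bullet> b \<le> R' else - R' \<le> v \<bullet> b \<and> v \<bullet> b \<le> - R"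
    by (auto simp: orthant_def)
  have "\<bar>v \<bullet> b\<bar> \<le> R'" if "b \<in> Basis" for b
    using v[OF that] assms by (auto split: if_splits)
  then have "q \<in> column_below R' R'"
    using q by (auto simp: column_below_def)
  from pow_fun_column_le[OF this, of 0 0] assms show "q \<in> low_power m L"
    by (intro low_powerI[of 0]) auto
qed

text \<open>The column and the orthants lie inside the window, and the emptiness condition is
  inherited by subsets.\<close>

lemma good_config_Int:
  fixes X :: "('a::euclidean_space \<times> real) set"
  assumes m: "0 \<le> m" and L: "(sqrt DIM('a) * r)\<^sup>2 + s \<le> L" "(sqrt DIM('a) * R')\<^sup>2 + R' \<le> L" and R: "0 \<le> R"
    and good: "good_config c r s H R R' X"
  shows "good_config c r s H R R' (X \<inter> low_power m L)"
proof -
  have col: "column_below r s \<subseteq> (low_power m L :: ('a \<times> real) set)"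
  proof
    fix q :: "'a \<times> real" assume "q \<in> column_below r s"
    from pow_fun_column_le[OF this, of 0 0] L(1) m show "q \<in> low_power m L"
      by (intro low_powerI[of 0]) auto
  qed
  have ort: "orthant S R R' \<subseteq> low_power m L" for S :: "'a set"
    by (rule orthant_subset_low_power[OF m L(2) R])
  have "X \<inter> low_power m L \<inter> column_below r s = X \<inter> column_below r s"
    "X \<inter> low_power m L \<inter> orthant S R R' = X \<inter> orthant S R R'" for S
    using col ort[of S] by blast+
  then show ?thesis using good unfolding good_config_def by auto
qed

text \<open>Both configurations define the same cells inside \<open>cball 0 m\<close>. Equality of
  the whole cells uses the bound on their size for the restricted configuration too, since removing
  points could enlarge them; this is why goodness has to be inherited by the restriction.\<close>

lemma cell_count_localise:
  fixes X :: "('a::euclidean_space \<times> real) set"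
  assumes \<Psi>: "\<And>C. \<Psi> C \<Longrightarrow> C \<inter> cball 0 c \<noteq> {}"
    and good: "good_config c r s H R R' X"
    and R: "c + sqrt ((c + sqrt DIM('a) * r)\<^sup>2 + s + H) + 1 \<le> R" "0 \<le> R"
    and m: "(real DIM('a) * R'\<^sup>2 + R' + H) / 2 \<le> m" "c \<le> m" "0 \<le> m"
    and L: "(m + sqrt DIM('a) * r)\<^sup>2 + s \<le> L" "(sqrt DIM('a) * R')\<^sup>2 + R' \<le> L" "(sqrt DIM('a) * r)\<^sup>2 + s \<le> L"
  shows "cell_count \<Psi> X = cell_count \<Psi> (X \<inter> low_power m L)"
proof -
  let ?Y = "X \<inter> low_power m L"
  have goodY: "good_config c r s H R R' ?Y" by (rule good_config_Int[OF m(3) L(3,2) R(2) good])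
  obtain q where q: "q \<in> X" "q \<in> column_below r s" using good by (auto simp: good_config_def)
  have eq: "laguerre_cell p ?Y \<inter> cball 0 m = laguerre_cell p X \<inter> cball 0 m" for p
    using pow_fun_column_le[OF q(2)] L(1) by (intro laguerre_cell_Int_low_power[OF q(1)]) (meson order_trans)
  have hit: "laguerre_cell p X \<inter> cball 0 c \<noteq> {} \<longleftrightarrow> laguerre_cell p ?Y \<inter> cball 0 c \<noteq> {}" for p
  proof -
    have cc: "cball 0 c \<subseteq> cball (0::'a) m" using m by auto
    then show ?thesis using eq[of p] by blast
  qed
  have bdd: "laguerre_cell p Z \<subseteq> cball 0 m"
      if "good_config c r s H R R' Z" "p \<in> Z" "laguerre_cell p Z \<inter> cball 0 c \<noteq> {}" for p and Z :: "('a \<times> real) set"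
    using good_config_cell_bounded[OF that(1) R(1) that(2,3)] m(1) by auto
  have 1: "p \<in> ?Y \<and> laguerre_cell p ?Y = laguerre_cell p X" if p: "p \<in> X" "\<Psi> (laguerre_cell p X)" for p
  proof -
    obtain w where w: "w \<in> laguerre_cell p X" "norm w \<le> c" using \<Psi>[OF p(2)] by auto
    have "pow_fun w p \<le> pow_fun w q" using w q by (auto simp: laguerre_cell_def)
    also have "\<dots> \<le> L" using pow_fun_column_le[OF q(2), of w m] w m L by auto
    finally have pY: "p \<in> ?Y" using p low_powerI[of w m p L] w m by auto
    have "laguerre_cell p X \<subseteq> cball 0 m" by (rule bdd[OF good p(1) \<Psi>[OF p(2)]])
    moreover have "laguerre_cell p ?Y \<subseteq> cball 0 m"
      using bdd[OF goodY pY] hit \<Psi>[OF p(2)] by blast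
    ultimately show ?thesis using eq[of p] pY by blast
  qed
  have 2: "p \<in> X \<and> laguerre_cell p ?Y = laguerre_cell p X" if p: "p \<in> ?Y" "\<Psi> (laguerre_cell p ?Y)" for p
  proof -
    have "laguerre_cell p ?Y \<subseteq> cball 0 m" by (rule bdd[OF goodY p(1) \<Psi>[OF p(2)]])
    moreover have "laguerre_cell p X \<subseteq> cball 0 m"
      using bdd[OF good _] p hit \<Psi>[OF p(2)] by blast
    ultimately show ?thesis using eq[of p] p by blast
  qed
  have "X \<inter> {p. \<Psi> (laguerre_cell p X)} = ?Y \<inter> {p. \<Psi> (laguerre_cell p ?Y)}"
  proof (intro equalityI subsetI)
    fix p assume "p \<in> X \<inter> {p. \<Psi> (laguerre_cell p X)}"
    then show "p \<in> ?Y \<inter> {p. \<Psi> (laguerre_cell p ?Y)}" using 1[of p] by simp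
  next
    fix p assume "p \<in> ?Y \<inter> {p. \<Psi> (laguerre_cell p ?Y)}"
    then show "p \<in> X \<inter> {p. \<Psi> (laguerre_cell p X)}" using 2[of p] by simp
  qed
  then show ?thesis unfolding cell_count_def points_in_def by simp
qed

section \<open>Intensity of the regions\<close>

text \<open>An upper bound for the intensity of \<open>low_power c L\<close>: the slice at height
  \<open>h\<close> is a ball of radius \<open>c + sqrt (L - h)\<close>, replaced here by its
  circumscribed cube.\<close>

definition low_power_bound :: "nat \<Rightarrow> (real \<Rightarrow> real) \<Rightarrow> real \<Rightarrow> real \<Rightarrow> ennreal" where
  "low_power_bound d f c L = (\<integral>\<^sup>+h\<in>{..L}. ennreal (f h * (2 * (c + sqrt (L - h))) ^ d) \<partial>lborel)"

lemma sets_low_power [measurable]: "low_power c L \<in> sets (borel :: ('a::euclidean_space \<times> real) measure)"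
proof -
  have "low_power c L = {x :: 'a \<times> real. snd x \<le> L \<and> norm (fst x) \<le> c + sqrt (L - snd x)}"
    by (auto simp: low_power_def)
  also have "\<dots> = {x \<in> space (borel :: ('a \<times> real) measure). snd x \<le> L \<and> norm (fst x) \<le> c + sqrt (L - snd x)}"
    by simp
  also have "\<dots> \<in> sets borel"
    unfolding borel_prod[symmetric] by measurable
  finally show ?thesis .
qed

lemma sets_column [measurable]: "column_below r s \<in> sets (borel :: ('a::euclidean_space \<times> real) measure)"
proof -
  have "column_below r s = {x \<in> space (borel :: ('a \<times> real) measure). (\<forall>b\<in>Basis. \<bar>fst x \<bullet> b\<bar> \<le> r) \<and> snd x \<le> s}"
    by (auto simp: column_below_def)
  also have "\<dots> \<in> sets borel"
    unfolding borel_prod[symmetric] by measurable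
  finally show ?thesis .
qed

lemma sets_orthant [measurable]: "orthant S R R' \<in> sets (borel :: ('a::euclidean_space \<times> real) measure)"
proof -
  have "orthant S R R' = {x \<in> space (borel :: ('a \<times> real) measure). (\<forall>b\<in>Basis. if b \<in> S then R \<le> fst x \<bullet> b \<and>
      fst x \<bullet> b \<le> R' else - R' \<le> fst x \<bullet> b \<and> fst x \<bullet> b \<le> - R) \<and> snd x \<le> R'}"
    by (auto simp: orthant_def)
  also have "\<dots> \<in> sets borel"
    unfolding borel_prod[symmetric] by measurable
  finally show ?thesis .
qed

lemma sets_Lambda [simp, measurable_cong]: "sets (Lambda f) = sets borel"
  by (simp add: Lambda_def lborel_prod)

lemma space_Lambda [simp]: "space (Lambda f) = UNIV"
  by (simp add: Lambda_def space_pair_measure)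

lemma emeasure_Lambda:
  assumes [measurable]: "f \<in> borel_measurable borel" "B \<in> sets borel"
  shows "emeasure (Lambda f :: ('a::euclidean_space \<times> real) measure) B =
      (\<integral>\<^sup>+h. ennreal (f h) * emeasure lborel {v. (v, h) \<in> B} \<partial>lborel)"
proof -
  have B [measurable]: "B \<in> sets (lborel \<Otimes>\<^sub>M lborel :: ('a \<times> real) measure)"
    using assms(2) unfolding lborel_prod by simp
  have "emeasure (Lambda f) B = (\<integral>\<^sup>+x. ennreal (f (snd x)) * indicator B x \<partial>(lborel \<Otimes>\<^sub>M lborel))"
    unfolding Lambda_def by (subst emeasure_density[OF _ B]) (auto simp: split_beta' intro!: nn_integral_cong)
  also have "\<dots> = (\<integral>\<^sup>+h. (\<integral>\<^sup>+v. ennreal (f h) * indicator B (v, h) \<partial>lborel) \<partial>lborel)"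
    by (subst lborel_pair.nn_integral_snd[symmetric]) (auto simp: split_beta')
  also have "\<dots> = (\<integral>\<^sup>+h. ennreal (f h) * emeasure lborel {v. (v, h) \<in> B} \<partial>lborel)"
  proof (intro nn_integral_cong)
    fix h :: real
    have [measurable]: "(\<lambda>v. (v, h)) -` B \<in> sets borel"
      using sets_Pair2[OF B, of h] by simp
    have "(\<integral>\<^sup>+v. ennreal (f h) * indicator B (v, h) \<partial>lborel) =
        (\<integral>\<^sup>+v. ennreal (f h) * indicator ((\<lambda>v. (v, h)) -` B) v \<partial>lborel)"
      by (simp add: indicator_def vimage_def)
    also have "\<dots> = ennreal (f h) * emeasure lborel ((\<lambda>v. (v, h)) -` B)"
      by (subst nn_integral_cmult_indicator) auto
    finally show "(\<integral>\<^sup>+v. ennreal (f h) * indicator B (v, h) \<partial>lborel) =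
        ennreal (f h) * emeasure lborel {v. (v, h) \<in> B}"
      by (simp add: vimage_def)
  qed
  finally show ?thesis .
qed

lemma emeasure_lborel_box_le:
  assumes "A \<subseteq> {v. \<forall>b\<in>Basis. \<bar>v \<bullet> b\<bar> \<le> r}" "0 \<le> r"
  shows "emeasure lborel (A :: 'a::euclidean_space set) \<le> ennreal ((2 * r) ^ DIM('a))"
proof -
  have "emeasure lborel A \<le> emeasure lborel (cbox (- r *\<^sub>R One) (r *\<^sub>R One) :: 'a set)"
    using assms by (intro emeasure_mono) (force simp: mem_box abs_le_iff)+
  also have "\<dots> = ennreal ((2 * r) ^ DIM('a))"
    using assms(2) by (subst emeasure_lborel_cbox) (auto simp: inner_diff_left inner_add_left simp flip: mult_2)
  finally show ?thesis .
qed

lemma emeasure_lborel_box: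
  assumes "\<And>b. b \<in> Basis \<Longrightarrow> l b \<le> u b" 
  shows "emeasure lborel {v::'a::euclidean_space. \<forall>b\<in>Basis. l b \<le> v \<bullet> b \<and> v \<bullet> b \<le> u b} =
      ennreal (\<Prod>b\<in>Basis. u b - l b)"
proof -
  have "{v::'a. \<forall>b\<in>Basis. l b \<le> v \<bullet> b \<and> v \<bullet> b \<le> u b} = cbox (\<Sum>b\<in>Basis. l b *\<^sub>R b) (\<Sum>b\<in>Basis. u b *\<^sub>R b)"
    by (auto simp: mem_box)
  moreover have "emeasure lborel (cbox (\<Sum>b\<in>Basis. l b *\<^sub>R b) (\<Sum>b\<in>Basis. u b *\<^sub>R b :: 'a)) =
      ennreal (\<Prod>b\<in>Basis. u b - l b)"
    using assms by (subst emeasure_lborel_cbox)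
        (auto simp: inner_diff_left intro!: arg_cong[where f=ennreal] prod.cong)
  ultimately show ?thesis
    by (simp only:)
qed

lemma emeasure_Lambda_low_power_le:
  assumes [measurable]: "f \<in> borel_measurable borel" and "\<And>x. 0 \<le> f x" "0 \<le> c"
  shows "emeasure (Lambda f) (low_power c L :: ('a::euclidean_space \<times> real) set) \<le> low_power_bound DIM('a) f c L"
proof -
  have "emeasure (Lambda f) (low_power c L :: ('a \<times> real) set)
      = (\<integral>\<^sup>+h. ennreal (f h) * emeasure lborel {v::'a. (v, h) \<in> low_power c L} \<partial>lborel)"
    by (rule emeasure_Lambda) auto
  also have "\<dots> \<le> (\<integral>\<^sup>+h. ennreal (f h * (2 * (c + sqrt (L - h))) ^ DIM('a)) * indicator {..L} h \<partial>lborel)"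
  proof (rule nn_integral_mono)
    fix h :: real
    show "ennreal (f h) * emeasure lborel {v::'a. (v, h) \<in> low_power c L} \<le>
        ennreal (f h * (2 * (c + sqrt (L - h))) ^ DIM('a)) * indicator {..L} h"
    proof (cases "h \<le> L")
      case True
      have "emeasure lborel {v::'a. (v, h) \<in> low_power c L} \<le> ennreal ((2 * (c + sqrt (L - h))) ^ DIM('a))"
        using True assms by (intro emeasure_lborel_box_le)
          (auto simp: low_power_def intro: order_trans[OF Basis_le_norm])
      then show ?thesis
        using True assms by (auto simp: ennreal_mult intro!: mult_left_mono)
    qed (auto simp: low_power_def)
  qed
  finally show ?thesis by (simp add: low_power_bound_def)
qed

lemma emeasure_Lambda_column:
  assumes [measurable]: "f \<in> borel_measurable borel" and "0 \<le> r"
  shows "emeasure (Lambda f) (column_below r s :: ('a::euclidean_space \<times> real) set)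
    = ennreal ((2 * r) ^ DIM('a)) * (\<integral>\<^sup>+h\<in>{..s}. ennreal (f h) \<partial>lborel)"
proof -
  have "emeasure lborel {v::'a. (v, h) \<in> column_below r s} = ennreal ((2 * r) ^ DIM('a)) * indicator {..s} h" for h
    using emeasure_lborel_box[of "\<lambda>_::'a. - r" "\<lambda>_. r"] assms(2)
    by (simp add: column_below_def abs_le_iff indicator_def conj_commute minus_le_iff)
  then have "emeasure (Lambda f) (column_below r s :: ('a \<times> real) set) 
    = (\<integral>\<^sup>+h. ennreal ((2 * r) ^ DIM('a)) * (ennreal (f h) * indicator {..s} h) \<partial>lborel)"
    by (subst emeasure_Lambda) (auto intro!: nn_integral_cong simp: mult_ac)
  then show ?thesis
    by (simp add: nn_integral_cmult)
qed

lemma emeasure_Lambda_orthant: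
  assumes [measurable]: "f \<in> borel_measurable borel" and "R \<le> R'"
  shows "emeasure (Lambda f) (orthant S R R' :: ('a::euclidean_space \<times> real) set)
    = ennreal ((R' - R) ^ DIM('a)) * (\<integral>\<^sup>+h\<in>{..R'}. ennreal (f h) \<partial>lborel)"
proof -
  have "emeasure lborel {v::'a. (v, h) \<in> orthant S R R'} = ennreal ((R' - R) ^ DIM('a)) * indicator {..R'} h" for h
  proof (cases "h \<le> R'")
    case True
    have eq: "{v::'a. (v, h) \<in> orthant S R R'} = {v. \<forall>b\<in>Basis. (if b \<in> S then R else - R') \<le> v \<bullet> b \<and> v \<bullet> b \<le>
        (if b \<in> S then R' else - R)}"
      using True by (auto simp: orthant_def split: if_splits)
    have "(\<Prod>b\<in>(Basis::'a set). (if b \<in> S then R' else - R) - (if b \<in> S then R else - R')) =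
        (\<Prod>b\<in>(Basis::'a set). R' - R)"
      by (rule prod.cong) auto
    then show ?thesis
      unfolding eq using True assms(2) by (subst emeasure_lborel_box) auto
  qed (simp add: orthant_def)
  then have "emeasure (Lambda f) (orthant S R R' :: ('a \<times> real) set) 
    = (\<integral>\<^sup>+h. ennreal ((R' - R) ^ DIM('a)) * (ennreal (f h) * indicator {..R'} h) \<partial>lborel)"
    by (subst emeasure_Lambda) (auto intro!: nn_integral_cong simp: mult_ac)
  then show ?thesis
    by (simp add: nn_integral_cmult)
qed

lemma measure_Lambda_diff_le:
  fixes B :: "('a::euclidean_space \<times> real) set"
  assumes [measurable]: "f \<in> borel_measurable borel" "g \<in> borel_measurable borel" "B \<in> sets borel"
    and pos: "\<And>x. 0 \<le> f x" "\<And>x. 0 \<le> g x"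
    and fin: "emeasure (Lambda f) B < \<infinity>" "emeasure (Lambda g) B < \<infinity>" "emeasure (Lambda (\<lambda>h. \<bar>f h - g h\<bar>)) B < \<infinity>"
  shows "\<bar>measure (Lambda f) B - measure (Lambda g) B\<bar> \<le> measure (Lambda (\<lambda>h. \<bar>f h - g h\<bar>)) B"
proof -
  have le: "emeasure (Lambda f') B \<le> emeasure (Lambda g') B + emeasure (Lambda (\<lambda>h. \<bar>f' h - g' h\<bar>)) B"
    if [measurable]: "f' \<in> borel_measurable borel" "g' \<in> borel_measurable borel"
        and "\<And>x. 0 \<le> f' x" "\<And>x. 0 \<le> g' x" for f' g' :: "real \<Rightarrow> real"
  proof -
    have B: "B \<in> sets (lborel \<Otimes>\<^sub>M lborel)" using assms(3) unfolding lborel_prod by simp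
    have m: "(\<lambda>h. emeasure lborel {v. (v, h) \<in> B}) \<in> borel_measurable lborel"
      using lborel_pair.measurable_emeasure_Pair2[OF B] by (simp add: vimage_def)
    have "ennreal (f' h) \<le> ennreal (g' h) + ennreal \<bar>f' h - g' h\<bar>" for h
      using that by (simp flip: ennreal_plus)
    then have "ennreal (f' h) * x \<le> ennreal (g' h) * x + ennreal \<bar>f' h - g' h\<bar> * x" for h x
      by (metis distrib_right mult_right_mono zero_le)
    then have "(\<integral>\<^sup>+h. ennreal (f' h) * emeasure lborel {v. (v, h) \<in> B} \<partial>lborel) \<le>
       (\<integral>\<^sup>+h. ennreal (g' h) * emeasure lborel {v. (v, h) \<in> B} +
          ennreal \<bar>f' h - g' h\<bar> * emeasure lborel {v. (v, h) \<in> B} \<partial>lborel)"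
      by (rule nn_integral_mono)
    also have "\<dots> = (\<integral>\<^sup>+h. ennreal (g' h) * emeasure lborel {v. (v, h) \<in> B} \<partial>lborel) +
        (\<integral>\<^sup>+h. ennreal \<bar>f' h - g' h\<bar> * emeasure lborel {v. (v, h) \<in> B} \<partial>lborel)"
      using m by (intro nn_integral_add) auto
    finally show ?thesis
      by (simp add: emeasure_Lambda)
  qed
  have "emeasure (Lambda f) B \<le> emeasure (Lambda g) B + emeasure (Lambda (\<lambda>h. \<bar>f h - g h\<bar>)) B"
    by (rule le) (use pos in auto)
  moreover have "emeasure (Lambda g) B \<le> emeasure (Lambda f) B + emeasure (Lambda (\<lambda>h. \<bar>f h - g h\<bar>)) B"
    using le[of g f] pos by (simp add: abs_minus_commute)
  ultimately show ?thesis
    using fin by (simp add: emeasure_eq_ennreal_measure less_top abs_le_iff flip: ennreal_plus)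
qed

section \<open>Expected numbers of cells\<close>

text \<open>What the probabilistic part uses of the assumptions: every paraboloid region has finite
  intensity and hence almost surely finitely many points.\<close>

definition intensity :: "nat \<Rightarrow> (real \<Rightarrow> real) \<Rightarrow> bool" where
  "intensity d f \<longleftrightarrow> f \<in> borel_measurable borel \<and> (\<forall>x. 0 \<le> f x) \<and>
    (\<forall>c L. 0 \<le> c \<longrightarrow> low_power_bound d f c L < \<infinity>)"

lemma intensityD:
  assumes "intensity d f"
  shows "f \<in> borel_measurable borel" "0 \<le> f x" "0 \<le> c \<Longrightarrow> low_power_bound d f c L < \<infinity>"
  using assms by (auto simp: intensity_def)

lemma intensity_integral_finite:
  assumes "intensity d f"
  shows "(\<integral>\<^sup>+h\<in>{..s}. ennreal (f h) \<partial>lborel) < \<infinity>"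
proof -
  \<comment> \<open>The choice \<open>c = 1\<close> makes the weight at least 1.\<close>
  have "(\<integral>\<^sup>+h\<in>{..s}. ennreal (f h) \<partial>lborel) \<le> low_power_bound d f 1 s"
    unfolding low_power_bound_def
  proof (rule nn_integral_mono)
    fix h
    have "1 \<le> (2 * (1 + sqrt (s - h))) ^ d" if "h \<le> s"
      using that by (intro one_le_power) (auto intro: add_increasing2)
    then have "f h * 1 \<le> f h * (2 * (1 + sqrt (s - h))) ^ d" if "h \<le> s"
      using that intensityD(2)[OF assms] by (intro mult_left_mono) auto
    then show "ennreal (f h) * indicator {..s} h \<le> ennreal (f h * (2 * (1 + sqrt (s - h))) ^ d) * indicator {..s} h"
      by (auto simp: indicator_def intro!: ennreal_leI)
  qed
  then show ?thesis
    using intensityD(3)[OF assms, of 1 s] by (auto intro: le_less_trans)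
qed

lemma intensity_fin:
  assumes "intensity DIM('a) f"
  shows "0 \<le> c \<Longrightarrow> emeasure (Lambda f) (low_power c L :: ('a::euclidean_space \<times> real) set) < \<infinity>"
    and "0 \<le> r \<Longrightarrow> emeasure (Lambda f) (column_below r s :: ('a \<times> real) set) < \<infinity>"
    and "R \<le> R' \<Longrightarrow> emeasure (Lambda f) (orthant S R R' :: ('a \<times> real) set) < \<infinity>"
proof -
  note int = intensityD[OF assms]
  show "emeasure (Lambda f) (low_power c L :: ('a \<times> real) set) < \<infinity>" if "0 \<le> c"
    using emeasure_Lambda_low_power_le[of f c L, where 'a='a] int that by (meson le_less_trans)
  show "emeasure (Lambda f) (column_below r s :: ('a \<times> real) set) < \<infinity>" if "0 \<le> r"
    using that int(1) intensity_integral_finite[OF assms] by (simp add: emeasure_Lambda_column ennreal_mult_less_top)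
  show "emeasure (Lambda f) (orthant S R R' :: ('a \<times> real) set) < \<infinity>" if "R \<le> R'"
    using that int(1) intensity_integral_finite[OF assms] by (simp add: emeasure_Lambda_orthant ennreal_mult_less_top)
qed

text \<open>Disjoint pieces of an exhaustion are used because \<open>borel_measurable_count\<close>
  asks for a partition.\<close>

definition locally_finite_config :: "('a::euclidean_space \<times> real) set \<Rightarrow> bool" where
  "locally_finite_config X \<longleftrightarrow> (\<forall>j. points_in (disjointed (\<lambda>j. low_power (real j) (real j)) j) X < \<infinity>)"

lemma UN_low_power: "(\<Union>j. low_power (real j) (real j)) = (UNIV :: ('a::euclidean_space \<times> real) set)"
proof (intro set_eqI iffI UNIV_I)
  fix x :: "'a \<times> real"
  obtain v h where x: "x = (v, h)" by force
  obtain j :: nat where j: "max (norm v) h \<le> real j" using real_arch_simple by blast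
  then have "x \<in> low_power (real j) (real j)" by (auto simp: x low_power_def intro: add_increasing2)
  then show "x \<in> (\<Union>j. low_power (real j) (real j))" by blast
qed

lemma sets_disjointed_low_power [measurable]:
  "disjointed (\<lambda>j. low_power (real j) (real j)) j \<in> sets (borel :: ('a::euclidean_space \<times> real) measure)"
proof -
  have "range (disjointed (\<lambda>j. low_power (real j) (real j))) \<subseteq> sets (borel :: ('a \<times> real) measure)"
    by (intro sets.range_disjointed_sets) auto
  then show ?thesis by auto
qed

lemma sets_locally_finite_config [measurable]: "Measurable.pred configs locally_finite_config"
  unfolding locally_finite_config_def by measurable

lemma locally_finite_config_Int: "locally_finite_config X \<Longrightarrow> locally_finite_config (X \<inter> K)"
proof -
  have "points_in B (X \<inter> K) \<le> points_in B X" for B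
    unfolding points_in_def by (rule emeasure_mono) auto
  then show "locally_finite_config X \<Longrightarrow> locally_finite_config (X \<inter> K)"
    unfolding locally_finite_config_def using le_less_trans by blast
qed

text \<open>Off the locally finite configurations the value is set to 0. The Poisson processes
  considered avoid these configurations almost surely, so expectations do not change.\<close>

lemma borel_measurable_cell_count:
  assumes "{(p, Z). \<Psi> (laguerre_cell p Z)} \<in> sets (borel \<Otimes>\<^sub>M configs)"
  shows "(\<lambda>X. if locally_finite_config X then cell_count \<Psi> X else 0) \<in> borel_measurable configs"
proof -
  have "(\<lambda>X. if \<forall>j. points_in (disjointed (\<lambda>j. low_power (real j) (real j)) j) X < \<infinity> then
      points_in {p. (p, X) \<in> {(p, Z). \<Psi> (laguerre_cell p Z)}} X else 0) \<in> borel_measurable configs"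
    by (rule borel_measurable_count[OF _ _ _ assms])
      (auto simp: disjoint_family_disjointed UN_disjointed_eq UN_low_power)
  then show ?thesis
    unfolding locally_finite_config_def cell_count_def mem_Collect_eq prod.case .
qed

lemma poisson_locally_finite:
  fixes X :: "'w \<Rightarrow> ('a::euclidean_space \<times> real) set"
  assumes PX: "poisson_process M X (Lambda f)" and int: "intensity DIM('a) f"
  shows "AE \<omega> in M. locally_finite_config (X \<omega>)"
  unfolding locally_finite_config_def
proof (rule AE_all_countable[THEN iffD2], rule allI)
  fix j
  let ?B = "disjointed (\<lambda>j. low_power (real j) (real j) :: ('a \<times> real) set) j"
  have B: "?B \<in> sets borel" by measurable
  have "emeasure (Lambda f) ?B \<le> emeasure (Lambda f) (low_power (real j) (real j) :: ('a \<times> real) set)"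
    by (intro emeasure_mono disjointed_subset) simp
  also have "\<dots> < \<infinity>" by (rule intensity_fin[OF int]) simp
  finally show "AE \<omega> in M. points_in ?B (X \<omega>) < \<infinity>"
    by (rule poisson_AE_finite[OF PX sets_Lambda B])
qed

lemma points_in_eq_0_iff: "points_in B X = 0 \<longleftrightarrow> X \<inter> B = {}"
  unfolding points_in_def by (subst emeasure_count_space_eq_0) auto

text \<open>Counts of disjoint sets are independent. \<open>A\<close> and \<open>B\<close> are coded
  as a family over \<open>{..<2}\<close>, the shape in which \<open>poisson_process\<close> provides
  independence.\<close>

lemma poisson_mean_void:
  fixes X :: "'w \<Rightarrow> 'b::topological_space set"
  assumes PX: "poisson_process M X \<Lambda>" and sets_L: "sets \<Lambda> = sets borel"
    and A [measurable]: "A \<in> sets borel" "emeasure \<Lambda> A < \<infinity>" 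
    and B [measurable]: "B \<in> sets borel" "emeasure \<Lambda> B < \<infinity>" and AB: "A \<inter> B = {}"
  shows "(\<integral>\<^sup>+\<omega>. points_in A (X \<omega>) * indicator {0} (points_in B (X \<omega>)) \<partial>M) =
      ennreal (measure \<Lambda> A * exp (- measure \<Lambda> B))"
proof -
  interpret prob_space M using PX sets_L by (rule poisson_prob_space)
  have X [measurable]: "X \<in> M \<rightarrow>\<^sub>M configs" using PX sets_L by (rule poisson_measurable)
  define C where "C i = (if i = 0 then A else B)" for i :: nat
  define g where "g i = (if i = 0 then (\<lambda>x. x) else indicator {0 :: ennreal} :: ennreal \<Rightarrow> ennreal)" for i :: nat
  have ind: "indep_vars (\<lambda>_. borel) (\<lambda>i \<omega>. points_in (C i) (X \<omega>)) {..<2}"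
  proof (rule poisson_indep[OF PX sets_L])
    show "disjoint_family_on C {..<2}"
      using AB by (auto simp: disjoint_family_on_def C_def)
  qed (auto simp: C_def)
  have "indep_vars (\<lambda>_. borel) (\<lambda>i \<omega>. g i (points_in (C i) (X \<omega>))) {..<2}"
    by (rule indep_vars_compose2[OF ind]) (auto simp: g_def)
  then have "(\<integral>\<^sup>+\<omega>. (\<Prod>i<2. g i (points_in (C i) (X \<omega>))) \<partial>M) = (\<Prod>i<2. \<integral>\<^sup>+\<omega>. g i (points_in (C i) (X \<omega>)) \<partial>M)"
    by (intro indep_vars_nn_integral) auto
  then have "(\<integral>\<^sup>+\<omega>. points_in A (X \<omega>) * indicator {0} (points_in B (X \<omega>)) \<partial>M)
      = (\<integral>\<^sup>+\<omega>. points_in A (X \<omega>) \<partial>M) * (\<integral>\<^sup>+\<omega>. indicator {0} (points_in B (X \<omega>)) \<partial>M)"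
    by (simp add: C_def g_def numeral_2_eq_2)
  also have "(\<integral>\<^sup>+\<omega>. points_in A (X \<omega>) \<partial>M) = ennreal (measure \<Lambda> A)"
    using poisson_mean[OF PX sets_L A] A by (simp add: emeasure_eq_ennreal_measure)
  also have "(\<integral>\<^sup>+\<omega>. indicator {0} (points_in B (X \<omega>)) \<partial>M) = emeasure M {\<omega> \<in> space M. points_in B (X \<omega>) = 0}"
  proof -
    have "(\<integral>\<^sup>+\<omega>. indicator {0} (points_in B (X \<omega>)) \<partial>M) = (\<integral>\<^sup>+\<omega>. indicator {\<omega> \<in> space M. points_in B (X \<omega>) = 0} \<omega> \<partial>M)"
      by (intro nn_integral_cong) (simp add: indicator_def)
    then show ?thesis by simp
  qed
  also have "\<dots> = ennreal (exp (- measure \<Lambda> B))"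
    using poisson_void[OF PX sets_L B] by (simp add: emeasure_eq_measure)
  finally show ?thesis by (simp add: ennreal_mult)
qed

lemma expected_cell_count_tail:
  fixes X :: "'w \<Rightarrow> ('a::euclidean_space \<times> real) set" and r s :: "nat \<Rightarrow> real"
  assumes PX: "poisson_process M X (Lambda f)" and int: "intensity DIM('a) f"
    and \<Psi>: "\<And>C. \<Psi> C \<Longrightarrow> C \<inter> cball 0 c \<noteq> {}" and c: "0 \<le> c" and r: "\<And>j. 0 \<le> r j"
    and void: "filterlim (\<lambda>j. measure (Lambda f) (column_below (r j) (s j) :: ('a \<times> real) set)) at_top sequentially"
    and t: "summable t" "\<And>j. measure (Lambda f) (low_power c ((c + sqrt DIM('a) * r (Suc j))\<^sup>2 +
        s (Suc j)) :: ('a \<times> real) set) *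
      exp (- measure (Lambda f) (column_below (r j) (s j) :: ('a \<times> real) set)) \<le> t j"
  shows "(\<integral>\<^sup>+\<omega>. cell_count \<Psi> (X \<omega>) * indicator {Z. Z \<inter> column_below (r k) (s k) = {}} (X \<omega>) \<partial>M) \<le>
      ennreal (\<Sum>j. t (j + k))"
proof -
  interpret prob_space M using PX sets_Lambda by (rule poisson_prob_space)
  have X [measurable]: "X \<in> M \<rightarrow>\<^sub>M configs" using PX sets_Lambda by (rule poisson_measurable)
  let ?col = "\<lambda>j. column_below (r j) (s j) :: ('a \<times> real) set"
  let ?low = "\<lambda>j. low_power c ((c + sqrt DIM('a) * r j)\<^sup>2 + s j) :: ('a \<times> real) set"
  have t0: "0 \<le> t j" for j
    by (rule order_trans[OF _ t(2)]) simp
  have fin: "emeasure (Lambda f) (?low j) < \<infinity>" "emeasure (Lambda f) (?col j) < \<infinity>" for j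
    using intensity_fin[OF int] c r by auto
  \<comment> \<open>Missing all boxes is at most as likely as missing any single one, and
    \<open>void\<close> sends these probabilities to 0.\<close>
  have "prob {\<omega> \<in> space M. \<forall>j\<ge>k. points_in (?col j) (X \<omega>) = 0} \<le> 0"
  proof (rule tendsto_lowerbound[OF _ _ sequentially_bot])
    show "(\<lambda>j. exp (- measure (Lambda f) (?col j))) \<longlonglongrightarrow> 0"
      by (rule filterlim_compose[OF exp_at_bot]) (use void in \<open>simp add: filterlim_uminus_at_bot\<close>)
    have "prob {\<omega> \<in> space M. \<forall>j\<ge>k. points_in (?col j) (X \<omega>) = 0} \<le> exp (- measure (Lambda f) (?col j))"
        if "j \<ge> k" for j
      unfolding poisson_void[OF PX sets_Lambda sets_column fin(2), symmetric]
      using that by (intro finite_measure_mono) auto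
    then show "\<forall>\<^sub>F j in sequentially. prob {\<omega> \<in> space M. \<forall>j\<ge>k. points_in (?col j) (X \<omega>) = 0} \<le>
        exp (- measure (Lambda f) (?col j))"
      by (rule eventually_sequentiallyI[of k])
  qed
  then have "prob {\<omega> \<in> space M. \<forall>j\<ge>k. points_in (?col j) (X \<omega>) = 0} = 0"
    by (simp add: measure_le_0_iff)
  then have AE_hit: "AE \<omega> in M. \<exists>j\<ge>k. X \<omega> \<inter> ?col j \<noteq> {}"
    by (subst AE_iff_measurable[OF _ refl]) (auto simp: emeasure_eq_measure points_in_eq_0_iff[symmetric])
  let ?u = "\<lambda>j \<omega>. points_in (?low (Suc (j + k)) - ?col (j + k)) (X \<omega>) *
      indicator {0} (points_in (?col (j + k)) (X \<omega>))"
  have "(\<integral>\<^sup>+\<omega>. cell_count \<Psi> (X \<omega>) * indicator {Z. Z \<inter> ?col k = {}} (X \<omega>) \<partial>M) \<le> (\<integral>\<^sup>+\<omega>. (\<Sum>j. ?u j \<omega>) \<partial>M)"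
  proof (rule nn_integral_mono_AE)
    show "AE \<omega> in M. cell_count \<Psi> (X \<omega>) * indicator {Z. Z \<inter> ?col k = {}} (X \<omega>) \<le> (\<Sum>j. ?u j \<omega>)"
      using AE_hit
    proof (rule AE_mp, intro AE_I2 impI)
      fix \<omega> assume ex: "\<exists>j\<ge>k. X \<omega> \<inter> ?col j \<noteq> {}"
      show "cell_count \<Psi> (X \<omega>) * indicator {Z. Z \<inter> ?col k = {}} (X \<omega>) \<le> (\<Sum>j. ?u j \<omega>)"
      proof (cases "X \<omega> \<inter> ?col k = {}")
        case True
        \<comment> \<open>Box \<open>i + k\<close> is the first one from \<open>k\<close> on that is
          hit. As box \<open>k\<close> is missed, it has a predecessor \<open>j + k\<close>, which
          is empty.\<close>
        define i where "i = (LEAST i. X \<omega> \<inter> ?col (i + k) \<noteq> {})"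
        have "\<exists>i. X \<omega> \<inter> ?col (i + k) \<noteq> {}" using ex by (metis le_add_diff_inverse2)
        then have i: "X \<omega> \<inter> ?col (i + k) \<noteq> {}" unfolding i_def by (rule LeastI_ex)
        then obtain j where j: "i = Suc j" using True by (cases i) auto
        then have "X \<omega> \<inter> ?col (j + k) = {}"
          using not_less_Least[of j "\<lambda>i. X \<omega> \<inter> ?col (i + k) \<noteq> {}"] by (auto simp: i_def)
        have "cell_count \<Psi> (X \<omega>) \<le> points_in (?low (Suc (j + k))) (X \<omega>)"
          using i j by (intro cell_count_le_points_in[OF \<Psi>]) auto
        also have "\<dots> = points_in (?low (Suc (j + k)) - ?col (j + k)) (X \<omega>)"
          using \<open>X \<omega> \<inter> ?col (j + k) = {}\<close> unfolding points_in_def by (intro arg_cong[where f="emeasure _"]) auto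
        also have "\<dots> = ?u j \<omega>"
          using \<open>X \<omega> \<inter> ?col (j + k) = {}\<close> by (simp add: points_in_eq_0_iff)
        also have "\<dots> \<le> (\<Sum>j. ?u j \<omega>)" using sum_le_suminf[of "\<lambda>j. ?u j \<omega>" "{j}"] by (simp del: sum_mult_indicator)
        finally show ?thesis using True by simp
      qed simp
    qed
  qed
  also have "\<dots> = (\<Sum>j. \<integral>\<^sup>+\<omega>. ?u j \<omega> \<partial>M)"
    by (rule nn_integral_suminf) simp
  also have "\<dots> \<le> (\<Sum>j. ennreal (t (j + k)))"
  proof (intro suminf_le allI summableI)
    fix j
    have le: "emeasure (Lambda f) (?low (Suc (j + k)) - ?col (j + k)) \<le> emeasure (Lambda f) (?low (Suc (j + k)))"
      by (intro emeasure_mono) auto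
    then have fin': "emeasure (Lambda f) (?low (Suc (j + k)) - ?col (j + k)) < \<infinity>"
      using fin(1) by (rule le_less_trans)
    have "(\<integral>\<^sup>+\<omega>. ?u j \<omega> \<partial>M) = ennreal (measure (Lambda f) (?low (Suc (j + k)) - ?col (j + k)) *
        exp (- measure (Lambda f) (?col (j + k))))"
      by (rule poisson_mean_void[OF PX sets_Lambda _ fin' _ fin(2)]) auto
    also have "\<dots> \<le> ennreal (measure (Lambda f) (?low (Suc (j + k))) * exp (- measure (Lambda f) (?col (j + k))))"
      using fin(1)[of "Suc (j + k)"] 
      by (intro ennreal_leI mult_right_mono measure_mono_fmeasurable) (auto simp: fmeasurable_def)
    also have "\<dots> \<le> ennreal (t (j + k))"
      using t(2)[of "j + k"] by (intro ennreal_leI) simp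
    finally show "(\<integral>\<^sup>+\<omega>. ?u j \<omega> \<partial>M) \<le> ennreal (t (j + k))" .
  qed
  also have "\<dots> = ennreal (\<Sum>j. t (j + k))"
    using t t0 by (intro suminf_ennreal2) (auto simp: summable_iff_shift)
  finally show ?thesis .
qed

lemma sets_good_config [measurable]:
  "Measurable.pred configs (good_config c r s H R R' :: ('a::euclidean_space \<times> real) set \<Rightarrow> bool)"
proof -
  have [measurable]: "low_power c L \<inter> UNIV \<times> {..< -H} \<in> sets (borel :: ('a \<times> real) measure)" for L
    by (intro sets.Int sets_low_power borel_open open_Times) auto
  show ?thesis
    unfolding good_config_def points_in_eq_0_iff[symmetric] by measurable
qed

section \<open>Comparison of two expected counts\<close>

lemma cell_count_nat: "cell_count \<Psi> X = \<infinity> \<or> (\<exists>k. cell_count \<Psi> X = of_nat k)"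
  unfolding cell_count_def points_in_def by (auto simp: emeasure_count_space)

lemma sum_less_eq_min: "(\<Sum>i<K. if i < k then 1 else 0) = (of_nat (min K k) :: ennreal)"
proof -
  have "(\<Sum>i<K. if i < k then 1 else 0) = (\<Sum>i\<in>{..<K} \<inter> {..<k}. 1 :: ennreal)"
    by (subst sum.inter_restrict) (auto intro!: sum.cong)
  also have "{..<K} \<inter> {..<k} = {..<min K k}" by auto
  finally show ?thesis by simp
qed

text \<open>A layer-cake formula: the count capped at \<open>K\<close> becomes a sum of indicators,
  so expectations can be compared through probabilities of events.\<close>

lemma sum_less_cell_count: "(\<Sum>i<K. if of_nat i < cell_count \<Psi> X then 1 else 0) = min (of_nat K) (cell_count \<Psi> X)"
  using cell_count_nat[of \<Psi> X]
proof
  assume "cell_count \<Psi> X = \<infinity>"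
  then show ?thesis by (simp add: of_nat_less_top)
next
  assume "\<exists>k. cell_count \<Psi> X = of_nat k"
  then show ?thesis by (auto simp: sum_less_eq_min min_def)
qed

lemma intensity_abs_diff:
  assumes "intensity d f" "intensity d g"
  shows "intensity d (\<lambda>h. \<bar>f h - g h\<bar>)"
  unfolding intensity_def
proof (intro conjI allI impI)
  note [measurable] = intensityD(1)[OF assms(1)] intensityD(1)[OF assms(2)]
  note pos = intensityD(2)[OF assms(1)] intensityD(2)[OF assms(2)]
  show "(\<lambda>h. \<bar>f h - g h\<bar>) \<in> borel_measurable borel" by measurable
  fix c L :: real assume c: "0 \<le> c"
  let ?w = "\<lambda>h. (2 * (c + sqrt (L - h))) ^ d"
  have "low_power_bound d (\<lambda>h. \<bar>f h - g h\<bar>) c L \<le>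
      (\<integral>\<^sup>+h. ennreal (f h * ?w h) * indicator {..L} h + ennreal (g h * ?w h) * indicator {..L} h \<partial>lborel)"
    unfolding low_power_bound_def
  proof (rule nn_integral_mono)
    fix h :: real
    have "ennreal (\<bar>f h - g h\<bar> * ?w h) \<le> ennreal (f h * ?w h) + ennreal (g h * ?w h)" if "h \<le> L"
    proof -
      have "0 \<le> ?w h" using that c by auto
      then have "\<bar>f h - g h\<bar> * ?w h \<le> (f h + g h) * ?w h"
        using pos[of h] by (intro mult_right_mono) auto
      then show ?thesis
        using pos[of h] \<open>0 \<le> ?w h\<close> by (simp add: distrib_right flip: ennreal_plus)
    qed
    then show "ennreal (\<bar>f h - g h\<bar> * ?w h) * indicator {..L} h \<le>
        ennreal (f h * ?w h) * indicator {..L} h + ennreal (g h * ?w h) * indicator {..L} h"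
      by (auto simp: indicator_def)
  qed
  also have "\<dots> = low_power_bound d f c L + low_power_bound d g c L"
    unfolding low_power_bound_def by (rule nn_integral_add) auto
  also have "\<dots> < \<infinity>"
    using intensityD(3)[OF assms(1) c] intensityD(3)[OF assms(2) c] by simp
  finally show "low_power_bound d (\<lambda>h. \<bar>f h - g h\<bar>) c L < \<infinity>" .
qed auto

lemma points_in_ge_1:
  assumes "points_in B X \<noteq> 0"
  shows "1 \<le> points_in B X"
proof -
  obtain x where "x \<in> X \<inter> B" using assms by (auto simp: points_in_eq_0_iff)
  then have "emeasure (count_space UNIV) {x} \<le> points_in B X"
    unfolding points_in_def by (intro emeasure_mono) auto
  then show ?thesis by simp
qed

text \<open>The error terms account in turn for an empty box, for more than \<open>K\<close> candidate cells, for the two ways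
  in which a configuration with a point in the box can fail to be good, and for the total variation distance.\<close>

lemma expected_cell_count_compare:
  fixes X :: "'w \<Rightarrow> ('a::euclidean_space \<times> real) set" and Y :: "'v \<Rightarrow> ('a \<times> real) set"
  assumes PX: "poisson_process M X (Lambda f)" and intf: "intensity DIM('a) f"
    and PY: "poisson_process N Y (Lambda g)" and intg: "intensity DIM('a) g"
    and \<Psi>: "\<And>C. \<Psi> C \<Longrightarrow> C \<inter> cball 0 c \<noteq> {}" "{(p, Z). \<Psi> (laguerre_cell p Z)} \<in> sets (borel \<Otimes>\<^sub>M configs)"
    and c: "0 \<le> c" and T: "0 \<le> T"
        "(\<integral>\<^sup>+\<omega>. cell_count \<Psi> (X \<omega>) * indicator {Z. Z \<inter> column_below r s = {}} (X \<omega>) \<partial>M) \<le> ennreal T"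
    and R: "c + sqrt ((c + sqrt DIM('a) * r)\<^sup>2 + s + H) + 1 \<le> R" "0 \<le> R" "R \<le> R'"
    and m: "(real DIM('a) * R'\<^sup>2 + R' + H) / 2 \<le> m" "c \<le> m" and r: "0 \<le> r"
    and L: "(m + sqrt DIM('a) * r)\<^sup>2 + s \<le> L" "(sqrt DIM('a) * R')\<^sup>2 + R' \<le> L" "(sqrt DIM('a) * r)\<^sup>2 + s \<le> L"
    and K: "0 < (K::nat)"
    and low: "measure (Lambda f) (low_power c ((c + sqrt DIM('a) * r)\<^sup>2 + s) :: ('a \<times> real) set) \<le> l"
    and bad: "measure (Lambda f) (low_power c ((c + sqrt DIM('a) * r)\<^sup>2 + s) \<inter>
        UNIV \<times> {..< -H} :: ('a \<times> real) set) \<le> b"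
    and orth: "\<And>S. S \<in> Pow Basis \<Longrightarrow> \<rho> \<le> measure (Lambda f) (orthant S R R' :: ('a \<times> real) set)"
    and D: "measure (Lambda (\<lambda>h. \<bar>f h - g h\<bar>)) (low_power m L :: ('a \<times> real) set) \<le> \<delta>"
  shows "(\<integral>\<^sup>+\<omega>. cell_count \<Psi> (X \<omega>) \<partial>M) \<le> (\<integral>\<^sup>+\<omega>. cell_count \<Psi> (Y \<omega>) \<partial>N) +
    ennreal (T + l\<^sup>2 / K + K * (b + 2 ^ DIM('a) * exp (- \<rho>) + \<delta>))"
proof -
  interpret M: prob_space M using PX sets_Lambda by (rule poisson_prob_space)
  interpret N: prob_space N using PY sets_Lambda by (rule poisson_prob_space)
  have X [measurable]: "X \<in> M \<rightarrow>\<^sub>M configs" using PX sets_Lambda by (rule poisson_measurable)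
  have Y [measurable]: "Y \<in> N \<rightarrow>\<^sub>M configs" using PY sets_Lambda by (rule poisson_measurable)
  let ?L0 = "(c + sqrt DIM('a) * r)\<^sup>2 + s"
  let ?low = "low_power c ?L0 :: ('a \<times> real) set"
  let ?bad = "low_power c ?L0 \<inter> UNIV \<times> {..< -H} :: ('a \<times> real) set"
  let ?K = "low_power m L :: ('a \<times> real) set"
  let ?good = "good_config c r s H R R' :: ('a \<times> real) set \<Rightarrow> bool"
  have m0: "0 \<le> m" using c m by simp
  have bad_sets [measurable]: "?bad \<in> sets borel"
    by (intro sets.Int sets_low_power borel_open open_Times) auto
  note fin = intensity_fin[OF intf]
  have finlow: "emeasure (Lambda f) ?low < \<infinity>" using fin c by auto
  have finbad: "emeasure (Lambda f) ?bad < \<infinity>"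
    by (rule le_less_trans[OF emeasure_mono finlow]) auto
  have l0: "0 \<le> l" "0 \<le> b" "0 \<le> \<delta>"
    using order_trans[OF measure_nonneg low] order_trans[OF measure_nonneg bad] order_trans[OF measure_nonneg D] .
  \<comment> \<open>The event that at least \<open>i + 1\<close> cells are counted, to be evaluated
    on the window. Goodness is part of it, as only then the window count can be trusted.\<close>
  define S where "S i = {Z :: ('a \<times> real) set. ?good Z \<and> of_nat i <
      (if locally_finite_config Z then cell_count \<Psi> Z else 0)}" for i :: nat
  have S [measurable]: "S i \<in> sets configs" for i
  proof -
    note borel_measurable_cell_count[OF \<Psi>(2), measurable]
    have "S i = {Z \<in> space configs. ?good Z \<and> of_nat i < (if locally_finite_config Z then cell_count \<Psi> Z else 0)}"
      by (simp add: S_def)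
    also have "\<dots> \<in> sets configs" by measurable
    finally show ?thesis .
  qed
  \<comment> \<open>The deep part that must be empty lies inside the window, so goodness seen in the
    window implies goodness of the whole configuration.\<close>
  have goodK: "?good Z" if "?good (Z \<inter> ?K)" for Z
  proof -
    have "?low \<subseteq> ?K"
    proof (rule low_power_mono[OF m(2)])
      have "(c + sqrt DIM('a) * r)\<^sup>2 \<le> (m + sqrt DIM('a) * r)\<^sup>2"
        using m(2) c r by (intro power_mono) auto
      then show "?L0 \<le> L" using L(1) by linarith
    qed
    then show ?thesis using that unfolding good_config_def by blast
  qed
  have loc: "cell_count \<Psi> Z = cell_count \<Psi> (Z \<inter> ?K)" if "?good Z" for Z
    by (rule cell_count_localise[OF \<Psi>(1) that R(1,2) m m0 L])
  let ?P = "\<lambda>Z. points_in ?low Z"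
  let ?tail = "\<lambda>Z. if of_nat K < ?P Z then ?P Z else 0"
  let ?empty = "\<lambda>S Z. indicator {0} (points_in (orthant S R R') Z) :: ennreal"
  let ?sum = "\<lambda>Z. \<Sum>i<K. indicator (S i) (Z \<inter> ?K) :: ennreal"
  \<comment> \<open>If the box is empty, the first summand is the count itself. Otherwise the count
    is at most \<open>?P Z\<close>; once this is at most \<open>K\<close>, each way of failing to be
    good is charged with \<open>K\<close>, and for a good configuration \<open>?sum\<close> is
    exact.\<close>
  have ptw: "cell_count \<Psi> Z \<le> cell_count \<Psi> Z * indicator {Z. Z \<inter> column_below r s = {}} Z
      + (?tail Z + (of_nat K * points_in ?bad Z + ((\<Sum>S\<in>Pow Basis. of_nat K * ?empty S Z) + ?sum Z)))"
    if lf: "locally_finite_config Z" for Z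
  proof (cases "Z \<inter> column_below r s = {}")
    case False
    have NP: "cell_count \<Psi> Z \<le> ?P Z"
      by (rule cell_count_le_points_in[OF \<Psi>(1) False])
    have "cell_count \<Psi> Z \<le> ?tail Z + (of_nat K * points_in ?bad Z + ((\<Sum>S\<in>Pow Basis. of_nat K * ?empty S Z) + ?sum Z))"
    proof (cases "of_nat K < ?P Z")
      case True
      then show ?thesis using NP by (simp add: add_increasing2)
    next
      case nK: False
      then have NK: "cell_count \<Psi> Z \<le> of_nat K" using NP by (simp add: not_less order_trans)
      show ?thesis
      proof (cases "?good Z")
        case True
        have good': "?good (Z \<inter> ?K)" by (rule good_config_Int[OF m0 L(3,2) R(2) True])
        have "cell_count \<Psi> Z = (\<Sum>i<K. if of_nat i < cell_count \<Psi> Z then 1 else 0)"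
          unfolding sum_less_cell_count using NK by (simp add: min_absorb2)
        also have "\<dots> = ?sum Z"
          using good' locally_finite_config_Int[OF lf] loc[OF True] by (intro sum.cong) (auto simp: S_def)
        finally show ?thesis by (simp add: add_increasing)
      next
        case bad: False
        consider "Z \<inter> ?bad \<noteq> {}" | S where "S \<in> Pow Basis" "Z \<inter> orthant S R R' = {}"
          using bad False unfolding good_config_def by blast
        then show ?thesis
        proof cases
          case 1
          then have "points_in ?bad Z \<noteq> 0" by (simp add: points_in_eq_0_iff)
          then have "1 \<le> points_in ?bad Z" by (rule points_in_ge_1)
          then have "of_nat K * 1 \<le> of_nat K * points_in ?bad Z" by (intro mult_left_mono) auto
          then have "of_nat K \<le> of_nat K * points_in ?bad Z" by simp
          then show ?thesis using NK
            by (intro add_increasing[OF zero_le] add_increasing2[OF zero_le]) (auto intro: order_trans)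
        next
          case 2
          then have "of_nat K = of_nat K * ?empty S Z" by (simp add: points_in_eq_0_iff)
          also have "\<dots> \<le> (\<Sum>S\<in>Pow Basis. of_nat K * ?empty S Z)"
            using 2 by (intro member_le_sum) auto
          finally show ?thesis using NK
            by (intro add_increasing[OF zero_le] add_increasing2[OF zero_le]) (auto intro: order_trans)
        qed
      qed
    qed
    then show ?thesis using False by simp
  qed (simp add: add_increasing2)
  have "(\<integral>\<^sup>+\<omega>. cell_count \<Psi> (X \<omega>) \<partial>M) \<le> (\<integral>\<^sup>+\<omega>. cell_count \<Psi> (X \<omega>) * indicator {Z. Z \<inter> column_below r s = {}} (X \<omega>)
      + (?tail (X \<omega>) + (of_nat K * points_in ?bad (X \<omega>) +
          ((\<Sum>S\<in>Pow Basis. of_nat K * ?empty S (X \<omega>)) + ?sum (X \<omega>)))) \<partial>M)"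
    by (rule nn_integral_mono_AE, rule AE_mp[OF poisson_locally_finite[OF PX intf]], rule AE_I2, rule impI, rule ptw)
  also have "\<dots> = (\<integral>\<^sup>+\<omega>. (if locally_finite_config (X \<omega>) then cell_count \<Psi> (X \<omega>) else 0) * indicator {Z.
      Z \<inter> column_below r s = {}} (X \<omega>)
      + (?tail (X \<omega>) + (of_nat K * points_in ?bad (X \<omega>) +
          ((\<Sum>S\<in>Pow Basis. of_nat K * ?empty S (X \<omega>)) + ?sum (X \<omega>)))) \<partial>M)"
    by (rule nn_integral_cong_AE, rule AE_mp[OF poisson_locally_finite[OF PX intf]], rule AE_I2, rule impI)
        (simp only: if_True)
  also have "\<dots> = (\<integral>\<^sup>+\<omega>. (if locally_finite_config (X \<omega>) then cell_count \<Psi> (X \<omega>) else 0) * indicator {Z.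
      Z \<inter> column_below r s = {}} (X \<omega>) \<partial>M)
      + ((\<integral>\<^sup>+\<omega>. ?tail (X \<omega>) \<partial>M) + ((\<integral>\<^sup>+\<omega>. of_nat K * points_in ?bad (X \<omega>) \<partial>M) +
      ((\<integral>\<^sup>+\<omega>. (\<Sum>S\<in>Pow Basis. of_nat K * ?empty S (X \<omega>)) \<partial>M) + (\<integral>\<^sup>+\<omega>. ?sum (X \<omega>) \<partial>M))))"
  proof -
    note borel_measurable_cell_count[OF \<Psi>(2), measurable]
    have [measurable]: "{Z. Z \<inter> column_below r s = {}} \<in> sets (configs :: ('a \<times> real) set measure)"
    proof -
      have "{Z. Z \<inter> column_below r s = {}} =
          {Z \<in> space (configs :: ('a \<times> real) set measure). points_in (column_below r s) Z = 0}"
        by (simp add: points_in_eq_0_iff)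
      also have "\<dots> \<in> sets configs" by measurable
      finally show ?thesis .
    qed
    have add5: "(\<integral>\<^sup>+x. a x + (b x + (c x + (d x + e x))) \<partial>M) =
        (\<integral>\<^sup>+x. a x \<partial>M) + ((\<integral>\<^sup>+x. b x \<partial>M) + ((\<integral>\<^sup>+x. c x \<partial>M) + ((\<integral>\<^sup>+x. d x \<partial>M) + (\<integral>\<^sup>+x. e x \<partial>M))))"
      if [measurable]: "a \<in> borel_measurable M" "b \<in> borel_measurable M" "c \<in> borel_measurable M"
        "d \<in> borel_measurable M" "e \<in> borel_measurable M" for a b c d e :: "'w \<Rightarrow> ennreal"
      by (simp add: nn_integral_add)
    show ?thesis by (rule add5) measurable
  qed
  also have "(\<integral>\<^sup>+\<omega>. (if locally_finite_config (X \<omega>) then cell_count \<Psi> (X \<omega>) else 0) * indicator {Z.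
      Z \<inter> column_below r s = {}} (X \<omega>) \<partial>M)
    = (\<integral>\<^sup>+\<omega>. cell_count \<Psi> (X \<omega>) * indicator {Z. Z \<inter> column_below r s = {}} (X \<omega>) \<partial>M)"
    using poisson_locally_finite[OF PX intf] by (intro nn_integral_cong_AE) auto
  also note T(2)
  also have "(\<integral>\<^sup>+\<omega>. ?tail (X \<omega>) \<partial>M) \<le> ennreal (l\<^sup>2 / K)"
  proof -
    have "(\<integral>\<^sup>+\<omega>. ?tail (X \<omega>) \<partial>M) =
        (\<integral>\<^sup>+k. (if of_nat K < (of_nat k :: ennreal) then of_nat k else 0) \<partial>measure_pmf
            (poi (measure (Lambda f) ?low)))"
      by (rule poisson_nn_integral[OF PX sets_Lambda sets_low_power finlow, of "\<lambda>x. if of_nat K <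
          x then x else 0"]) measurable
    also have "\<dots> \<le> ennreal ((measure (Lambda f) ?low)\<^sup>2 / K)"
      using nn_integral_poi_tail[OF _ K, of "measure (Lambda f) ?low"] by simp
    also have "\<dots> \<le> ennreal (l\<^sup>2 / K)"
      using low l0 by (intro ennreal_leI divide_right_mono power_mono) auto
    finally show ?thesis .
  qed
  also have "(\<integral>\<^sup>+\<omega>. of_nat K * points_in ?bad (X \<omega>) \<partial>M) \<le> ennreal (K * b)"
  proof -
    have "(\<integral>\<^sup>+\<omega>. of_nat K * points_in ?bad (X \<omega>) \<partial>M) = of_nat K * emeasure (Lambda f) ?bad"
      using poisson_mean[OF PX sets_Lambda bad_sets finbad] by (simp add: nn_integral_cmult)
    also have "\<dots> \<le> of_nat K * ennreal b"
      using bad finbad by (intro mult_left_mono) (auto simp: emeasure_eq_ennreal_measure ennreal_leI)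
    finally show ?thesis by (simp add: ennreal_mult' ennreal_of_nat_eq_real_of_nat)
  qed
  also have "(\<integral>\<^sup>+\<omega>. (\<Sum>S\<in>Pow Basis. of_nat K * ?empty S (X \<omega>)) \<partial>M) \<le> ennreal (K * (2 ^ DIM('a) * exp (- \<rho>)))"
  proof -
    have e: "(\<integral>\<^sup>+\<omega>. ?empty S (X \<omega>) \<partial>M) \<le> ennreal (exp (- \<rho>))" if "S \<in> Pow Basis" for S :: "'a set"
    proof -
      have "(\<integral>\<^sup>+\<omega>. ?empty S (X \<omega>) \<partial>M) = (\<integral>\<^sup>+\<omega>. indicator {\<omega> \<in> space M. points_in (orthant S R R') (X \<omega>) = 0} \<omega> \<partial>M)"
        by (intro nn_integral_cong) (simp add: indicator_def)
      also have "\<dots> = ennreal (M.prob {\<omega> \<in> space M. points_in (orthant S R R') (X \<omega>) = 0})"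
        by (simp add: M.emeasure_eq_measure)
      also have "\<dots> = ennreal (exp (- measure (Lambda f) (orthant S R R' :: ('a \<times> real) set)))"
        using poisson_void[OF PX sets_Lambda sets_orthant fin(3)[OF R(3)]] by simp
      also have "\<dots> \<le> ennreal (exp (- \<rho>))"
        using orth[OF that] by (intro ennreal_leI) simp
      finally show ?thesis .
    qed
    have "(\<integral>\<^sup>+\<omega>. (\<Sum>S\<in>Pow Basis. of_nat K * ?empty S (X \<omega>)) \<partial>M) = (\<Sum>S\<in>Pow Basis. of_nat K * (\<integral>\<^sup>+\<omega>. ?empty S (X \<omega>) \<partial>M))"
      by (subst nn_integral_sum) (auto simp: nn_integral_cmult)
    also have "\<dots> \<le> (\<Sum>S\<in>Pow (Basis :: 'a set). of_nat K * ennreal (exp (- \<rho>)))"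
      by (intro sum_mono mult_left_mono e) auto
    also have "\<dots> = ennreal (K * (2 ^ DIM('a) * exp (- \<rho>)))"
      by (simp add: card_Pow ennreal_mult' ennreal_of_nat_eq_real_of_nat ennreal_power[symmetric] mult_ac)
    finally show ?thesis .
  qed
  also have "(\<integral>\<^sup>+\<omega>. ?sum (X \<omega>) \<partial>M) \<le> (\<integral>\<^sup>+\<omega>. cell_count \<Psi> (Y \<omega>) \<partial>N) + ennreal (K * \<delta>)"
  proof -
    have sumP: "(\<integral>\<^sup>+\<omega>. (\<Sum>i<K. indicator (S i) (W \<omega> \<inter> ?K)) \<partial>Q) =
        (\<Sum>i<K. ennreal (measure Q {\<omega> \<in> space Q. W \<omega> \<inter> ?K \<in> S i}))"
      if "prob_space Q" and W [measurable]: "W \<in> Q \<rightarrow>\<^sub>M configs" for W and Q :: "'q measure"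
    proof -
      interpret Q: prob_space Q by fact
      have "(\<integral>\<^sup>+\<omega>. (\<Sum>i<K. indicator (S i) (W \<omega> \<inter> ?K)) \<partial>Q) = (\<Sum>i<K. \<integral>\<^sup>+\<omega>. indicator (S i) (W \<omega> \<inter> ?K) \<partial>Q)"
        by (rule nn_integral_sum) measurable
      also have "\<dots> = (\<Sum>i<K. \<integral>\<^sup>+\<omega>. indicator {\<omega> \<in> space Q. W \<omega> \<inter> ?K \<in> S i} \<omega> \<partial>Q)"
        by (intro sum.cong refl nn_integral_cong) (simp add: indicator_def)
      finally show ?thesis by (simp add: Q.emeasure_eq_measure)
    qed
    have intD: "intensity DIM('a) (\<lambda>h. \<bar>f h - g h\<bar>)" by (rule intensity_abs_diff[OF intf intg])
    have finK: "emeasure (Lambda h) B < \<infinity>" if "intensity DIM('a) h" "B \<subseteq> ?K" "B \<in> sets borel" for h B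
      by (rule le_less_trans[OF emeasure_mono intensity_fin(1)[OF that(1) m0]]) (use that in auto)
    have "measure M {\<omega> \<in> space M. X \<omega> \<inter> ?K \<in> S i} \<le> measure N {\<omega> \<in> space N. Y \<omega> \<inter> ?K \<in> S i} + \<delta>" for i
    proof -
      have "\<bar>measure M {\<omega> \<in> space M. X \<omega> \<inter> ?K \<in> S i} - measure N {\<omega> \<in> space N. Y \<omega> \<inter> ?K \<in> S i}\<bar>
        \<le> measure (Lambda (\<lambda>h. \<bar>f h - g h\<bar>)) ?K"
      proof (rule poisson_law_diff_le[OF PX PY sets_Lambda sets_Lambda sets_low_power])
        fix B assume "B \<in> sets borel" "B \<subseteq> ?K"
        then show "\<bar>measure (Lambda f) B - measure (Lambda g) B\<bar> \<le> measure (Lambda (\<lambda>h. \<bar>f h - g h\<bar>)) B"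
          using intensityD[OF intf] intensityD[OF intg] by (intro measure_Lambda_diff_le finK intf intg intD) auto
      qed (use intensity_fin(1)[OF intf m0] intensity_fin(1)[OF intg m0] intensity_fin(1)[OF intD m0] in simp_all)
      then show ?thesis using D by linarith
    qed
    then have "(\<integral>\<^sup>+\<omega>. ?sum (X \<omega>) \<partial>M) \<le> (\<Sum>i<K. ennreal (measure N {\<omega> \<in> space N. Y \<omega> \<inter> ?K \<in> S i} + \<delta>))"
      unfolding sumP[OF M.prob_space_axioms X] by (intro sum_mono ennreal_leI)
    also have "\<dots> = (\<integral>\<^sup>+\<omega>. ?sum (Y \<omega>) \<partial>N) + ennreal (K * \<delta>)"
      unfolding sumP[OF N.prob_space_axioms Y] using l0
      by (simp add: sum.distrib ennreal_mult' ennreal_of_nat_eq_real_of_nat)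
    also have "(\<integral>\<^sup>+\<omega>. ?sum (Y \<omega>) \<partial>N) \<le> (\<integral>\<^sup>+\<omega>. cell_count \<Psi> (Y \<omega>) \<partial>N)"
    proof (rule nn_integral_mono)
      fix \<omega>
      \<comment> \<open>Goodness passes from the window to all of \<open>Y \<omega>\<close>, so the
        window count is the true one.\<close>
      have "?sum (Y \<omega>) \<le> (\<Sum>i<K. if of_nat i < cell_count \<Psi> (Y \<omega>) then 1 else 0)"
        using goodK[of "Y \<omega>"] loc[of "Y \<omega>"] by (intro sum_mono) (auto simp: S_def indicator_def)
      then show "?sum (Y \<omega>) \<le> cell_count \<Psi> (Y \<omega>)"
        unfolding sum_less_cell_count by simp
    qed
    finally show ?thesis by (simp add: add_right_mono)
  qed
  finally have "(\<integral>\<^sup>+\<omega>. cell_count \<Psi> (X \<omega>) \<partial>M) \<le> ennreal T + (ennreal (l\<^sup>2 / K) + (ennreal (K * b) +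
      (ennreal (K * (2 ^ DIM('a) * exp (- \<rho>))) + ((\<integral>\<^sup>+\<omega>. cell_count \<Psi> (Y \<omega>) \<partial>N) + ennreal (K * \<delta>)))))"
    by (simp add: add_mono)
  also have "\<dots> = (\<integral>\<^sup>+\<omega>. cell_count \<Psi> (Y \<omega>) \<partial>N) + (ennreal T + (ennreal (l\<^sup>2 / K) + (ennreal (K * b) +
      (ennreal (K * (2 ^ DIM('a) * exp (- \<rho>))) + ennreal (K * \<delta>)))))"
    by (simp only: add_ac)
  also have "ennreal T + (ennreal (l\<^sup>2 / K) + (ennreal (K * b) +
      (ennreal (K * (2 ^ DIM('a) * exp (- \<rho>))) + ennreal (K * \<delta>)))) =
      ennreal (T + l\<^sup>2 / K + K * (b + 2 ^ DIM('a) * exp (- \<rho>) + \<delta>))"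
    using T l0 by (simp add: distrib_left add_ac flip: ennreal_plus)
  finally show ?thesis .
qed

text \<open>Either the box is empty, which \<open>T\<close> covers, or the count is dominated by a
  Poisson variable of finite mean.\<close>

lemma expected_cell_count_finite:
  fixes X :: "'w \<Rightarrow> ('a::euclidean_space \<times> real) set"
  assumes PX: "poisson_process M X (Lambda f)" and intf: "intensity DIM('a) f"
    and \<Psi>: "\<And>C. \<Psi> C \<Longrightarrow> C \<inter> cball 0 c \<noteq> {}" "{(p, Z). \<Psi> (laguerre_cell p Z)} \<in> sets (borel \<Otimes>\<^sub>M configs)"
    and c: "0 \<le> c" and T: "(\<integral>\<^sup>+\<omega>. cell_count \<Psi> (X \<omega>) * indicator {Z. Z \<inter> column_below r s = {}} (X \<omega>) \<partial>M) < \<infinity>"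
  shows "(\<integral>\<^sup>+\<omega>. cell_count \<Psi> (X \<omega>) \<partial>M) < \<infinity>"
proof -
  have X [measurable]: "X \<in> M \<rightarrow>\<^sub>M configs" using PX sets_Lambda by (rule poisson_measurable)
  let ?low = "low_power c ((c + sqrt DIM('a) * r)\<^sup>2 + s) :: ('a \<times> real) set"
  have fin: "emeasure (Lambda f) ?low < \<infinity>" using intensity_fin[OF intf] c by auto
  have "(\<integral>\<^sup>+\<omega>. cell_count \<Psi> (X \<omega>) \<partial>M) \<le>
      (\<integral>\<^sup>+\<omega>. cell_count \<Psi> (X \<omega>) * indicator {Z. Z \<inter> column_below r s = {}} (X \<omega>) + points_in ?low (X \<omega>) \<partial>M)"
    using cell_count_le_points_in[OF \<Psi>(1), where r=r and s=s]
    by (intro nn_integral_mono) (auto simp: indicator_def)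
  also have "\<dots> = (\<integral>\<^sup>+\<omega>. (if locally_finite_config (X \<omega>) then cell_count \<Psi> (X \<omega>) else 0) *
      indicator {0} (points_in (column_below r s) (X \<omega>)) + points_in ?low (X \<omega>) \<partial>M)"
    using poisson_locally_finite[OF PX intf]
        by (intro nn_integral_cong_AE) (auto simp: points_in_eq_0_iff indicator_def)
  also have "\<dots> = (\<integral>\<^sup>+\<omega>. (if locally_finite_config (X \<omega>) then cell_count \<Psi> (X \<omega>) else 0) *
      indicator {0} (points_in (column_below r s) (X \<omega>)) \<partial>M) + (\<integral>\<^sup>+\<omega>. points_in ?low (X \<omega>) \<partial>M)"
  proof -
    note borel_measurable_cell_count[OF \<Psi>(2), measurable]
    show ?thesis by (rule nn_integral_add) measurable
  qed
  also have "(\<integral>\<^sup>+\<omega>. (if locally_finite_config (X \<omega>) then cell_count \<Psi> (X \<omega>) else 0) *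
      indicator {0} (points_in (column_below r s) (X \<omega>)) \<partial>M) =
          (\<integral>\<^sup>+\<omega>. cell_count \<Psi> (X \<omega>) * indicator {Z. Z \<inter> column_below r s = {}} (X \<omega>) \<partial>M)"
    using poisson_locally_finite[OF PX intf]
        by (intro nn_integral_cong_AE) (auto simp: points_in_eq_0_iff indicator_def)
  also have "\<dots> + (\<integral>\<^sup>+\<omega>. points_in ?low (X \<omega>) \<partial>M) < \<infinity>"
    using T fin poisson_mean[OF PX sets_Lambda sets_low_power fin] by simp
  finally show ?thesis .
qed

text \<open>The hypotheses of \<open>expected_cell_count_tail\<close>. One summable \<open>t\<close>
  common to all intensities of the sequence makes the counts uniformly integrable.\<close>

definition tail_bound :: "nat \<Rightarrow> real \<Rightarrow> (nat \<Rightarrow> real) \<Rightarrow> (nat \<Rightarrow> real) \<Rightarrow> (nat \<Rightarrow> real) \<Rightarrow> ('a::euclidean_space \<times> real)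
    measure \<Rightarrow> bool" where
  "tail_bound d c r s t \<Lambda> \<longleftrightarrow>
     filterlim (\<lambda>j. measure \<Lambda> (column_below (r j) (s j))) at_top sequentially \<and>
     (\<forall>j. measure \<Lambda> (low_power c ((c + sqrt d * r (Suc j))\<^sup>2 + s (Suc j))) *
        exp (- measure \<Lambda> (column_below (r j) (s j))) \<le> t j)"

text \<open>A side length of at least 1 may replace the volume, which gives a bound linear in
  \<open>R'\<close>.\<close>

lemma measure_Lambda_orthant_ge:
  assumes int: "intensity DIM('a) f" and R: "R + 1 \<le> R'" "h0 \<le> R'"
  shows "(R' - R) * enn2real (\<integral>\<^sup>+h\<in>{..h0}. ennreal (f h) \<partial>lborel) \<le>
      measure (Lambda f) (orthant S R R' :: ('a::euclidean_space \<times> real) set)"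
proof -
  let ?I = "\<lambda>s. \<integral>\<^sup>+h\<in>{..s}. ennreal (f h) \<partial>lborel"
  have fin: "?I s < \<infinity>" for s by (rule intensity_integral_finite[OF int])
  have "(R' - R) * enn2real (?I h0) \<le> (R' - R) ^ DIM('a) * enn2real (?I h0)"
    using R power_increasing[of 1 "DIM('a)" "R' - R"] DIM_positive[where 'a='a]
    by (intro mult_right_mono) (auto simp: Suc_le_eq)
  also have "\<dots> \<le> (R' - R) ^ DIM('a) * enn2real (?I R')"
    using R fin[of R'] by (intro mult_left_mono enn2real_mono nn_integral_mono) (auto simp: indicator_def)
  also have "\<dots> = measure (Lambda f) (orthant S R R' :: ('a \<times> real) set)"
    using R intensityD(1)[OF int] unfolding measure_def by (simp add: emeasure_Lambda_orthant enn2real_mult)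
  finally show ?thesis .
qed

text \<open>The parameters are fixed in the order \<open>k\<close>, \<open>K\<close>,
  \<open>H\<close>, \<open>R\<close>, \<open>R'\<close>, \<open>m\<close>, \<open>L\<close>, using
  only \<open>g\<close> and the common tails \<open>t\<close>; only then \<open>n\<close> is taken
  large, so one window serves all late members of the sequence. The comparison lemma is one-sided
  and is used in both directions.\<close>

lemma expected_cell_count_tendsto:
  fixes X :: "nat \<Rightarrow> 'w \<Rightarrow> ('a::euclidean_space \<times> real) set" and Y :: "'v \<Rightarrow> ('a \<times> real) set"
  assumes PX: "\<And>n. poisson_process (M n) (X n) (Lambda (f n))" and intf: "\<And>n. intensity DIM('a) (f n)"
    and PY: "poisson_process N Y (Lambda g)" and intg: "intensity DIM('a) g"
    and conv: "\<And>c L. 0 \<le> c \<Longrightarrow> (\<lambda>n. low_power_bound DIM('a) (\<lambda>h. \<bar>f n h - g h\<bar>) c L) \<longlonglongrightarrow> 0"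
    and pos: "0 < (\<integral>\<^sup>+h\<in>{..h0}. ennreal (g h) \<partial>lborel)"
    and \<Psi>: "\<And>C. \<Psi> C \<Longrightarrow> C \<inter> cball 0 c \<noteq> {}" "{(p, Z). \<Psi> (laguerre_cell p Z)} \<in> sets (borel \<Otimes>\<^sub>M configs)"
    and c: "0 \<le> c" and r: "\<And>j. 0 \<le> r j" and t: "summable t"
    and tail: "\<And>n. tail_bound DIM('a) c r s t (Lambda (f n) :: ('a \<times> real) measure)"
      "tail_bound DIM('a) c r s t (Lambda g :: ('a \<times> real) measure)"
  shows "(\<integral>\<^sup>+\<omega>. cell_count \<Psi> (Y \<omega>) \<partial>N) < \<infinity>" (is "?E < _")
    and "(\<lambda>n. \<integral>\<^sup>+\<omega>. cell_count \<Psi> (X n \<omega>) \<partial>M n) \<longlonglongrightarrow> (\<integral>\<^sup>+\<omega>. cell_count \<Psi> (Y \<omega>) \<partial>N)" (is "?En \<longlonglongrightarrow> _")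
proof -
  let ?L0 = "\<lambda>k. (c + sqrt DIM('a) * r k)\<^sup>2 + s k"
  have TX: "(\<integral>\<^sup>+\<omega>. cell_count \<Psi> (X n \<omega>) * indicator {Z. Z \<inter> column_below (r k) (s k) = {}} (X n \<omega>) \<partial>M n) \<le>
      ennreal (\<Sum>j. t (j + k))" for n k
    by (rule expected_cell_count_tail[OF PX intf \<Psi>(1) c r _ t]) (use tail(1)[of n] in \<open>auto simp: tail_bound_def\<close>)
  have TY: "(\<integral>\<^sup>+\<omega>. cell_count \<Psi> (Y \<omega>) * indicator {Z. Z \<inter> column_below (r k) (s k) = {}} (Y \<omega>) \<partial>N) \<le>
      ennreal (\<Sum>j. t (j + k))" for k
    by (rule expected_cell_count_tail[OF PY intg \<Psi>(1) c r _ t]) (use tail(2) in \<open>auto simp: tail_bound_def\<close>)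
  show finE: "?E < \<infinity>"
    by (rule expected_cell_count_finite[OF PY intg \<Psi> c le_less_trans[OF TY[of 0]]]) auto
  have finEn: "?En n < \<infinity>" for n
    by (rule expected_cell_count_finite[OF PX intf \<Psi> c le_less_trans[OF TX[of n 0]]]) auto
  have t0: "0 \<le> t j" for j
    using tail(2) unfolding tail_bound_def by (meson exp_ge_zero measure_nonneg mult_nonneg_nonneg order_trans)
  have close: "\<forall>\<^sub>F n in sequentially. ?En n \<le> ?E + ennreal e \<and> ?E \<le> ?En n + ennreal e" if e: "0 < e" for e
  proof -
    \<comment> \<open>The error has six equal shares: one for the empty box, one for the cap
      \<open>K\<close>, two for the deep points, one for the orthants and one for the total
      variation.\<close>
    define e' where "e' = e / 6"
    have e': "0 < e'" using e by (simp add: e'_def)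
    obtain k where k: "\<bar>\<Sum>j. t (j + k)\<bar> < e'"
      using suminf_exist_split[OF e' t] by (auto simp: real_norm_def)
    define T where "T = (\<Sum>j. t (j + k))"
    have T: "0 \<le> T" "T \<le> e'" using k t0 t unfolding T_def by (auto intro!: suminf_nonneg simp: summable_iff_shift)
    define low where "low = (low_power c (?L0 k) :: ('a \<times> real) set)"
    define l0 where "l0 = measure (Lambda g) low"
    have finlow: "emeasure (Lambda g) low < \<infinity>" unfolding low_def by (rule intensity_fin(1)[OF intg c])
    have l0: "0 \<le> l0" unfolding l0_def by simp
    \<comment> \<open>\<open>l0 + 1\<close> instead of \<open>l0\<close> leaves room for
      \<open>f n\<close>, whose intensities in the window will differ from those of \<open>g\<close>
      by less than 1.\<close>
    obtain K :: nat where K: "(l0 + 1)\<^sup>2 / e' < real K" using reals_Archimedean2 by blast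
    have K0: "0 < K" using K e' l0 by (smt (verit) divide_nonneg_pos of_nat_0_less_iff zero_le_power2)
    have K1: "(l0 + 1)\<^sup>2 / K \<le> e'"
      using K e' K0 by (simp add: field_simps)
    define bad where "bad H = low \<inter> UNIV \<times> {..< -H}" for H
    have bad_sets [measurable]: "bad H \<in> sets borel" for H
      unfolding bad_def low_def by (intro sets.Int sets_low_power borel_open open_Times) auto
    have "(\<lambda>i. measure (Lambda g) (bad (real i))) \<longlonglongrightarrow> measure (Lambda g) (\<Inter>i. bad (real i))"
    proof (rule Lim_measure_decseq)
      show "decseq (\<lambda>i. bad (real i))" by (auto simp: decseq_def bad_def)
      have "emeasure (Lambda g) (bad (real i)) < \<infinity>" for i
        by (rule le_less_trans[OF emeasure_mono finlow]) (auto simp: bad_def low_def)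
      then show "emeasure (Lambda g) (bad (real i)) \<noteq> \<infinity>" for i by (simp add: less_top)
    qed auto
    also have "(\<Inter>i. bad (real i)) = {}"
    proof -
      have False if "x \<in> (\<Inter>i. bad (real i))" for x
      proof -
        obtain i :: nat where "- snd x \<le> real i" using real_arch_simple by blast
        moreover have "x \<in> bad (real i)" using that by blast
        ultimately show False by (auto simp: bad_def)
      qed
      then show ?thesis by blast
    qed
    finally have "(\<lambda>i. measure (Lambda g) (bad (real i))) \<longlonglongrightarrow> 0" by simp
    then have "\<forall>\<^sub>F i in sequentially. measure (Lambda g) (bad (real i)) < e' / K"
      using e' K0 by (intro order_tendstoD) auto
    then obtain i where i: "measure (Lambda g) (bad (real i)) < e' / K"
      by (auto simp: eventually_sequentially)
    define H where "H = real i"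
    define R where "R = max 0 (c + sqrt (?L0 k + H) + 1)"
    define a where "a = enn2real (\<integral>\<^sup>+h\<in>{..h0}. ennreal (g h) \<partial>lborel)"
    have a: "0 < a"
      using pos intensity_integral_finite[OF intg, of h0] unfolding a_def
      by (simp add: enn2real_positive_iff)
    \<comment> \<open>Chosen so that \<open>K * (2 ^ DIM('a) * exp (- (\<rho> - 1)))\<close> equals
      \<open>e'\<close>; the subtracted 1 is the possible loss when \<open>g\<close> is replaced by
      \<open>f n\<close>.\<close>
    define \<rho> where "\<rho> = ln (K * 2 ^ DIM('a) / e') + 1"
    define R' where "R' = max (max (R + 1) h0) (R + \<bar>\<rho>\<bar> / a)"
    have R': "R \<le> R'" "1 \<le> R' - R" "h0 \<le> R'" "\<bar>\<rho>\<bar> / a \<le> R' - R" unfolding R'_def by auto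
    have orth: "\<rho> \<le> measure (Lambda g) (orthant S R R' :: ('a \<times> real) set)" for S
    proof -
      have "\<rho> \<le> (R' - R) * a" using R'(4) a by (simp add: field_simps)
      also have "\<dots> \<le> measure (Lambda g) (orthant S R R' :: ('a \<times> real) set)"
        unfolding a_def using R'(2,3) by (intro measure_Lambda_orthant_ge[OF intg]) auto
      finally show ?thesis .
    qed
    have \<rho>: "K * (2 ^ DIM('a) * exp (- (\<rho> - 1))) = e'"
      using K0 e' by (simp add: \<rho>_def exp_minus)
    define m where "m = max c ((real DIM('a) * R'\<^sup>2 + R' + H) / 2)"
    define L where "L = Max {(m + sqrt DIM('a) * r k)\<^sup>2 + s k, (sqrt DIM('a) * R')\<^sup>2 +
        R', (sqrt DIM('a) * r k)\<^sup>2 + s k}"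
    have m: "(real DIM('a) * R'\<^sup>2 + R' + H) / 2 \<le> m" "c \<le> m" "0 \<le> m" using c by (auto simp: m_def)
    have L: "(m + sqrt DIM('a) * r k)\<^sup>2 + s k \<le> L" "(sqrt DIM('a) * R')\<^sup>2 + R' \<le> L" "(sqrt DIM('a) * r k)\<^sup>2 + s k \<le> L"
      unfolding L_def by auto
    define \<delta> where "\<delta> n = measure (Lambda (\<lambda>h. \<bar>f n h - g h\<bar>)) (low_power m L :: ('a \<times> real) set)" for n
    have intD: "intensity DIM('a) (\<lambda>h. \<bar>f n h - g h\<bar>)" for n by (rule intensity_abs_diff[OF intf intg])
    have \<delta>0: "0 \<le> \<delta> n" for n unfolding \<delta>_def by simp
    have "(\<lambda>n. ennreal (\<delta> n)) \<longlonglongrightarrow> 0"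
    proof (rule tendsto_sandwich[OF _ _ tendsto_const conv[OF m(3), of L]])
      have "ennreal (\<delta> n) = emeasure (Lambda (\<lambda>h. \<bar>f n h - g h\<bar>)) (low_power m L :: ('a \<times> real) set)" for n
        unfolding \<delta>_def using intensity_fin(1)[OF intD m(3)]
            by (intro emeasure_eq_ennreal_measure[symmetric]) (simp add: less_top)
      then show "\<forall>\<^sub>F n in sequentially. ennreal (\<delta> n) \<le> low_power_bound DIM('a) (\<lambda>h. \<bar>f n h - g h\<bar>) m L"
        using intensityD[OF intD] m(3) by (simp add: emeasure_Lambda_low_power_le)
    qed simp
    then have "\<delta> \<longlonglongrightarrow> 0"
      by (subst (asm) ennreal_0[symmetric], subst (asm) tendsto_ennreal_iff) (auto simp: \<delta>0)
    then have "\<forall>\<^sub>F n in sequentially. \<delta> n < min 1 (e' / K)"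
      using e' K0 by (intro order_tendstoD) auto
    then show ?thesis
    proof (rule eventually_mono, intro conjI)
      fix n assume \<delta>: "\<delta> n < min 1 (e' / K)"
      have finK: "emeasure (Lambda h) B < \<infinity>" if "intensity DIM('a) h" "B \<subseteq> low_power m L" "B \<in> sets borel" for h
          and B :: "('a \<times> real) set"
        by (rule le_less_trans[OF emeasure_mono intensity_fin(1)[OF that(1) m(3)]]) (use that in auto)
      have diff: "\<bar>measure (Lambda (f n)) B - measure (Lambda g) B\<bar> \<le> \<delta> n"
        if B: "B \<subseteq> low_power m L" "B \<in> sets borel" for B :: "('a \<times> real) set"
      proof -
        have "\<bar>measure (Lambda (f n)) B - measure (Lambda g) B\<bar> \<le> measure (Lambda (\<lambda>h. \<bar>f n h - g h\<bar>)) B"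
          using intensityD[OF intf] intensityD[OF intg] B by (intro measure_Lambda_diff_le finK intf intg intD) auto
        also have "\<dots> \<le> \<delta> n"
          unfolding \<delta>_def using finK[OF intD subset_refl, of n] B
              by (intro measure_mono_fmeasurable) (auto simp: fmeasurable_def)
        finally show ?thesis .
      qed
      have lowK: "low \<subseteq> low_power m L"
        unfolding low_def
      proof (rule low_power_mono[OF m(2)])
        have "(c + sqrt DIM('a) * r k)\<^sup>2 \<le> (m + sqrt DIM('a) * r k)\<^sup>2"
          using m(2) c r by (intro power_mono) auto
        then show "?L0 k \<le> L" using L(1) by linarith
      qed
      have orthK: "orthant S R R' \<subseteq> (low_power m L :: ('a \<times> real) set)" for S
        by (rule orthant_subset_low_power) (use m(3) L(2) R_def in auto)
      have b: "measure (Lambda (f n)) low \<le> l0 + 1" "measure (Lambda g) low \<le> l0 + 1"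
        "measure (Lambda (f n)) (bad H) \<le> 2 * (e' / K)" "measure (Lambda g) (bad H) \<le> 2 * (e' / K)"
        "\<rho> - 1 \<le> measure (Lambda (f n)) (orthant S R R' :: ('a \<times> real) set)" 
        "\<rho> - 1 \<le> measure (Lambda g) (orthant S R R' :: ('a \<times> real) set)" for S
      proof -
        have "low \<in> sets borel" "bad H \<subseteq> low_power m L"
          using lowK by (auto simp: low_def bad_def)
        then show "measure (Lambda (f n)) low \<le> l0 + 1" "measure (Lambda g) low \<le> l0 + 1"
          "measure (Lambda (f n)) (bad H) \<le> 2 * (e' / K)" "measure (Lambda g) (bad H) \<le> 2 * (e' / K)"
          "\<rho> - 1 \<le> measure (Lambda (f n)) (orthant S R R' :: ('a \<times> real) set)"
          "\<rho> - 1 \<le> measure (Lambda g) (orthant S R R' :: ('a \<times> real) set)"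
          using diff[OF lowK] diff[of "bad H"] diff[OF orthK[of S]] \<delta> i orth[of S]
          unfolding l0_def H_def by (auto simp: abs_le_iff)
      qed
      have "T + (l0 + 1)\<^sup>2 / K + K * (2 * (e' / K) + 2 ^ DIM('a) * exp (- (\<rho> - 1)) + e' / K) \<le>
          e' + e' + (2 * e' + e' + e')"
        using T(2) K1 \<rho> K0 by (intro add_mono) (auto simp: distrib_left)
      also have "\<dots> = e" by (simp add: e'_def)
      finally have err: "T + (l0 + 1)\<^sup>2 / K + K * (2 * (e' / K) + 2 ^ DIM('a) * exp (- (\<rho> - 1)) + e' / K) \<le> e" .
      have R1: "c + sqrt ((c + sqrt DIM('a) * r k)\<^sup>2 + s k + H) + 1 \<le> R" "0 \<le> R"
        unfolding R_def by auto
      have "?En n \<le> ?E + ennreal (T + (l0 + 1)\<^sup>2 / K + K * (2 * (e' / K) + 2 ^ DIM('a) * exp (- (\<rho> - 1)) + e' / K))"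
        by (rule expected_cell_count_compare[OF PX intf PY intg \<Psi> c T(1) TX[of n k, folded T_def] R1 R'(1)
            m(1,2) r L K0])
          (use b \<delta> in \<open>auto simp: low_def bad_def \<delta>_def\<close>)
      also have "\<dots> \<le> ?E + ennreal e"
        by (intro add_left_mono ennreal_leI err)
      finally show "?En n \<le> ?E + ennreal e" .
      have "?E \<le> ?En n + ennreal (T + (l0 + 1)\<^sup>2 / K + K * (2 * (e' / K) + 2 ^ DIM('a) * exp (- (\<rho> - 1)) + e' / K))"
        by (rule expected_cell_count_compare[OF PY intg PX intf \<Psi> c T(1) TY[of k, folded T_def] R1 R'(1) m(1,2)
            r L K0])
          (use b \<delta> in \<open>auto simp: low_def bad_def \<delta>_def abs_minus_commute\<close>)
      also have "\<dots> \<le> ?En n + ennreal e"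
        by (intro add_left_mono ennreal_leI err)
      finally show "?E \<le> ?En n + ennreal e" .
    qed
  qed
  define x where "x = enn2real ?E"
  define xn where "xn n = enn2real (?En n)" for n
  have x: "?E = ennreal x" "0 \<le> x" and xn: "?En n = ennreal (xn n)" "0 \<le> xn n" for n
    using finE finEn[of n] by (auto simp: x_def xn_def less_top)
  have "xn \<longlonglongrightarrow> x"
  proof (rule LIMSEQ_I)
    fix e :: real assume "0 < e"
    then have "\<forall>\<^sub>F n in sequentially. ?En n \<le> ?E + ennreal (e / 2) \<and> ?E \<le> ?En n + ennreal (e / 2)"
      by (intro close) simp
    then have "\<forall>\<^sub>F n in sequentially. norm (xn n - x) < e"
    proof (rule eventually_mono)
      fix n assume "?En n \<le> ?E + ennreal (e / 2) \<and> ?E \<le> ?En n + ennreal (e / 2)"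
      then have "xn n \<le> x + e / 2" "x \<le> xn n + e / 2"
        unfolding x xn using x(2) xn(2)[of n] \<open>0 < e\<close> by (simp_all flip: ennreal_plus)
      then show "norm (xn n - x) < e" using \<open>0 < e\<close> by (simp add: real_norm_def abs_less_iff)
    qed
    then show "\<exists>no. \<forall>n\<ge>no. norm (xn n - x) < e" by (simp add: eventually_sequentially)
  qed
  then show "?En \<longlonglongrightarrow> ?E"
    unfolding x xn by (rule tendsto_ennrealI)
qed

section \<open>Measurability of random compact sets\<close>

text \<open>Turns a non-strict distance condition into countably many hits of open sets, the events
  that \<open>measurable_ncompactI\<close> has at its disposal.\<close>

lemma infdist_le_iff_ball:
  fixes S :: "'a::metric_space set"
  assumes "S \<noteq> {}"
  shows "infdist a S \<le> e \<longleftrightarrow> (\<forall>n. S \<inter> ball a (e + 1 / real (Suc n)) \<noteq> {})"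
proof
  assume le: "infdist a S \<le> e"
  show "\<forall>n. S \<inter> ball a (e + 1 / real (Suc n)) \<noteq> {}"
  proof
    fix n
    have "infdist a S < e + 1 / real (Suc n)" using le by (rule le_less_trans) simp
    then have "(INF x\<in>S. dist a x) < e + 1 / real (Suc n)" using assms by (simp add: infdist_notempty)
    then obtain x where "x \<in> S" "dist a x < e + 1 / real (Suc n)"
      using assms by (subst (asm) cINF_less_iff) (auto intro!: bdd_belowI[where m=0])
    then show "S \<inter> ball a (e + 1 / real (Suc n)) \<noteq> {}" by auto
  qed
next
  assume *: "\<forall>n. S \<inter> ball a (e + 1 / real (Suc n)) \<noteq> {}"
  show "infdist a S \<le> e"
  proof (rule LIMSEQ_le_const)
    show "(\<lambda>n. e + 1 / real (Suc n)) \<longlonglongrightarrow> e"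
      using tendsto_add[OF tendsto_const LIMSEQ_Suc[OF lim_1_over_n], of e] by simp
    have "infdist a S \<le> e + 1 / real (Suc n)" for n
    proof -
      have "S \<inter> ball a (e + 1 / real (Suc n)) \<noteq> {}" using * by blast
      then obtain x where "x \<in> S" "dist a x < e + 1 / real (Suc n)" by auto
      then show ?thesis using infdist_le2[of x S a] by auto
    qed
    then show "\<exists>N. \<forall>n\<ge>N. infdist a S \<le> e + 1 / real (Suc n)" by blast
  qed
qed

text \<open>Compactness gives a finite cover by \<open>e\<close>-balls with centres in
  \<open>D\<close>; the centres whose balls meet \<open>L\<close> form the approximating set. With a
  countable \<open>D\<close> this makes the hyperspace separable.\<close>

lemma ncompact_finite_dense:
  fixes L :: "'a::metric_space ncompact"
  assumes D: "\<And>X. open X \<Longrightarrow> X \<noteq> {} \<Longrightarrow> \<exists>d\<in>D. d \<in> X" and e: "0 < e"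
  shows "\<exists>F. finite F \<and> F \<noteq> {} \<and> F \<subseteq> D \<and> dist (Abs_ncompact F) L \<le> e"
proof -
  have L: "compact (Rep_ncompact L)" "Rep_ncompact L \<noteq> {}"
    by (rule Rep_ncompact_compact, rule Rep_ncompact_nonempty)
  have "\<exists>d\<in>D. x \<in> ball d e" for x
    using D[of "ball x e"] e by (auto simp: dist_commute)
  then have "Rep_ncompact L \<subseteq> (\<Union>d\<in>D. ball d e)" by blast
  then obtain F0 where F0: "F0 \<subseteq> D" "finite F0" "Rep_ncompact L \<subseteq> (\<Union>d\<in>F0. ball d e)"
    using compactE_image[OF L(1), of D "\<lambda>d. ball d e"] by (metis open_ball)
  define F where "F = {d \<in> F0. ball d e \<inter> Rep_ncompact L \<noteq> {}}"
  have cover: "\<exists>d\<in>F. dist d x < e" if "x \<in> Rep_ncompact L" for x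
  proof -
    obtain d where "d \<in> F0" "x \<in> ball d e" using F0(3) \<open>x \<in> Rep_ncompact L\<close> by blast
    then show ?thesis using \<open>x \<in> Rep_ncompact L\<close> by (intro bexI[of _ d]) (auto simp: F_def)
  qed
  have F: "finite F" "F \<noteq> {}" "F \<subseteq> D"
  proof -
    show "finite F" "F \<subseteq> D" using F0 by (auto simp: F_def)
    obtain x where "x \<in> Rep_ncompact L" using L(2) by blast
    then show "F \<noteq> {}" using cover by blast
  qed
  have RF: "Rep_ncompact (Abs_ncompact F) = F"
    using F by (intro Abs_ncompact_inverse) (auto intro: finite_imp_compact)
  have "dist (Abs_ncompact F) L \<le> e"
    unfolding dist_ncompact_le_iff RF
  proof (intro conjI ballI)
    fix a assume "a \<in> F"
    then obtain x where "x \<in> Rep_ncompact L" "dist a x < e" by (auto simp: F_def)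
    then show "infdist a (Rep_ncompact L) \<le> e" using infdist_le2[of x "Rep_ncompact L" a e] by simp
  next
    fix b assume "b \<in> Rep_ncompact L"
    then obtain d where "d \<in> F" "dist d b < e" using cover by blast
    then show "infdist b F \<le> e" using infdist_le2[of d F b e] by (simp add: dist_commute)
  qed
  with F show ?thesis by blast
qed

text \<open>An open set of compact sets is a countable union of closed balls around finite subsets
  of a countable dense set. To be in such a ball means to hit small balls about finitely many points
  and to miss one open set.\<close>

lemma measurable_ncompactI:
  fixes f :: "'w \<Rightarrow> 'a::{metric_space, second_countable_topology} ncompact"
  assumes hit: "\<And>U. open U \<Longrightarrow> {x \<in> space M. Rep_ncompact (f x) \<inter> U \<noteq> {}} \<in> sets M"
  shows "f \<in> borel_measurable M"
proof (rule borel_measurableI)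
  obtain D :: "'a set" where D: "countable D" "\<And>X. open X \<Longrightarrow> X \<noteq> {} \<Longrightarrow> \<exists>d\<in>D. d \<in> X"
    using countable_dense_setE by blast
  define \<F> where "\<F> = {F. finite F \<and> F \<noteq> {} \<and> F \<subseteq> D}"
  have cF: "countable \<F>"
    using countable_Collect_finite_subset[OF D(1)] by (rule countable_subset[rotated]) (auto simp: \<F>_def)
  have RF: "Rep_ncompact (Abs_ncompact F) = F" if "F \<in> \<F>" for F
    using that by (intro Abs_ncompact_inverse) (auto simp: \<F>_def intro: finite_imp_compact)
  have ball: "{x \<in> space M. dist (Abs_ncompact F) (f x) \<le> e} \<in> sets M" if F: "F \<in> \<F>" for F and e :: real
  proof -
    have eq: "{x \<in> space M. dist (Abs_ncompact F) (f x) \<le> e} =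
        (\<Inter>a\<in>F. \<Inter>n. {x \<in> space M. Rep_ncompact (f x) \<inter> ball a (e + 1 / real (Suc n)) \<noteq> {}}) \<inter>
        (space M - {x \<in> space M. Rep_ncompact (f x) \<inter> {b. e < infdist b F} \<noteq> {}})" (is "?L = ?R")
    proof (intro set_eqI)
      fix x
      have "F \<noteq> {}" using F by (simp add: \<F>_def)
      then show "x \<in> ?L \<longleftrightarrow> x \<in> ?R"
        unfolding dist_ncompact_le_iff RF[OF F] infdist_le_iff_ball[OF Rep_ncompact_nonempty]
        by (auto simp: not_less[symmetric])
    qed
    have "open {b. e < infdist b F}" by (intro open_Collect_less continuous_intros)
    then show ?thesis
      unfolding eq using F
      by (intro sets.Int sets.Diff sets.finite_INT sets.countable_INT' hit sets.top) (auto simp: \<F>_def hit)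
  qed
  fix W :: "'a ncompact set" assume W: "open W"
  have "f -` W \<inter> space M = (\<Union>F\<in>\<F>. \<Union>q\<in>{q\<in>\<rat>. cball (Abs_ncompact F) q \<subseteq>
      W}. {x \<in> space M. dist (Abs_ncompact F) (f x) \<le> q})"
  proof (intro equalityI subsetI)
    fix x assume x: "x \<in> f -` W \<inter> space M"
    then obtain e where e: "0 < e" "ball (f x) e \<subseteq> W"
      using W by (auto simp: open_contains_ball)
    obtain q where q: "q \<in> \<rat>" "0 < q" "q < e / 2" using Rats_dense_in_real[of 0 "e / 2"] e by auto
    obtain F where F: "finite F" "F \<noteq> {}" "F \<subseteq> D" "dist (Abs_ncompact F) (f x) \<le> q"
      using ncompact_finite_dense[OF D(2) q(2)] by blast
    have "cball (Abs_ncompact F) q \<subseteq> ball (f x) e"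
    proof
      fix y assume "y \<in> cball (Abs_ncompact F) q"
      then have "dist (f x) y \<le> q + q"
        using dist_triangle3[of "f x" y "Abs_ncompact F"] F(4) by simp
      then show "y \<in> ball (f x) e" using q by simp
    qed
    then have "cball (Abs_ncompact F) q \<subseteq> W" using e(2) by (rule order_trans)
    with q F x show "x \<in> (\<Union>F\<in>\<F>. \<Union>q\<in>{q\<in>\<rat>. cball (Abs_ncompact F) q \<subseteq>
        W}. {x \<in> space M. dist (Abs_ncompact F) (f x) \<le> q})"
      by (intro UN_I[of F] UN_I[of q]) (simp_all add: \<F>_def)
  next
    fix x assume "x \<in> (\<Union>F\<in>\<F>. \<Union>q\<in>{q\<in>\<rat>. cball (Abs_ncompact F) q \<subseteq> W}. {x \<in> space M. dist (Abs_ncompact F) (f x) \<le> q})"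
    then obtain F q where "cball (Abs_ncompact F) q \<subseteq> W" "x \<in> space M" "dist (Abs_ncompact F) (f x) \<le> q"
      by (elim UN_E CollectE conjE) blast
    then show "x \<in> f -` W \<inter> space M" by (simp add: subset_iff)
  qed
  also have "\<dots> \<in> sets M"
    using cF countable_rat by (intro sets.countable_UN'' ball) (auto intro: countable_subset[OF _ countable_rat])
  finally show "f -` W \<inter> space M \<in> sets M" .
qed

text \<open>A closed convex set with interior points is the closure of its interior, so an open set
  that meets it meets its interior too. For countable \<open>D\<close>, hitting events thus reduce
  to countably many events that a fixed point lies in the set.\<close>

lemma convex_meets_open_iff:
  fixes C :: "'a::euclidean_space set"
  assumes D: "\<And>X. open X \<Longrightarrow> X \<noteq> {} \<Longrightarrow> \<exists>d\<in>D. d \<in> X" and C: "convex C" "closed C" "interior C \<noteq> {}" and V: "open V"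
  shows "C \<inter> V \<noteq> {} \<longleftrightarrow> (\<exists>w\<in>D. w \<in> C \<and> w \<in> V)"
proof
  assume "C \<inter> V \<noteq> {}"
  then have "closure (interior C) \<inter> V \<noteq> {}"
    using convex_closure_interior[OF C(1,3)] C(2) by simp
  then have "interior C \<inter> V \<noteq> {}"
    using V open_Int_closure_eq_empty[of V "interior C"] by (auto simp: Int_commute)
  then show "\<exists>w\<in>D. w \<in> C \<and> w \<in> V"
    using D[of "interior C \<inter> V"] V interior_subset by blast
qed blast

section \<open>The lexicographically smallest vertex\<close>

definition lex_le :: "real ^ 'd::{finite,linorder} \<Rightarrow> real ^ 'd::{finite,linorder} \<Rightarrow> bool" where
  "lex_le x y \<longleftrightarrow> x = y \<or> less_fun (($) x) (($) y)"

lemma less_fun_total: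
  fixes x y :: "real ^ 'd::{finite,linorder}"
  assumes "x \<noteq> y"
  shows "\<exists>k. x $ k \<noteq> y $ k \<and> (\<forall>j<k. x $ j = y $ j)"
proof -
  let ?I = "{k. x $ k \<noteq> y $ k}"
  have "?I \<noteq> {}" using assms by (auto simp: vec_eq_iff)
  then have "Min ?I \<in> ?I" by (intro Min_in) auto
  moreover have "x $ j = y $ j" if "j < Min ?I" for j
    using that by (metis (mono_tags, lifting) Min_le finite leD mem_Collect_eq)
  ultimately show ?thesis by blast
qed

text \<open>The coordinates are minimised in increasing order, each over the compact face
  \<open>T\<close> left by the previous ones.\<close>

lemma lex_minimum_exists:
  fixes S :: "(real ^ 'd::{finite,linorder}) set"
  assumes "compact S" "S \<noteq> {}"
  shows "\<exists>z\<in>S. \<forall>y\<in>S. lex_le z y"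
proof -
  \<comment> \<open>Either \<open>z\<close> precedes \<open>y\<close> strictly on the coordinates in
    \<open>A\<close>, or the two agree there and \<open>y\<close> belongs to the current face
    \<open>T\<close> as well.\<close>
  define G where "G A T z y \<longleftrightarrow> (\<exists>k\<in>A. z $ k < y $ k \<and> (\<forall>j\<in>A. j < k \<longrightarrow> z $ j = y $ j)) \<or> y \<in> T \<and> (\<forall>j\<in>A. z $ j = y $ j)"
    for A :: "'d set" and T and z y :: "real ^ 'd::{finite,linorder}"
  have "\<exists>T\<subseteq>S. compact T \<and> T \<noteq> {} \<and> (\<forall>z\<in>T. \<forall>y\<in>S. G A T z y)" if "finite A" for A :: "'d set"
    using that
  proof (induction rule: finite_linorder_max_induct)
    case empty
    then show ?case using assms by (intro exI[of _ S]) (auto simp: G_def)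
  next
    case (insert b A)
    then obtain T where T: "T \<subseteq> S" "compact T" "T \<noteq> {}" "\<And>z y. z \<in> T \<Longrightarrow> y \<in> S \<Longrightarrow> G A T z y"
      by blast
    have "continuous_on T (\<lambda>x. x $ b)" by (intro continuous_intros)
    then obtain m where m: "m \<in> T" "\<And>y. y \<in> T \<Longrightarrow> m $ b \<le> y $ b"
      using continuous_attains_inf[OF T(2,3)] by blast
    define T' where "T' = T \<inter> {x. x $ b \<le> m $ b}"
    have "compact T'"
      unfolding T'_def using T(2) by (intro compact_Int_closed closed_Collect_le continuous_intros)
    moreover have "G (insert b A) T' z y" if z: "z \<in> T'" and y: "y \<in> S" for z y
    proof -
      have zT: "z \<in> T" and zb: "z $ b = m $ b" using m(2)[of z] z by (auto simp: T'_def)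
      from T(4)[OF zT y] consider (1) k where "k \<in> A" "z $ k < y $ k" "\<forall>j\<in>A. j < k \<longrightarrow> z $ j = y $ j"
        | (2) "y \<in> T" "\<forall>j\<in>A. z $ j = y $ j" unfolding G_def by blast
      then show ?thesis
      proof cases
        case 1
        have "\<forall>j\<in>insert b A. j < k \<longrightarrow> z $ j = y $ j"
          using 1 insert.hyps(2) by (metis insert_iff less_asym)
        with 1 show ?thesis unfolding G_def by blast
      next
        case 2
        show ?thesis
        proof (cases "z $ b < y $ b")
          case True
          then have "\<exists>k\<in>insert b A. z $ k < y $ k \<and> (\<forall>j\<in>insert b A. j < k \<longrightarrow> z $ j = y $ j)"
            using 2 by (intro bexI[of _ b]) auto
          then show ?thesis unfolding G_def by blast
        next
          case False
          then have "z $ b = y $ b" using m(2)[OF 2(1)] zb by simp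
          then show ?thesis using 2 zb unfolding G_def T'_def by simp
        qed
      qed
    qed
    moreover have "m \<in> T'" "T' \<subseteq> S" using m T(1) by (auto simp: T'_def)
    ultimately show ?case by (intro exI[of _ T']) blast
  qed
  from this[of UNIV, OF finite] obtain T where T: "T \<subseteq> S" "T \<noteq> {}"
    "\<And>z y. z \<in> T \<Longrightarrow> y \<in> S \<Longrightarrow> G UNIV T z y"
    by blast
  then obtain z where z: "z \<in> T" by blast
  have "lex_le z y" if "y \<in> S" for y
    using T(3)[OF z that] unfolding lex_le_def less_fun_def G_def by (auto simp: vec_eq_iff)
  then show ?thesis using z T(1) by blast
qed

text \<open>If \<open>z\<close> lay inside a segment, then at the first coordinate where the ends
  differ one end would be smaller than \<open>z\<close>, all earlier coordinates being
  equal.\<close>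

lemma lex_minimum_extreme_point:
  fixes S :: "(real ^ 'd::{finite,linorder}) set"
  assumes z: "z \<in> S" "\<And>y. y \<in> S \<Longrightarrow> lex_le z y"
  shows "z extreme_point_of S"
  unfolding extreme_point_of_def
proof (intro conjI ballI notI)
  fix a b assume ab: "a \<in> S" "b \<in> S" "z \<in> open_segment a b"
  then obtain u where u: "0 < u" "u < 1" "z = (1 - u) *\<^sub>R a + u *\<^sub>R b" and "a \<noteq> b"
    by (auto simp: in_segment)
  obtain k where k: "a $ k \<noteq> b $ k" "\<And>j. j < k \<Longrightarrow> a $ j = b $ j"
    using less_fun_total[OF \<open>a \<noteq> b\<close>] by blast
  have zk: "z $ i = (1 - u) * a $ i + u * b $ i" for i using u by simp
  have zj: "z $ j = a $ j" if "j < k" for j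
    using k(2)[OF that] by (simp add: zk algebra_simps)
  have no: "\<not> lex_le z y" if "\<And>j. j < k \<Longrightarrow> y $ j = z $ j" "y $ k < z $ k" for y
    using that unfolding lex_le_def less_fun_def by (metis less_asym less_irrefl linorder_neqE)
  show False
  proof (cases "a $ k < b $ k")
    case True
    then have "u * a $ k < u * b $ k" using u by simp
    then have "a $ k < z $ k" by (simp add: zk algebra_simps)
    then show False using no[of a] zj z(2)[OF ab(1)] by auto
  next
    case False
    then have "b $ k < a $ k" using k by simp
    then have "(1 - u) * b $ k < (1 - u) * a $ k" using u by simp
    then have "b $ k < z $ k" by (simp add: zk algebra_simps)
    then show False using no[of b] zj k(2) z(2)[OF ab(2)] by auto
  qed
qed (fact z(1))

text \<open>The definition compares extreme points only; the lexicographic minimum of the whole set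
  is one of them, so it is the point described.\<close>

lemma lex_min_vertex_props:
  fixes S :: "(real ^ 'd::{finite,linorder}) set"
  assumes "compact S" "S \<noteq> {}"
  shows "lex_min_vertex S T \<in> S" "\<And>y. y \<in> S \<Longrightarrow> lex_le (lex_min_vertex S T) y"
proof -
  obtain z where z: "z \<in> S" "\<And>y. y \<in> S \<Longrightarrow> lex_le z y"
    using lex_minimum_exists[OF assms] by blast
  have "lex_min_vertex S T = z"
    unfolding lex_min_vertex_def
  proof (rule the_equality)
    show "z extreme_point_of S \<and> (\<forall>y. y extreme_point_of S \<and> y \<noteq> z \<longrightarrow> less_fun (($) z) (($) y))"
      using lex_minimum_extreme_point[OF z] z(2) by (auto simp: lex_le_def extreme_point_of_def)
    fix x assume x: "x extreme_point_of S \<and> (\<forall>y. y extreme_point_of S \<and> y \<noteq> x \<longrightarrow> less_fun (($) x) (($) y))"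
    show "x = z"
    proof (rule ccontr)
      assume "x \<noteq> z"
      then have "less_fun (($) x) (($) z)" using x lex_minimum_extreme_point[OF z] by auto
      moreover have "less_fun (($) z) (($) x)"
        using z(2)[of x] x \<open>x \<noteq> z\<close> by (auto simp: lex_le_def extreme_point_of_def)
      ultimately show False using less_fun_asym by blast
    qed
  qed
  with z show "lex_min_vertex S T \<in> S" "\<And>y. y \<in> S \<Longrightarrow> lex_le (lex_min_vertex S T) y" by auto
qed

lemma lex_min_vertex_irrelevant: "lex_min_vertex c T = lex_min_vertex c T'"
  unfolding lex_min_vertex_def ..

lemma lex_min_vertex_translate:
  fixes S :: "(real ^ 'd::{finite,linorder}) set"
  assumes "compact S" "S \<noteq> {}"
  shows "lex_min_vertex ((+) a ` S) T = a + lex_min_vertex S T"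
proof -
  have S': "compact ((+) a ` S)" "(+) a ` S \<noteq> {}"
    using assms by (auto intro: compact_translation)
  let ?z = "lex_min_vertex S T" and ?z' = "lex_min_vertex ((+) a ` S) T"
  have 1: "lex_le ?z' (a + ?z)"
    using lex_min_vertex_props(2)[OF S'] lex_min_vertex_props(1)[OF assms] by blast
  obtain y where y: "?z' = a + y" "y \<in> S"
    using lex_min_vertex_props(1)[OF S'] by blast
  have 2: "lex_le ?z y" using lex_min_vertex_props(2)[OF assms y(2)] .
  have "lex_le y ?z" using 1 unfolding y(1) by (auto simp: lex_le_def less_fun_def)
  then have "y = ?z" using 2 less_fun_asym by (auto simp: lex_le_def)
  then show ?thesis using y by simp
qed

text \<open>\<^const>\<open>lex_min_vertex\<close> ignores its second argument, so the empty set serves as a dummy.\<close>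

definition centred_cell_in :: "(real ^ 'd::{finite,linorder}) ncompact set \<Rightarrow> (real ^ 'd::{finite,linorder}) set
    \<Rightarrow> bool" where
  "centred_cell_in A c \<longleftrightarrow> compact c \<and> interior c \<noteq> {} \<and> lex_min_vertex c {} \<in> cbox 0 One \<and>
     (\<lambda>x. x - lex_min_vertex c {}) ` c \<in> Rep_ncompact ` A"

section \<open>Measurability for a random closed convex set\<close>

context
  fixes M :: "'w measure" and C :: "'w \<Rightarrow> (real ^ 'd::{finite,linorder}) set"
      and D :: "(real ^ 'd::{finite,linorder}) set"
  assumes D: "countable D" "\<And>X. open X \<Longrightarrow> X \<noteq> {} \<Longrightarrow> \<exists>d\<in>D. d \<in> X"
    and mem: "\<And>w. {x \<in> space M. w \<in> C x} \<in> sets M"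
    and clo: "\<And>x. closed (C x)" and conv: "\<And>x. convex (C x)"
begin

lemma pred_mem [measurable]: "Measurable.pred M (\<lambda>x. w \<in> C x)"
  using mem[of w] by (simp add: pred_def)

text \<open>As \<open>C x\<close> is closed, a ball lies in it as soon as the points of
  \<open>D\<close> in that ball do.\<close>

lemma pred_interior: "Measurable.pred M (\<lambda>x. interior (C x) \<noteq> {})"
proof -
  have "interior (C x) \<noteq> {} \<longleftrightarrow> (\<exists>d\<in>D. \<exists>n::nat. \<forall>w\<in>D. dist d w < 1 / real (Suc n) \<longrightarrow> w \<in> C x)" for x
  proof
    assume "interior (C x) \<noteq> {}"
    then obtain d where d: "d \<in> D" "d \<in> interior (C x)" using D(2)[of "interior (C x)"] by blast
    then obtain e where e: "0 < e" "ball d e \<subseteq> C x" by (auto simp: mem_interior)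
    then obtain n where "1 / real (Suc n) < e" using nat_approx_posE by blast
    then have "\<forall>w\<in>D. dist d w < 1 / real (Suc n) \<longrightarrow> w \<in> C x" using e by (auto simp: subset_iff)
    then show "\<exists>d\<in>D. \<exists>n::nat. \<forall>w\<in>D. dist d w < 1 / real (Suc n) \<longrightarrow> w \<in> C x" using d by blast
  next
    assume "\<exists>d\<in>D. \<exists>n::nat. \<forall>w\<in>D. dist d w < 1 / real (Suc n) \<longrightarrow> w \<in> C x"
    then obtain d n where dn: "\<And>w. w \<in> D \<Longrightarrow> dist d w < 1 / real (Suc n) \<Longrightarrow> w \<in> C x" by blast
    have "ball d (1 / real (Suc n)) \<subseteq> C x"
    proof (rule ccontr)
      assume "\<not> ball d (1 / real (Suc n)) \<subseteq> C x"
      then have "ball d (1 / real (Suc n)) - C x \<noteq> {}" by blast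
      then obtain w where "w \<in> D" "w \<in> ball d (1 / real (Suc n)) - C x"
        using D(2)[of "ball d (1 / real (Suc n)) - C x"] clo[of x] by blast
      then show False using dn[of w] by simp
    qed
    moreover have "d \<in> ball d (1 / real (Suc n))" by simp
    ultimately show "interior (C x) \<noteq> {}" using interior_maximal[OF _ open_ball] by blast
  qed
  then show ?thesis
    using D(1) by simp measurable
qed

text \<open>Given interior points, \<open>convex_meets_open_iff\<close> lets the points of
  \<open>D\<close> decide whether the set leaves a ball.\<close>

lemma pred_body: "Measurable.pred M (\<lambda>x. compact (C x) \<and> interior (C x) \<noteq> {})"
proof -
  have "compact (C x) \<longleftrightarrow> (\<exists>n::nat. \<forall>w\<in>D. w \<in> C x \<longrightarrow> norm w \<le> real n)" if int: "interior (C x) \<noteq> {}" for x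
  proof
    assume "compact (C x)"
    from compact_imp_bounded[OF this] obtain b where "\<And>w. w \<in> C x \<Longrightarrow> norm w \<le> b" by (auto simp: bounded_iff)
    moreover obtain n where "b \<le> real n" using real_arch_simple by blast
    ultimately show "\<exists>n::nat. \<forall>w\<in>D. w \<in> C x \<longrightarrow> norm w \<le> real n" by (meson order_trans)
  next
    assume "\<exists>n::nat. \<forall>w\<in>D. w \<in> C x \<longrightarrow> norm w \<le> real n"
    then obtain n :: nat where n: "\<And>w. w \<in> D \<Longrightarrow> w \<in> C x \<Longrightarrow> norm w \<le> real n" by blast
    have "C x \<inter> - cball 0 (real n) = {}"
    proof (rule ccontr)
      assume "C x \<inter> - cball 0 (real n) \<noteq> {}"
      then obtain w where "w \<in> D" "w \<in> C x" "w \<in> - cball 0 (real n)"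
        using convex_meets_open_iff[OF D(2) conv clo int, of "- cball 0 (real n)"] by (auto simp: open_Compl)
      then show False using n[of w] by auto
    qed
    then have "bounded (C x)" using bounded_subset[OF bounded_cball] by blast
    then show "compact (C x)" using clo by (simp add: compact_eq_bounded_closed)
  qed
  then have "(compact (C x) \<and> interior (C x) \<noteq> {}) \<longleftrightarrow>
      (\<exists>n::nat. \<forall>w\<in>D. w \<in> C x \<longrightarrow> norm w \<le> real n) \<and> interior (C x) \<noteq> {}" for x
    by blast
  then show ?thesis
    using D(1) pred_interior by simp measurable
qed

text \<open>On this subspace the smallest vertex exists and the centred cell is an element of the
  hyperspace.\<close>

definition "bodies = restrict_space M {x \<in> space M. compact (C x) \<and> interior (C x) \<noteq> {}}"

lemma space_bodies: "space bodies = {x \<in> space M. compact (C x) \<and> interior (C x) \<noteq> {}}"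
  by (auto simp: bodies_def space_restrict_space)

lemma pred_mem_bodies [measurable]: "Measurable.pred bodies (\<lambda>x. w \<in> C x)"
  unfolding bodies_def by (rule measurable_restrict_space1) measurable

text \<open>The faces on which the first coordinates are minimal have no interior, so a dense set may miss them. The
  constraints on the coordinates before \<open>k\<close> are therefore relaxed by \<open>1 / (n + 1)\<close>, and compactness recovers
  the minimum over the face.\<close>

lemma measurable_lex_min_vertex: "(\<lambda>x. lex_min_vertex (C x) {}) \<in> borel_measurable bodies"
proof -
  let ?z = "\<lambda>x. lex_min_vertex (C x) {}"
  have comp: "(\<lambda>x. ?z x $ k) \<in> borel_measurable bodies" for k
  \<comment> \<open>The coordinates are treated in increasing order, because the description of
    coordinate \<open>k\<close> involves the earlier coordinates of the minimum.\<close>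
  proof (induction k rule: measure_induct_rule[where f="\<lambda>k. card {j. j < k}"])
    case (less k)
    have IH [measurable]: "(\<lambda>x. ?z x $ j) \<in> borel_measurable bodies" if "j \<in> {j. j < k}" for j
      using that by (intro less psubset_card_mono) auto
    \<comment> \<open>The rational \<open>q\<close> keeps a gap below \<open>c\<close>, so that
      strictness survives the passage to a limit point.\<close>
    have eq: "?z x $ k < c \<longleftrightarrow> (\<exists>q\<in>{q\<in>\<rat>. q < c}. \<forall>n::nat. \<exists>w\<in>D. w \<in> C x \<and>
        (\<forall>j\<in>{j. j < k}. w $ j < ?z x $ j + 1 / real (Suc n)) \<and> w $ k < q)"
      if x: "x \<in> space bodies" for x c
    proof -
      have cx: "compact (C x)" "interior (C x) \<noteq> {}" "C x \<noteq> {}" using x interior_subset[of "C x"]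
          by (auto simp: space_bodies)
      note z = lex_min_vertex_props[OF cx(1,3), where T="{}"]
      show ?thesis
      proof
        assume "?z x $ k < c"
        then obtain q where q: "q \<in> \<rat>" "?z x $ k < q" "q < c" using Rats_dense_in_real by blast
        have "\<exists>w\<in>D. w \<in> C x \<and> (\<forall>j\<in>{j. j < k}. w $ j < ?z x $ j + 1 / real (Suc n)) \<and> w $ k < q" for n
        proof -
          let ?V = "(\<Inter>j\<in>{j. j < k}. {w. w $ j < ?z x $ j + 1 / real (Suc n)}) \<inter> {w. w $ k < q}"
          have "open ?V"
            by (intro open_Int open_INT ballI open_Collect_less continuous_intros) auto
          moreover have "?z x \<in> C x \<inter> ?V" using z(1) q by auto
          ultimately obtain w where "w \<in> D" "w \<in> C x" "w \<in> ?V"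
            using convex_meets_open_iff[OF D(2) conv clo cx(2), of ?V] by blast
          then show ?thesis by (intro bexI[of _ w]) auto
        qed
        with q show "\<exists>q\<in>{q\<in>\<rat>. q < c}. \<forall>n::nat. \<exists>w\<in>D. w \<in> C x \<and>
            (\<forall>j\<in>{j. j < k}. w $ j < ?z x $ j + 1 / real (Suc n)) \<and> w $ k < q"
          by blast
      next
        assume "\<exists>q\<in>{q\<in>\<rat>. q < c}. \<forall>n::nat. \<exists>w\<in>D. w \<in> C x \<and> (\<forall>j\<in>{j. j < k}. w $ j < ?z x $ j + 1 / real (Suc n)) \<and>
            w $ k < q"
        then obtain q where q: "q < c"
            and ex: "\<forall>n::nat. \<exists>w\<in>D. w \<in> C x \<and> (\<forall>j\<in>{j. j < k}. w $ j < ?z x $ j + 1 / real (Suc n)) \<and> w $ k < q"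
          by blast
        have "\<exists>w. w \<in> C x \<and> (\<forall>j<k. w $ j < ?z x $ j + 1 / real (Suc n)) \<and> w $ k < q" for n :: nat
          using spec[OF ex, of n] by auto
        then obtain w where w: "\<And>n. w n \<in> C x" "\<And>n j. j < k \<Longrightarrow> w n $ j < ?z x $ j + 1 / real (Suc n)" "\<And>n. w n $ k < q"
          by metis
        obtain l s where l: "l \<in> C x" "strict_mono s" "(w \<circ> s) \<longlonglongrightarrow> l"
          using cx(1) w(1) unfolding compact_def by meson
        have lim: "(\<lambda>n. w (s n) $ j) \<longlonglongrightarrow> l $ j" for j
          using tendsto_vec_nth[OF l(3)] by (simp add: o_def)
        have "l $ k \<le> q"
          using w(3) by (intro LIMSEQ_le_const2[OF lim]) (auto intro: less_imp_le)
        moreover have "l $ j \<le> ?z x $ j" if "j < k" for j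
        proof (rule LIMSEQ_le[OF lim])
          show "(\<lambda>n. ?z x $ j + 1 / real (Suc (s n))) \<longlonglongrightarrow> ?z x $ j"
            using tendsto_add[OF tendsto_const LIMSEQ_subseq_LIMSEQ[OF LIMSEQ_Suc[OF lim_1_over_n] l(2)], of
                "?z x $ j"]
            by (simp add: o_def)
          show "\<exists>N. \<forall>n\<ge>N. w (s n) $ j \<le> ?z x $ j + 1 / real (Suc (s n))"
            using w(2)[OF that] by (auto intro: less_imp_le)
        qed
        ultimately have le: "l $ k \<le> q" "\<And>j. j < k \<Longrightarrow> l $ j \<le> ?z x $ j" by auto
        \<comment> \<open>The limit \<open>l\<close> is at most the minimum in every coordinate
          before \<open>k\<close>, so they can first differ only at \<open>k\<close> or later; hence
          coordinate \<open>k\<close> of the minimum is at most that of \<open>l\<close>.\<close>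
        have "lex_le (?z x) l" using z(2)[OF l(1)] .
        then consider "?z x = l" | i where "?z x $ i < l $ i" "\<And>j. j < i \<Longrightarrow> ?z x $ j = l $ j"
          unfolding lex_le_def less_fun_def by blast
        then have "?z x $ k \<le> q"
        proof cases
          case 1
          then show ?thesis using le(1) by simp
        next
          case 2
          then show ?thesis using le by (cases i k rule: linorder_cases) force+
        qed
        with q(1) show "?z x $ k < c" by simp
      qed
    qed
    show ?case
    proof (rule borel_measurableI_less)
      fix c
      have "{x \<in> space bodies. ?z x $ k < c} = {x \<in> space bodies. \<exists>q\<in>{q\<in>\<rat>. q < c}. \<forall>n::nat. \<exists>w\<in>D. w \<in> C x \<and>
          (\<forall>j\<in>{j. j < k}. w $ j < ?z x $ j + 1 / real (Suc n)) \<and> w $ k < q}"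
        using eq by blast
      also have "\<dots> \<in> sets bodies"
        using D(1) countable_subset[OF _ countable_rat, of "{q\<in>\<rat>. q < c}"] by measurable
      finally show "{x \<in> space bodies. ?z x $ k < c} \<in> sets bodies" .
    qed
  qed
  show ?thesis
    unfolding borel_measurable_euclidean_space[of "?z"]
    using comp by (auto simp: Basis_vec_def inner_axis)
qed

text \<open>\<open>measurable_ncompactI\<close> is applied on \<open>bodies\<close>, where the
  translated set really is nonempty and compact. As \<open>bodies\<close> is a measurable part of
  \<open>M\<close>, the event is measurable in \<open>M\<close> too.\<close>

lemma sets_centred_cell_in:
  assumes "A \<in> sets borel"
  shows "{x \<in> space M. centred_cell_in A (C x)} \<in> sets M"
proof -
  let ?z = "\<lambda>x. lex_min_vertex (C x) {}"
  let ?K = "\<lambda>x. (\<lambda>y. y - ?z x) ` C x"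
  have body: "compact (C x)" "interior (C x) \<noteq> {}" "C x \<noteq> {}" if "x \<in> space bodies" for x
    using that interior_subset[of "C x"] by (auto simp: space_bodies)
  have rep: "Rep_ncompact (Abs_ncompact (?K x)) = ?K x" if "x \<in> space bodies" for x
    using body[OF that] by (intro Abs_ncompact_inverse) (auto intro!: compact_continuous_image continuous_intros)
  note [measurable] = measurable_lex_min_vertex
  have "(\<lambda>x. Abs_ncompact (?K x)) \<in> borel_measurable bodies"
  proof (rule measurable_ncompactI)
    fix U :: "(real ^ 'd::{finite,linorder}) set" assume U: "open U"
    then have [measurable]: "U \<in> sets borel" by simp
    have "{x \<in> space bodies. Rep_ncompact (Abs_ncompact (?K x)) \<inter> U \<noteq> {}} = {x \<in> space bodies. \<exists>w\<in>D. w \<in> C x \<and>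
        w - ?z x \<in> U}"
    proof -
      have "?K x \<inter> U \<noteq> {} \<longleftrightarrow> (\<exists>w\<in>D. w \<in> C x \<and> w - ?z x \<in> U)" if "x \<in> space bodies" for x
      proof -
        have "open ((\<lambda>y. y - ?z x) -` U)"
          by (intro open_vimage U continuous_intros)
        then have "C x \<inter> ((\<lambda>y. y - ?z x) -` U) \<noteq> {} \<longleftrightarrow> (\<exists>w\<in>D. w \<in> C x \<and> w - ?z x \<in> U)"
          using convex_meets_open_iff[OF D(2) conv clo body(2)[OF that], of "(\<lambda>y. y - ?z x) -` U"] by simp
        then show ?thesis by blast
      qed
      then show ?thesis by (intro Collect_cong conj_cong refl) (simp only: rep)
    qed
    also have "\<dots> \<in> sets bodies"
      using D(1) by measurable
    finally show "{x \<in> space bodies. Rep_ncompact (Abs_ncompact (?K x)) \<inter> U \<noteq> {}} \<in> sets bodies" .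
  qed
  then have "(\<lambda>x. Abs_ncompact (?K x)) -` A \<inter> space bodies \<in> sets bodies"
    using assms by (rule measurable_sets)
  moreover have "?z -` cbox 0 One \<inter> space bodies \<in> sets bodies"
    by measurable
  ultimately have "((\<lambda>x. Abs_ncompact (?K x)) -` A \<inter> space bodies) \<inter> (?z -` cbox 0 One \<inter> space bodies) \<in> sets bodies"
    by (rule sets.Int)
  also have "((\<lambda>x. Abs_ncompact (?K x)) -` A \<inter> space bodies) \<inter> (?z -` cbox 0 One \<inter> space bodies) =
      {x \<in> space M. centred_cell_in A (C x)}"
  proof -
    have "Abs_ncompact (?K x) \<in> A \<longleftrightarrow> ?K x \<in> Rep_ncompact ` A" if "x \<in> space bodies" for x
    proof
      assume "Abs_ncompact (?K x) \<in> A"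
      then have "Rep_ncompact (Abs_ncompact (?K x)) \<in> Rep_ncompact ` A" by (rule imageI)
      then show "?K x \<in> Rep_ncompact ` A" unfolding rep[OF that] .
    next
      assume "?K x \<in> Rep_ncompact ` A"
      then obtain a where "a \<in> A" "?K x = Rep_ncompact a" by (rule imageE)
      then show "Abs_ncompact (?K x) \<in> A" by (simp add: Rep_ncompact_inverse)
    qed
    then have "(x \<in> space bodies \<and> Abs_ncompact (?K x) \<in> A \<and> ?z x \<in> cbox 0 One) \<longleftrightarrow>
        (x \<in> space M \<and> centred_cell_in A (C x))" for x
      unfolding space_bodies centred_cell_in_def mem_Collect_eq by blast
    then show ?thesis by blast
  qed
  finally show ?thesis
    using pred_body unfolding bodies_def by (subst (asm) sets_restrict_space_iff) (auto simp: pred_def)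
qed

end

section \<open>Laguerre cells as random closed convex sets\<close>

lemma closed_laguerre_cell: "closed (laguerre_cell p (A :: ('a::euclidean_space \<times> real) set))"
proof -
  have "laguerre_cell p A = (\<Inter>q\<in>A. {w. pow_fun w p \<le> pow_fun w q})"
    by (auto simp: laguerre_cell_def)
  also have "closed \<dots>"
    unfolding pow_fun_def by (intro closed_INT ballI closed_Collect_le continuous_intros)
  finally show ?thesis .
qed

lemma convex_laguerre_cell: "convex (laguerre_cell p (A :: ('a::euclidean_space \<times> real) set))"
proof -
  have "laguerre_cell p A = (\<Inter>q\<in>A. {w. inner (2 *\<^sub>R (fst q - fst p)) w \<le>
      (fst q \<bullet> fst q) - (fst p \<bullet> fst p) + snd q - snd p})"
  proof -
    have "pow_fun w p \<le> pow_fun w q \<longleftrightarrow>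
        inner (2 *\<^sub>R (fst q - fst p)) w \<le> (fst q \<bullet> fst q) - (fst p \<bullet> fst p) + snd q - snd p" for w q
      unfolding pow_fun_def power2_norm_eq_inner
      using inner_commute[of w "fst p"] inner_commute[of w "fst q"]
      by (simp add: inner_diff_left inner_diff_right) linarith
    then show ?thesis unfolding laguerre_cell_def by blast
  qed
  also have "convex \<dots>"
    by (intro convex_INT convex_halfspace_le)
  finally show ?thesis .
qed

text \<open>If \<open>w\<close> is outside the cell, some point of the configuration has smaller
  power at \<open>w\<close> than the nucleus; a rational number between the two powers turns this
  into countably many events about counts.\<close>

lemma sets_laguerre_cell_mem:
  "{x \<in> space (borel \<Otimes>\<^sub>M configs).
      w \<in> laguerre_cell (fst x) (snd x)} \<in>
          sets (borel \<Otimes>\<^sub>M configs :: (('a::euclidean_space \<times> real) \<times> ('a \<times> real) set) measure)"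
proof -
  let ?P = "borel \<Otimes>\<^sub>M configs :: (('a::euclidean_space \<times> real) \<times> ('a \<times> real) set) measure"
  have cont: "continuous_on UNIV (pow_fun w :: 'a \<times> real \<Rightarrow> real)"
    unfolding pow_fun_def by (intro continuous_intros)
  have [measurable]: "(pow_fun w :: 'a \<times> real \<Rightarrow> real) \<in> borel_measurable borel"
    by (rule borel_measurable_continuous_onI[OF cont])
  have [measurable]: "{q :: 'a \<times> real. pow_fun w q < c} \<in> sets borel" for c
    by (intro borel_open open_Collect_less cont) simp
  have "w \<notin> laguerre_cell p X \<longleftrightarrow> (\<exists>c\<in>\<rat>. c < pow_fun w p \<and> points_in {q. pow_fun w q < c} X \<noteq> 0)"
      for p :: "'a \<times> real" and X
  proof
    assume "w \<notin> laguerre_cell p X"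
    then obtain q where q: "q \<in> X" "pow_fun w q < pow_fun w p" by (auto simp: laguerre_cell_def not_le)
    then obtain c where c: "c \<in> \<rat>" "pow_fun w q < c" "c < pow_fun w p" using Rats_dense_in_real by blast
    then have "X \<inter> {q. pow_fun w q < c} \<noteq> {}" using q by blast
    then show "\<exists>c\<in>\<rat>. c < pow_fun w p \<and> points_in {q. pow_fun w q < c} X \<noteq> 0"
      using c unfolding points_in_eq_0_iff by blast
  next
    assume "\<exists>c\<in>\<rat>. c < pow_fun w p \<and> points_in {q. pow_fun w q < c} X \<noteq> 0"
    then obtain c where c: "c < pow_fun w p" "X \<inter> {q. pow_fun w q < c} \<noteq> {}"
      unfolding points_in_eq_0_iff by blast
    then obtain q where q: "q \<in> X" "pow_fun w q < c" by blast
    with c(1) have "\<not> pow_fun w p \<le> pow_fun w q" by linarith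
    then show "w \<notin> laguerre_cell p X" using q(1) unfolding laguerre_cell_def by blast
  qed
  then have "{x \<in> space ?P. w \<in> laguerre_cell (fst x) (snd x)} =
      {x \<in> space ?P. \<not> (\<exists>c\<in>\<rat>. c < pow_fun w (fst x) \<and> points_in {q. pow_fun w q < c} (snd x) \<noteq> 0)}"
    by blast
  also have "\<dots> \<in> sets ?P"
    using countable_rat by measurable
  finally show ?thesis .
qed

lemma sets_centred_laguerre_cell:
  assumes "A \<in> sets borel"
  shows "{(p, X). centred_cell_in A (laguerre_cell p X)} \<in> sets (borel \<Otimes>\<^sub>M configs)"
proof -
  obtain D :: "(real ^ 'a::{finite,linorder}) set" where D: "countable D" "\<And>X. open X \<Longrightarrow> X \<noteq> {} \<Longrightarrow> \<exists>d\<in>D. d \<in> X"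
    using countable_dense_setE by blast
  have "{x \<in> space (borel \<Otimes>\<^sub>M configs). centred_cell_in A (laguerre_cell (fst x) (snd x))} \<in> sets (borel \<Otimes>\<^sub>M configs)"
    by (rule sets_centred_cell_in[OF D sets_laguerre_cell_mem closed_laguerre_cell convex_laguerre_cell assms])
  then show ?thesis by (simp add: space_pair_measure split_beta')
qed

section \<open>Almost sure properties of the diagram\<close>

lemma orthant_mono:
  assumes "R2 \<le> R1" "R1' \<le> R2'"
  shows "orthant S R1 R1' \<subseteq> orthant S R2 R2'"
proof
  fix q assume "q \<in> orthant S R1 R1'"
  then obtain v h where q: "q = (v, h)" "h \<le> R1'"
    and v: "\<And>b. b \<in> Basis \<Longrightarrow> if b \<in> S then R1 \<le> v \<bullet> b \<and> v \<bullet> b \<le> R1' else - R1' \<le> v \<bullet> b \<and> v \<bullet> b \<le> - R1"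
    by (auto simp: orthant_def)
  have "if b \<in> S then R2 \<le> v \<bullet> b \<and> v \<bullet> b \<le> R2' else - R2' \<le> v \<bullet> b \<and> v \<bullet> b \<le> - R2" if "b \<in> Basis" for b
    using v[OF that] assms by (auto split: if_splits)
  then show "q \<in> orthant S R2 R2'" using q assms by (simp add: orthant_def)
qed

text \<open>Two almost sure properties that make all cells compact: finitely many competitors in
  each paraboloid region, and points arbitrarily far out in each orthant.\<close>

definition regular_config :: "('a::euclidean_space \<times> real) set \<Rightarrow> bool" where
  "regular_config X \<longleftrightarrow> (\<forall>c L. finite (X \<inter> low_power c L)) \<and> (\<forall>S\<in>Pow Basis. \<forall>R. \<exists>R'. X \<inter> orthant S R R' \<noteq> {})"

text \<open>The intensity of a truncated orthant grows at least linearly in \<open>R'\<close>, so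
  the probability that all truncations are empty is 0. Integer parameters suffice by
  monotonicity.\<close>

lemma poisson_regular_config:
  fixes X :: "'w \<Rightarrow> ('a::euclidean_space \<times> real) set"
  assumes PX: "poisson_process M X (Lambda f)" and int: "intensity DIM('a) f"
    and pos: "0 < (\<integral>\<^sup>+h\<in>{..h0}. ennreal (f h) \<partial>lborel)"
  shows "AE \<omega> in M. regular_config (X \<omega>)"
proof -
  interpret prob_space M using PX sets_Lambda by (rule poisson_prob_space)
  have X [measurable]: "X \<in> M \<rightarrow>\<^sub>M configs" using PX sets_Lambda by (rule poisson_measurable)
  have 1: "AE \<omega> in M. \<forall>j::nat. points_in (low_power (real j) (real j)) (X \<omega>) < \<infinity>"
    by (intro AE_all_countable[THEN iffD2] allI poisson_AE_finite[OF PX sets_Lambda] intensity_fin[OF int]) auto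
  have "AE \<omega> in M. \<exists>i::nat. X \<omega> \<inter> orthant S (real n) (real i) \<noteq> {}" for S and n :: nat
  proof -
    define a where "a = enn2real (\<integral>\<^sup>+h\<in>{..h0}. ennreal (f h) \<partial>lborel)"
    have a: "0 < a"
      unfolding a_def using pos intensity_integral_finite[OF int] by (simp add: enn2real_positive_iff)
    have "prob {\<omega> \<in> space M. \<forall>i::nat. points_in (orthant S (real n) (real i)) (X \<omega>) = 0} \<le> 0"
    proof (rule tendsto_lowerbound[OF _ _ sequentially_bot])
      have "filterlim (\<lambda>i::nat. (real i - real n) * a) at_top sequentially"
        using a by real_asymp
      then show "(\<lambda>i::nat. exp (- ((real i - real n) * a))) \<longlonglongrightarrow> 0"
        by (intro filterlim_compose[OF exp_at_bot]) (simp add: filterlim_uminus_at_bot)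
      obtain i0 :: nat where i0: "h0 \<le> real i0" using real_arch_simple by blast
      have "prob {\<omega> \<in> space M. \<forall>i::nat. points_in (orthant S (real n) (real i)) (X \<omega>) = 0} \<le>
          exp (- ((real i - real n) * a))"
        if i: "i \<ge> max i0 (Suc n)" for i :: nat
      proof -
        have "prob {\<omega> \<in> space M. \<forall>i::nat. points_in (orthant S (real n) (real i)) (X \<omega>) = 0}
          \<le> prob {\<omega> \<in> space M. points_in (orthant S (real n) (real i)) (X \<omega>) = 0}"
          by (intro finite_measure_mono) auto
        also have "\<dots> = exp (- measure (Lambda f) (orthant S (real n) (real i) :: ('a \<times> real) set))"
          using i by (intro poisson_void[OF PX sets_Lambda] intensity_fin[OF int]) auto
        also have "\<dots> \<le> exp (- ((real i - real n) * a))"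
          using measure_Lambda_orthant_ge[OF int, of "real n" "real i" h0 S] i i0 by (auto simp: a_def)
        finally show ?thesis .
      qed
      then show "\<forall>\<^sub>F i in sequentially. prob {\<omega> \<in> space M. \<forall>i::nat.
          points_in (orthant S (real n) (real i)) (X \<omega>) = 0} \<le> exp (- ((real i - real n) * a))"
        by (rule eventually_sequentiallyI)
    qed
    then have "prob {\<omega> \<in> space M. \<forall>i::nat. points_in (orthant S (real n) (real i)) (X \<omega>) = 0} = 0"
      by (simp add: measure_le_0_iff)
    then show ?thesis
      by (subst AE_iff_measurable[OF _ refl]) (auto simp: emeasure_eq_measure points_in_eq_0_iff[symmetric])
  qed
  then have 2: "AE \<omega> in M. \<forall>S\<in>Pow Basis. \<forall>n::nat. \<exists>i::nat. X \<omega> \<inter> orthant S (real n) (real i) \<noteq> {}"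
    by (intro AE_finite_allI AE_all_countable[THEN iffD2] allI) auto
  from 1 2 show ?thesis
  proof eventually_elim
    case (elim \<omega>)
    have "finite (X \<omega> \<inter> low_power c L)" for c L
    proof -
      obtain j :: nat where j: "max c L \<le> real j" using real_arch_simple by blast
      have "finite (X \<omega> \<inter> low_power (real j) (real j))"
        using elim(1) unfolding points_in_def by (auto simp: emeasure_count_space split: if_splits)
      then show ?thesis using low_power_mono[of c "real j" L "real j"] j by (auto elim: finite_subset[rotated])
    qed
    moreover have "\<exists>R'. X \<omega> \<inter> orthant S R R' \<noteq> {}" if S: "S \<in> Pow Basis" for S R
    proof -
      obtain n :: nat where n: "R \<le> real n" using real_arch_simple by blast
      obtain i :: nat where i: "X \<omega> \<inter> orthant S (real n) (real i) \<noteq> {}" using elim(2) S by blast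
      have "orthant S (real n) (real i) \<subseteq> (orthant S R (real i) :: ('a \<times> real) set)"
        using n by (intro orthant_mono) auto
      then show ?thesis using i by blast
    qed
    ultimately show ?case unfolding regular_config_def by blast
  qed
qed

text \<open>\<open>good_config_cell_bounded\<close> also serves a fixed configuration: for
  \<open>w\<close> in the cell take \<open>c = norm w\<close>, let \<open>p\<close> itself be the
  point in the column, and obtain \<open>H\<close> and \<open>R'\<close> as bounds over finitely
  many points and sign patterns.\<close>

lemma compact_laguerre_cell:
  fixes X :: "('a::euclidean_space \<times> real) set"
  assumes reg: "regular_config X" and p: "p \<in> X"
  shows "compact (laguerre_cell p X)"
proof (cases "laguerre_cell p X = {}")
  case False
  then obtain w where w: "w \<in> laguerre_cell p X" by blast
  obtain v h where vh: "p = (v, h)" by force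
  let ?c = "norm w" and ?r = "norm v"
  let ?low = "low_power ?c ((?c + sqrt DIM('a) * ?r)\<^sup>2 + h)"
  have "finite (X \<inter> ?low)" using reg by (simp add: regular_config_def)
  then have "bdd_below (snd ` (X \<inter> ?low))" by simp
  then obtain H where H: "\<And>x. x \<in> X \<inter> ?low \<Longrightarrow> - H \<le> snd x"
    unfolding bdd_below_def by (metis image_eqI minus_minus)
  define R where "R = ?c + sqrt ((?c + sqrt DIM('a) * ?r)\<^sup>2 + h + H) + 1"
  have "\<exists>R'. X \<inter> orthant S R R' \<noteq> {}" if "S \<in> Pow Basis" for S
    using reg that by (simp add: regular_config_def)
  then obtain g where g: "\<And>S. S \<in> Pow Basis \<Longrightarrow> X \<inter> orthant S R (g S) \<noteq> {}" by metis
  define R' where "R' = Max (g ` Pow Basis)"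
  have "good_config ?c ?r h H R R' X"
    unfolding good_config_def
  proof (intro conjI ballI)
    have "p \<in> X \<inter> column_below ?r h" using p by (auto simp: vh column_below_def Basis_le_norm)
    then show "X \<inter> column_below ?r h \<noteq> {}" by blast
    show "X \<inter> (?low \<inter> UNIV \<times> {..<- H}) = {}" using H by force
    fix S :: "'a set" assume S: "S \<in> Pow Basis"
    have "g S \<le> R'" unfolding R'_def using S by (intro Max_ge) auto
    then have "orthant S R (g S) \<subseteq> orthant S R R'" by (intro orthant_mono) auto
    then show "X \<inter> orthant S R R' \<noteq> {}" using g[OF S] by blast
  qed
  then have "laguerre_cell p X \<subseteq> cball 0 ((real DIM('a) * R'\<^sup>2 + R' + H) / 2)"
    by (rule good_config_cell_bounded) (use p w R_def in auto)
  then show ?thesis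
    using closed_laguerre_cell[of p X] bounded_subset[OF bounded_cball] by (simp add: compact_eq_bounded_closed)
qed simp

lemma interior_finite_Union_empty:
  assumes "finite F" "\<And>C. C \<in> F \<Longrightarrow> closed C \<and> interior C = {}"
  shows "interior (\<Union>F) = {}"
  using assms
proof (induction F rule: finite_induct)
  case (insert C F)
  then show ?case using interior_closed_Un_empty_interior[of C "\<Union>F"] by auto
qed simp

text \<open>The unit ball is covered by finitely many closed cells, so they cannot all have empty
  interior.\<close>

lemma exists_laguerre_cell_interior:
  fixes X :: "('a::euclidean_space \<times> real) set"
  assumes reg: "regular_config X"
  shows "\<exists>p\<in>X. interior (laguerre_cell p X) \<noteq> {}"
proof (rule ccontr)
  assume no: "\<not> (\<exists>p\<in>X. interior (laguerre_cell p X) \<noteq> {})"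
  obtain R' where "X \<inter> orthant {} 0 R' \<noteq> {}" using reg unfolding regular_config_def by blast
  then obtain q where q: "q \<in> X" by blast
  let ?r = "norm (fst q)"
  let ?L = "(1 + sqrt DIM('a) * ?r)\<^sup>2 + snd q"
  have qc: "q \<in> column_below ?r (snd q)" by (cases q) (auto simp: column_below_def Basis_le_norm)
  have low: "pow_fun w q \<le> ?L" if "norm w \<le> 1" for w
    using pow_fun_column_le[OF qc that] .
  let ?F = "X \<inter> low_power 1 ?L"
  have fin: "finite ?F" using reg by (simp add: regular_config_def)
  have qF: "q \<in> ?F" using q low_powerI[of 0 1 q ?L] low[of 0] by auto
  have "cball 0 1 \<subseteq> (\<Union>p\<in>?F. laguerre_cell p X)"
  proof
    fix w :: 'a assume "w \<in> cball 0 1"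
    then have w: "norm w \<le> 1" by simp
    \<comment> \<open>A nucleus of least power at \<open>w\<close> exists because only the finitely
      many points of \<open>?F\<close> compete on the unit ball.\<close>
    define p where "p = arg_min_on (pow_fun w) ?F"
    have p: "p \<in> ?F" unfolding p_def using fin qF by (intro arg_min_if_finite(1)) auto
    have pmin: "pow_fun w p \<le> pow_fun w p'" if "p' \<in> ?F" for p'
      unfolding p_def using fin that by (intro arg_min_least) auto
    have "pow_fun w p \<le> pow_fun w p'" if "p' \<in> X" for p'
    proof (cases "pow_fun w p' \<le> ?L")
      case True
      then show ?thesis using that w by (intro pmin) (auto intro: low_powerI)
    next
      case False
      then show ?thesis using pmin[OF qF] low[OF w] by linarith
    qed
    then have "w \<in> laguerre_cell p X" by (auto simp: laguerre_cell_def)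
    with p show "w \<in> (\<Union>p\<in>?F. laguerre_cell p X)" by blast
  qed
  then have "interior (cball 0 1 :: 'a set) \<subseteq> interior (\<Union>p\<in>?F. laguerre_cell p X)" by (rule interior_mono)
  also have "\<dots> = {}"
    using fin no closed_laguerre_cell by (intro interior_finite_Union_empty) auto
  finally show False by simp
qed

text \<open>On a ball inside the common cell both powers agree. Their difference is affine with
  gradient a multiple of \<open>u - v\<close>, so the centres coincide, and then the
  heights.\<close>

lemma laguerre_cell_inj:
  assumes "laguerre_cell p X = laguerre_cell q X" "p \<in> X" "q \<in> X" "interior (laguerre_cell p X) \<noteq> {}"
  shows "p = (q :: 'a::euclidean_space \<times> real)"
proof -
  obtain w e where we: "0 < e" "ball w e \<subseteq> laguerre_cell p X"
    using assms(4) by (auto simp: mem_interior)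
  have eq: "pow_fun x p = pow_fun x q" if "x \<in> ball w e" for x
  proof (rule antisym)
    have x: "x \<in> laguerre_cell p X" "x \<in> laguerre_cell q X" using that we(2) assms(1) by auto
    show "pow_fun x p \<le> pow_fun x q" using x(1) assms(3) by (simp add: laguerre_cell_def)
    show "pow_fun x q \<le> pow_fun x p" using x(2) assms(2) by (simp add: laguerre_cell_def)
  qed
  obtain v h u k where p: "p = (v, h)" and q: "q = (u, k)" by force
  have lin: "2 * (x \<bullet> (u - v)) = u \<bullet> u - v \<bullet> v + k - h" if "x \<in> ball w e" for x
    using eq[OF that] by (simp add: p q pow_fun_def power2_norm_eq_inner inner_diff_left inner_diff_right
        inner_commute algebra_simps)
  have "u - v = 0"
  proof (rule ccontr)
    assume ne: "u - v \<noteq> 0"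
    define y where "y = w + (e / (2 * norm (u - v))) *\<^sub>R (u - v)"
    have "dist w y = e / 2" using ne we by (simp add: y_def dist_norm)
    then have "y \<in> ball w e" using we by simp
    then have "y \<bullet> (u - v) = w \<bullet> (u - v)" using lin[of y] lin[of w] we by simp
    then have "(e / (2 * norm (u - v))) * ((u - v) \<bullet> (u - v)) = 0"
      by (simp add: y_def inner_add_left)
    then show False using ne we by simp
  qed
  then have "u = v" by simp
  then show ?thesis using lin[of w] we by (simp add: p q)
qed

text \<open>By \<open>laguerre_cell_inj\<close> nuclei and cells correspond one to one, since only
  cells with interior points enter the diagram.\<close>

lemma sum_laguerre_diagram:
  fixes X :: "('a::euclidean_space \<times> real) set" and \<Psi> :: "'a set \<Rightarrow> bool"
  assumes "\<And>c. \<Psi> c \<Longrightarrow> interior c \<noteq> {}"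
  shows "(\<integral>\<^sup>+t. indicator {c. \<Psi> c} t \<partial>count_space (laguerre_diagram X)) = cell_count \<Psi> X"
proof -
  let ?P = "{p \<in> X. interior (laguerre_cell p X) \<noteq> {}}"
  have "bij_betw (\<lambda>p. laguerre_cell p X) ?P (laguerre_diagram X)"
    unfolding bij_betw_def
  proof
    show "inj_on (\<lambda>p. laguerre_cell p X) ?P"
      by (rule inj_onI, rule laguerre_cell_inj[where X=X]) simp_all
  qed (auto simp: laguerre_diagram_def)
  then have "(\<integral>\<^sup>+t. indicator {c. \<Psi> c} t \<partial>count_space (laguerre_diagram X)) =
      (\<integral>\<^sup>+p. indicator {c. \<Psi> c} (laguerre_cell p X) \<partial>count_space ?P)"
    by (rule nn_integral_bij_count_space[symmetric])
  also have "\<dots> = (\<integral>\<^sup>+p. indicator {c. \<Psi> c} (laguerre_cell p X) * indicator ?P p \<partial>count_space UNIV)"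
    by (rule nn_integral_count_space_indicator) simp
  also have "\<dots> = (\<integral>\<^sup>+p. indicator (X \<inter> {p. \<Psi> (laguerre_cell p X)}) p \<partial>count_space UNIV)"
    using assms by (intro nn_integral_cong) (auto simp: indicator_def)
  also have "\<dots> = cell_count \<Psi> X"
    unfolding cell_count_def points_in_def by (rule nn_integral_indicator) simp
  finally show ?thesis .
qed

section \<open>The distribution of the typical cell\<close>

text \<open>The unit cube lies in this ball about 0; its radius is the value of \<open>c\<close> in
  the application.\<close>

lemma centred_cell_in_hit:
  fixes c :: "(real ^ 'd::{finite,linorder}) set"
  assumes "centred_cell_in A c"
  shows "c \<inter> cball 0 (sqrt DIM(real ^ 'd::{finite,linorder})) \<noteq> {}"
proof -
  let ?z = "lex_min_vertex c {}"
  have c: "compact c" "c \<noteq> {}" "?z \<in> cbox 0 One"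
    using assms interior_subset[of c] by (auto simp: centred_cell_in_def)
  have "norm ?z \<le> sqrt DIM(real ^ 'd::{finite,linorder}) * 1"
    using c(3) by (intro norm_le_box) (auto simp: mem_box)
  then have "?z \<in> c \<inter> cball 0 (sqrt DIM(real ^ 'd::{finite,linorder}))"
    using lex_min_vertex_props(1)[OF c(1,2)] by simp
  then show ?thesis by blast
qed

lemma translate_in_Rep_UNIV:
  fixes c :: "'a::real_normed_vector set"
  assumes "compact c" "c \<noteq> {}"
  shows "(\<lambda>x. x - z) ` c \<in> range Rep_ncompact"
proof -
  have "compact ((\<lambda>x. x - z) ` c)"
    using assms by (intro compact_continuous_image continuous_intros)
  then have "Rep_ncompact (Abs_ncompact ((\<lambda>x. x - z) ` c)) = (\<lambda>x. x - z) ` c"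
    using assms by (intro Abs_ncompact_inverse) auto
  then show ?thesis using rangeI[of Rep_ncompact] by metis
qed

lemma sum_centred_laguerre_diagram:
  fixes X :: "((real ^ 'd::{finite,linorder}) \<times> real) set"
  assumes reg: "regular_config X"
  shows "(\<integral>\<^sup>+t. indicator (Rep_ncompact ` A) ((\<lambda>x. x - lex_min_vertex t (laguerre_diagram X)) ` t) *
      indicator (cbox 0 One) (lex_min_vertex t (laguerre_diagram X)) \<partial>count_space (laguerre_diagram X)) =
          cell_count (centred_cell_in A) X" (is "?l = _")
    and "(\<integral>\<^sup>+t. indicator (cbox 0 One) (lex_min_vertex t (laguerre_diagram X)) \<partial>count_space (laguerre_diagram X))
      = cell_count (centred_cell_in UNIV) X"
proof -
  let ?T = "laguerre_diagram X"
  have z: "lex_min_vertex t ?T = lex_min_vertex t {}" for t by (rule lex_min_vertex_irrelevant)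
  have t: "compact t" "interior t \<noteq> {}" "t \<noteq> {}" if "t \<in> ?T" for t
    using that compact_laguerre_cell[OF reg] interior_subset[of t] by (auto simp: laguerre_diagram_def)
  have "?l = (\<integral>\<^sup>+t. indicator {c. centred_cell_in A c} t \<partial>count_space ?T)"
  proof (rule nn_integral_cong)
    fix t assume "t \<in> space (count_space ?T)"
    then show "indicator (Rep_ncompact ` A) ((\<lambda>x. x - lex_min_vertex t ?T) ` t) *
        indicator (cbox 0 One) (lex_min_vertex t ?T)
      = (indicator {c. centred_cell_in A c} t :: ennreal)"
      using t[of t] unfolding z centred_cell_in_def indicator_def by auto
  qed
  then show "?l = cell_count (centred_cell_in A) X"
    by (subst (asm) sum_laguerre_diagram) (auto simp: centred_cell_in_def)
  have "(\<integral>\<^sup>+t. indicator (cbox 0 One) (lex_min_vertex t ?T) \<partial>count_space ?T) =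
      (\<integral>\<^sup>+t. indicator {c. centred_cell_in UNIV c} t \<partial>count_space ?T)"
  proof (rule nn_integral_cong)
    fix t assume "t \<in> space (count_space ?T)"
    then show "indicator (cbox 0 One) (lex_min_vertex t ?T) = (indicator {c. centred_cell_in UNIV c} t :: ennreal)"
      using t[of t] translate_in_Rep_UNIV[of t] unfolding z centred_cell_in_def indicator_def by simp
  qed
  then show "(\<integral>\<^sup>+t. indicator (cbox 0 One) (lex_min_vertex t ?T) \<partial>count_space ?T) =
      cell_count (centred_cell_in UNIV) X"
    by (subst (asm) sum_laguerre_diagram) (auto simp: centred_cell_in_def)
qed

lemma cell_count_centred_UN:
  assumes "disjoint_family A"
  shows "cell_count (centred_cell_in (\<Union>i::nat. A i)) X = (\<Sum>i. cell_count (centred_cell_in (A i)) X)"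
proof -
  let ?S = "\<lambda>i. X \<inter> {p. centred_cell_in (A i) (laguerre_cell p X)}"
  have dj: "Rep_ncompact ` A i \<inter> Rep_ncompact ` A j = {}" if "i \<noteq> j" for i j
  proof -
    have "A i \<inter> A j = {}" using assms that by (simp add: disjoint_family_on_def)
    then show ?thesis by (auto simp: Rep_ncompact_inject)
  qed
  have "disjoint_family ?S"
    unfolding disjoint_family_on_def centred_cell_in_def using dj by blast
  then have "(\<Sum>i. emeasure (count_space UNIV) (?S i)) = emeasure (count_space UNIV) (\<Union>i. ?S i)"
    by (intro suminf_emeasure) auto
  moreover have "(\<Union>i. ?S i) = X \<inter> {p. centred_cell_in (\<Union>i. A i) (laguerre_cell p X)}"
    unfolding centred_cell_in_def image_UN by blast
  ultimately show ?thesis by (simp add: cell_count_def points_in_def)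
qed

text \<open>The value of \<open>measure_of\<close> is the given set function only once countable
  additivity is known. This rests on the measurable modifications \<open>?F i\<close> of the counts,
  which agree with them almost surely.\<close>

lemma emeasure_typical_cell_distr:
  fixes X :: "'w \<Rightarrow> ((real ^ 'd::{finite,linorder}) \<times> real) set"
  assumes PX: "poisson_process M X (Lambda f)" and int: "intensity DIM(real ^ 'd::{finite,linorder}) f"
    and pos: "0 < (\<integral>\<^sup>+h\<in>{..h0}. ennreal (f h) \<partial>lborel)"
    and A: "A \<in> sets borel"
  shows "emeasure (typical_cell_distr lex_min_vertex M (\<lambda>\<omega>. laguerre_diagram (X \<omega>))) A =
    (\<integral>\<^sup>+\<omega>. cell_count (centred_cell_in A) (X \<omega>) \<partial>M) / (\<integral>\<^sup>+\<omega>. cell_count (centred_cell_in UNIV) (X \<omega>) \<partial>M)"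
proof -
  have X [measurable]: "X \<in> M \<rightarrow>\<^sub>M configs" using PX sets_Lambda by (rule poisson_measurable)
  note reg = poisson_regular_config[OF PX int pos]
  let ?T = "\<lambda>\<omega>. laguerre_diagram (X \<omega>)"
  let ?\<gamma> = "\<integral>\<^sup>+\<omega>. cell_count (centred_cell_in UNIV) (X \<omega>) \<partial>M"
  have \<gamma>: "cell_intensity lex_min_vertex M ?T = ?\<gamma>"
    unfolding cell_intensity_def using reg
    by (intro nn_integral_cong_AE) (auto elim!: eventually_mono simp: sum_centred_laguerre_diagram)
  have E: "(\<integral>\<^sup>+\<omega>. (\<integral>\<^sup>+t. indicator (Rep_ncompact ` A) ((\<lambda>x. x - lex_min_vertex t (?T \<omega>)) ` t) *
                 indicator (cbox 0 One) (lex_min_vertex t (?T \<omega>)) \<partial>count_space (?T \<omega>)) \<partial>M) =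
      (\<integral>\<^sup>+\<omega>. cell_count (centred_cell_in A) (X \<omega>) \<partial>M)" for A
    using reg by (intro nn_integral_cong_AE) (auto elim!: eventually_mono simp: sum_centred_laguerre_diagram)
  let ?\<mu> = "\<lambda>A. (\<integral>\<^sup>+\<omega>. cell_count (centred_cell_in A) (X \<omega>) \<partial>M) / ?\<gamma>"
  have eq: "typical_cell_distr lex_min_vertex M ?T = measure_of UNIV (sets borel) ?\<mu>"
    unfolding typical_cell_distr_def E \<gamma> ..
  show ?thesis
  proof (rule emeasure_measure_of[OF eq])
    show "positive (sets (typical_cell_distr lex_min_vertex M ?T)) ?\<mu>"
      by (simp add: positive_def cell_count_def points_in_def centred_cell_in_def)
    show "countably_additive (sets (typical_cell_distr lex_min_vertex M ?T)) ?\<mu>"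
      unfolding countably_additive_def
    proof (intro allI impI)
      fix B :: "nat \<Rightarrow> (real ^ 'd::{finite,linorder}) ncompact set"
      assume B: "range B \<subseteq> sets (typical_cell_distr lex_min_vertex M ?T)" "disjoint_family B"
      have B_sets: "B i \<in> sets borel" for i
        using B(1) by (auto simp: typical_cell_distr_def sets.sigma_sets_eq[of borel, simplified])
      let ?F = "\<lambda>i \<omega>. if locally_finite_config (X \<omega>) then cell_count (centred_cell_in (B i)) (X \<omega>) else 0"
      have [measurable]: "?F i \<in> borel_measurable M" for i
        by (rule measurable_compose[OF X borel_measurable_cell_count[OF sets_centred_laguerre_cell[OF B_sets]]])
      have F: "(\<integral>\<^sup>+\<omega>. ?F i \<omega> \<partial>M) = (\<integral>\<^sup>+\<omega>. cell_count (centred_cell_in (B i)) (X \<omega>) \<partial>M)" for i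
        using poisson_locally_finite[OF PX int] by (intro nn_integral_cong_AE) auto
      have "(\<integral>\<^sup>+\<omega>. cell_count (centred_cell_in (\<Union>i. B i)) (X \<omega>) \<partial>M) = (\<integral>\<^sup>+\<omega>. (\<Sum>i. ?F i \<omega>) \<partial>M)"
        using poisson_locally_finite[OF PX int]
        by (intro nn_integral_cong_AE) (auto elim!: eventually_mono simp: cell_count_centred_UN[OF B(2)])
      also have "\<dots> = (\<Sum>i. \<integral>\<^sup>+\<omega>. cell_count (centred_cell_in (B i)) (X \<omega>) \<partial>M)"
        by (subst nn_integral_suminf) (auto simp: F)
      finally show "(\<Sum>i. ?\<mu> (B i)) = ?\<mu> (\<Union>i. B i)"
        by simp
    qed
    show "A \<in> sets (typical_cell_distr lex_min_vertex M ?T)"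
      using A by (simp add: typical_cell_distr_def)
  qed simp
qed

lemma sets_typical_cell_distr [simp]: "sets (typical_cell_distr z M T) = sets borel"
  using sets.sigma_sets_eq[of "borel :: 'a::euclidean_space ncompact measure"] by (simp add: typical_cell_distr_def)

lemma prob_space_typical_cell_distr:
  fixes X :: "'w \<Rightarrow> ((real ^ 'd::{finite,linorder}) \<times> real) set"
  assumes PX: "poisson_process M X (Lambda f)" and int: "intensity DIM(real ^ 'd::{finite,linorder}) f"
    and pos: "0 < (\<integral>\<^sup>+h\<in>{..h0}. ennreal (f h) \<partial>lborel)"
    and \<gamma>: "0 < (\<integral>\<^sup>+\<omega>. cell_count (centred_cell_in UNIV) (X \<omega>) \<partial>M)"
        "(\<integral>\<^sup>+\<omega>. cell_count (centred_cell_in UNIV) (X \<omega>) \<partial>M) < \<infinity>"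
  shows "prob_space (typical_cell_distr lex_min_vertex M (\<lambda>\<omega>. laguerre_diagram (X \<omega>)))"
proof (rule prob_spaceI)
  have "space (typical_cell_distr lex_min_vertex M (\<lambda>\<omega>. laguerre_diagram (X \<omega>))) = UNIV"
    using sets_eq_imp_space_eq[OF sets_typical_cell_distr] by simp
  then show "emeasure (typical_cell_distr lex_min_vertex M (\<lambda>\<omega>. laguerre_diagram (X \<omega>)))
      (space (typical_cell_distr lex_min_vertex M (\<lambda>\<omega>. laguerre_diagram (X \<omega>)))) = 1"
    using \<gamma> by (simp add: emeasure_typical_cell_distr[OF PX int pos] ennreal_divide_self)
qed

section \<open>Weak convergence from convergence on all Borel sets\<close>

text \<open>\<open>g\<close> is approximated uniformly up to \<open>1 / N\<close> by a step function
  with finitely many values \<open>k / N\<close>, whose integrals converge by assumption.\<close>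

lemma integral_tendsto_of_setwise:
  fixes g :: "'a::topological_space \<Rightarrow> real"
  assumes P: "\<And>n. prob_space (P n)" "\<And>n. sets (P n) = sets borel" and Q: "prob_space Q" "sets Q = sets borel"
    and conv: "\<And>A. A \<in> sets borel \<Longrightarrow> (\<lambda>n. measure (P n) A) \<longlonglongrightarrow> measure Q A"
    and g [measurable]: "g \<in> borel_measurable borel" and b: "\<And>x. \<bar>g x\<bar> \<le> b"
  shows "(\<lambda>n. \<integral>x. g x \<partial>P n) \<longlonglongrightarrow> (\<integral>x. g x \<partial>Q)"
proof (rule LIMSEQ_I)
  fix e :: real assume e: "0 < e"
  obtain N :: nat where N: "3 / e < real N" using reals_Archimedean2 by blast
  have N0: "0 < real N" using N e by (smt (verit) divide_pos_pos)
  define I where "I = {- \<lceil>b * N\<rceil> - 1 .. \<lceil>b * N\<rceil> + 1}"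
  define A where "A k = {x. \<lfloor>g x * N\<rfloor> = k}" for k
  have A [measurable]: "A k \<in> sets borel" for k
  proof -
    have "A k = {x \<in> space borel. \<lfloor>g x * N\<rfloor> = k}" by (simp add: A_def)
    also have "\<dots> \<in> sets borel" by measurable
    finally show ?thesis .
  qed
  define s where "s x = (\<Sum>k\<in>I. (real_of_int k / N) * indicator (A k) x)" for x
  have I: "\<lfloor>g x * N\<rfloor> \<in> I" for x
  proof -
    have "\<bar>g x * N\<bar> \<le> b * N" using b[of x] N0 by (simp add: abs_mult)
    then show ?thesis unfolding I_def by (auto simp: abs_le_iff) linarith+
  qed
  have s_eq: "s x = \<lfloor>g x * N\<rfloor> / N" for x
  proof -
    have "s x = (\<Sum>k\<in>I. if k = \<lfloor>g x * N\<rfloor> then real_of_int k / N else 0)"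
      unfolding s_def by (intro sum.cong) (auto simp: A_def indicator_def)
    also have "\<dots> = \<lfloor>g x * N\<rfloor> / N" using I[of x] by (subst sum.delta) (auto simp: I_def)
    finally show ?thesis .
  qed
  have close: "\<bar>g x - s x\<bar> \<le> 1 / N" for x
  proof -
    have "\<bar>g x * N - \<lfloor>g x * N\<rfloor>\<bar> \<le> 1" by linarith
    then have "\<bar>g x * N - \<lfloor>g x * N\<rfloor>\<bar> / N \<le> 1 / N" using N0 by (intro divide_right_mono) auto
    moreover have "g x - s x = (g x * N - \<lfloor>g x * N\<rfloor>) / N" using N0 by (simp add: s_eq field_simps)
    ultimately show ?thesis using N0 by (simp add: abs_divide)
  qed
  have ints: "(\<integral>x. s x \<partial>R) = (\<Sum>k\<in>I. (real_of_int k / N) * measure R (A k))"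
    and diff: "\<bar>(\<integral>x. g x \<partial>R) - (\<integral>x. s x \<partial>R)\<bar> \<le> 1 / N"
    if "prob_space R" and sR [measurable_cong]: "sets R = sets borel" for R
  proof -
    interpret prob_space R by fact
    have iA: "integrable R (\<lambda>x. (real_of_int k / N) * indicator (A k) x)" for k
      by (intro integrable_mult_right integrable_real_indicator) (auto simp: sR emeasure_eq_measure)
    show "(\<integral>x. s x \<partial>R) = (\<Sum>k\<in>I. (real_of_int k / N) * measure R (A k))"
      unfolding s_def using iA sets_eq_imp_space_eq[OF sR] by (subst Bochner_Integration.integral_sum) auto
    have i_s: "integrable R s" unfolding s_def by (intro Bochner_Integration.integrable_sum iA)
    have ig: "integrable R g" by (rule integrable_const_bound[where B=b]) (use b in auto)
    have "\<bar>(\<integral>x. g x \<partial>R) - (\<integral>x. s x \<partial>R)\<bar> = \<bar>\<integral>x. g x - s x \<partial>R\<bar>" using ig i_s by simp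
    also have "\<dots> \<le> (\<integral>x. \<bar>g x - s x\<bar> \<partial>R)" by (rule integral_abs_bound)
    also have "\<dots> \<le> (\<integral>x. 1 / N \<partial>R)" using ig i_s close by (intro integral_mono) auto
    finally show "\<bar>(\<integral>x. g x \<partial>R) - (\<integral>x. s x \<partial>R)\<bar> \<le> 1 / N" by (simp add: prob_space)
  qed
  have lim: "(\<lambda>n. \<integral>x. s x \<partial>P n) \<longlonglongrightarrow> (\<integral>x. s x \<partial>Q)"
    unfolding ints[OF P] ints[OF Q] by (intro tendsto_intros conv A)
  have "0 < e / 3" using e by simp
  from LIMSEQ_D[OF lim this] obtain n0 where n0: "\<And>n. n \<ge> n0 \<Longrightarrow> norm ((\<integral>x. s x \<partial>P n) - (\<integral>x. s x \<partial>Q)) < e / 3"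
    by blast
  have "1 / N < e / 3" using N N0 e by (simp add: field_simps)
  then have "norm ((\<integral>x. g x \<partial>P n) - (\<integral>x. g x \<partial>Q)) < e" if "n \<ge> n0" for n
    using n0[OF that] diff[OF P(1,2)[of n]] diff[OF Q] unfolding real_norm_def by linarith
  then show "\<exists>no. \<forall>n\<ge>no. norm ((\<integral>x. g x \<partial>P n) - (\<integral>x. g x \<partial>Q)) < e" by blast
qed

lemma weakly_converges_offset:
  assumes "weakly_converges (\<lambda>n. P (n + k)) Q"
  shows "weakly_converges P Q"
  unfolding weakly_converges_def
proof (intro conjI allI impI)
  show "\<forall>\<^sub>F n in sequentially. prob_space (P n) \<and> sets (P n) = sets borel"
    using assms eventually_sequentially_seg[of "\<lambda>n. prob_space (P n) \<and> sets (P n) = sets borel" k]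
    by (simp add: weakly_converges_def)
  fix g :: "'a \<Rightarrow> real" assume "continuous_on UNIV g \<and> bounded (range g)"
  then have "(\<lambda>n. \<integral>x. g x \<partial>P (n + k)) \<longlonglongrightarrow> (\<integral>x. g x \<partial>Q)"
    using assms by (simp add: weakly_converges_def)
  then show "(\<lambda>n. \<integral>x. g x \<partial>P n) \<longlonglongrightarrow> (\<integral>x. g x \<partial>Q)"
    by (rule LIMSEQ_offset)
qed (use assms in \<open>simp_all add: weakly_converges_def\<close>)

lemma weakly_convergesI_setwise:
  fixes P :: "nat \<Rightarrow> 'a::topological_space measure"
  assumes P: "\<forall>\<^sub>F n in sequentially. prob_space (P n)" "\<And>n. sets (P n) = sets borel"
      and Q: "prob_space Q" "sets Q = sets borel"
    and conv: "\<And>A. A \<in> sets borel \<Longrightarrow> (\<lambda>n. emeasure (P n) A) \<longlonglongrightarrow> emeasure Q A"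
  shows "weakly_converges P Q"
proof -
  obtain k where k: "\<And>n. n \<ge> k \<Longrightarrow> prob_space (P n)" using P(1) by (auto simp: eventually_sequentially)
  then have Pk: "prob_space (P (n + k))" for n by simp
  have m: "(\<lambda>n. measure (P (n + k)) A) \<longlonglongrightarrow> measure Q A" if "A \<in> sets borel" for A
  proof -
    have "(\<lambda>n. emeasure (P (n + k)) A) \<longlonglongrightarrow> emeasure Q A" using conv[OF that] by (rule LIMSEQ_ignore_initial_segment)
    then have "(\<lambda>n. enn2real (emeasure (P (n + k)) A)) \<longlonglongrightarrow> enn2real (emeasure Q A)"
      by (intro tendsto_enn2real)
          (simp_all add: finite_measure.emeasure_eq_measure[OF prob_space.finite_measure[OF Q(1)]])
    then show ?thesis by (simp add: measure_def)
  qed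
  have "weakly_converges (\<lambda>n. P (n + k)) Q"
    unfolding weakly_converges_def
  proof (intro conjI allI impI)
    fix g :: "'a \<Rightarrow> real" assume g: "continuous_on UNIV g \<and> bounded (range g)"
    then obtain b where b: "\<And>x. \<bar>g x\<bar> \<le> b" by (auto simp: bounded_iff)
    have "g \<in> borel_measurable borel" using g by (intro borel_measurable_continuous_onI) auto
    then show "(\<lambda>n. \<integral>x. g x \<partial>P (n + k)) \<longlonglongrightarrow> (\<integral>x. g x \<partial>Q)"
      by (intro integral_tendsto_of_setwise[where b=b] Pk P(2) Q m b)
  qed (use Pk P(2) Q in auto)
  then show ?thesis by (rule weakly_converges_offset)
qed

section \<open>Stationarity and positivity of the cell intensity\<close>

text \<open>The shift is by \<open>- a\<close>: a vertex in the cube with lower corner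
  \<open>a\<close> lands in the unit cube.\<close>

definition translate_config :: "'a::euclidean_space \<Rightarrow> ('a \<times> real) set \<Rightarrow> ('a \<times> real) set" where
  "translate_config a X = (\<lambda>p. (fst p - a, snd p)) ` X"

lemma points_in_translate_config:
  "points_in B (translate_config a X) = points_in {p. (fst p - a, snd p) \<in> B} X"
proof -
  let ?\<tau> = "\<lambda>p :: 'a \<times> real. (fst p - a, snd p)"
  have "translate_config a X \<inter> B = ?\<tau> ` (X \<inter> {p. ?\<tau> p \<in> B})"
    by (auto simp: translate_config_def)
  moreover have "inj_on ?\<tau> S" for S by (auto simp: inj_on_def prod_eq_iff)
  ultimately show ?thesis
    unfolding points_in_def by (simp add: emeasure_count_space finite_image_iff card_image)
qed

lemma sets_translate_vimage [measurable]:
  assumes "B \<in> sets borel"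
  shows "{p. (fst p - a, snd p) \<in> B} \<in> sets (borel :: ('a::euclidean_space \<times> real) measure)"
proof -
  have "continuous_on UNIV (\<lambda>p :: 'a \<times> real. (fst p - a, snd p))" by (intro continuous_intros)
  then have "(\<lambda>p :: 'a \<times> real. (fst p - a, snd p)) \<in> borel_measurable borel" by (rule borel_measurable_continuous_onI)
  from measurable_sets[OF this assms] show ?thesis by (simp add: vimage_def)
qed

lemma emeasure_Lambda_translate:
  fixes a :: "'a::euclidean_space"
  assumes f [measurable]: "f \<in> borel_measurable borel" and B: "B \<in> sets borel"
  shows "emeasure (Lambda f) {p. (fst p - a, snd p) \<in> B} = emeasure (Lambda f) B"
proof -
  have eq: "emeasure lborel {v. (v - a, h) \<in> B} = emeasure lborel {v. (v, h) \<in> B}" for h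
  proof -
    have m: "{v. (v, h) \<in> B} \<in> sets borel"
    proof -
      have "B \<in> sets (lborel \<Otimes>\<^sub>M lborel)" using B unfolding lborel_prod by simp
      from sets_Pair2[OF this, of h] show ?thesis by (simp add: vimage_def)
    qed
    have "emeasure lborel {v. (v, h) \<in> B} = emeasure (distr lborel borel ((+) (- a))) {v. (v, h) \<in> B}"
      by (simp add: lborel_distr_plus)
    also have "\<dots> = emeasure lborel {v. (v - a, h) \<in> B}"
      using m by (subst emeasure_distr) (auto simp: vimage_def)
    finally show ?thesis ..
  qed
  show ?thesis
    using B eq by (simp add: emeasure_Lambda sets_translate_vimage)
qed

text \<open>\<open>Lambda f\<close> is invariant under spatial shifts and preimages preserve
  disjointness, so every clause of \<open>poisson_process\<close> carries over.\<close>

lemma poisson_process_translate: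
  fixes X :: "'w \<Rightarrow> ('a::euclidean_space \<times> real) set"
  assumes PX: "poisson_process M X (Lambda f)" and f: "f \<in> borel_measurable borel"
  shows "poisson_process M (\<lambda>\<omega>. translate_config a (X \<omega>)) (Lambda f)"
proof -
  have X: "X \<in> M \<rightarrow>\<^sub>M configs" using PX sets_Lambda by (rule poisson_measurable)
  let ?V = "\<lambda>B. {p :: 'a \<times> real. (fst p - a, snd p) \<in> B}"
  have em: "emeasure (Lambda f) (?V B) = emeasure (Lambda f) B" if "B \<in> sets borel" for B
    using emeasure_Lambda_translate[OF f that] .
  then have me: "measure (Lambda f) (?V B) = measure (Lambda f) B" if "B \<in> sets borel" for B
    using that by (simp add: measure_def)
  show ?thesis
    unfolding poisson_process_def points_in_translate_config
  proof (intro conjI ballI allI impI)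
    show "prob_space M" using PX sets_Lambda by (rule poisson_prob_space)
  next
    fix \<omega> assume "\<omega> \<in> space M"
    then show "countable (translate_config a (X \<omega>))"
      using poisson_countable[OF PX sets_Lambda] by (simp add: translate_config_def)
  next
    fix B :: "('a \<times> real) set" assume "B \<in> sets (Lambda f)"
    then have B: "B \<in> sets borel" by simp
    show "(\<lambda>\<omega>. points_in (?V B) (X \<omega>)) \<in> borel_measurable M"
      using measurable_compose[OF X measurable_points_in[OF sets_translate_vimage[OF B]]] .
    show "measure M {\<omega> \<in> space M. points_in (?V B) (X \<omega>) = of_nat k} =
        measure (Lambda f) B ^ k / fact k * exp (- measure (Lambda f) B)"
      if "emeasure (Lambda f) B < \<infinity>" for k
      using PX sets_translate_vimage[OF B, of a] that em[OF B] me[OF B] by (simp add: poisson_process_def)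
    show "AE \<omega> in M. points_in (?V B) (X \<omega>) = \<infinity>" if "emeasure (Lambda f) B = \<infinity>"
      using poisson_infinite[OF PX sets_Lambda sets_translate_vimage[OF B]] em[OF B] that by simp
  next
    fix m and B :: "nat \<Rightarrow> ('a \<times> real) set"
    assume "(\<forall>i<m. B i \<in> sets (Lambda f)) \<and> disjoint_family_on B {..<m}"
    then show "prob_space.indep_vars M (\<lambda>_. borel) (\<lambda>i \<omega>. points_in (?V (B i)) (X \<omega>)) {..<m}"
      by (intro poisson_indep[OF PX sets_Lambda] sets_translate_vimage) (auto simp: disjoint_family_on_def)
  qed simp
qed

lemma laguerre_cell_translate:
  "laguerre_cell (fst p - a, snd p) (translate_config a X) = (+) (- a) ` laguerre_cell p X"
proof -
  have "w \<in> laguerre_cell (fst p - a, snd p) (translate_config a X) \<longleftrightarrow> a + w \<in> laguerre_cell p X" for w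
    by (auto simp: laguerre_cell_def translate_config_def pow_fun_def algebra_simps)
  moreover have "w \<in> (+) (- a) ` laguerre_cell p X \<longleftrightarrow> a + w \<in> laguerre_cell p X" for w
    by (auto simp: image_iff intro!: bexI[of _ "a + w"])
  ultimately show ?thesis by blast
qed

text \<open>Some cell has interior points; rounding down the coordinates of its smallest vertex
  gives the shift that brings this vertex into the unit cube. Integer shifts form a countable
  family, so almost sure statements hold for all of them at once.\<close>

lemma cell_count_translate_pos:
  fixes X :: "((real ^ 'd::{finite,linorder}) \<times> real) set"
  assumes reg: "regular_config X"
  shows "\<exists>k :: 'd \<Rightarrow> int. cell_count (centred_cell_in UNIV) (translate_config (\<chi> i. real_of_int (k i)) X) \<noteq> 0"
proof -
  obtain p where p: "p \<in> X" "interior (laguerre_cell p X) \<noteq> {}"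
    using exists_laguerre_cell_interior[OF reg] by blast
  let ?C = "laguerre_cell p X"
  have C: "compact ?C" "?C \<noteq> {}" using compact_laguerre_cell[OF reg p(1)] p(2) interior_subset[of ?C] by auto
  let ?z = "lex_min_vertex ?C {}"
  define k where "k i = \<lfloor>?z $ i\<rfloor>" for i
  let ?a = "\<chi> i. real_of_int (k i)"
  let ?C' = "(+) (- ?a) ` ?C"
  have C': "compact ?C'" "?C' \<noteq> {}" using C compact_translation[of ?C "- ?a"] by auto
  have "interior ?C' \<noteq> {}" using p(2) interior_translation[of "- ?a" ?C] by simp
  moreover have "lex_min_vertex ?C' {} = - ?a + ?z" by (rule lex_min_vertex_translate[OF C])
  moreover have "- ?a + ?z \<in> cbox 0 One"
  proof -
    have k: "real_of_int (k i) \<le> ?z $ i" "?z $ i \<le> real_of_int (k i) + 1" for i unfolding k_def by linarith+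
    show ?thesis
      unfolding mem_box
    proof
      fix b :: "real ^ 'd::{finite,linorder}" assume b: "b \<in> Basis"
      then obtain i where i: "b = axis i 1" by (auto simp: Basis_vec_def)
      have "One \<bullet> b = 1" using b by simp
      then show "0 \<bullet> b \<le> (- ?a + ?z) \<bullet> b \<and> (- ?a + ?z) \<bullet> b \<le> One \<bullet> b"
        using k[of i] by (simp add: i inner_axis)
    qed
  qed
  ultimately have "centred_cell_in UNIV ?C'"
    using C' translate_in_Rep_UNIV[OF C'] by (simp add: centred_cell_in_def)
  then have "centred_cell_in UNIV (laguerre_cell (fst p - ?a, snd p) (translate_config ?a X))"
    unfolding laguerre_cell_translate .
  moreover have "(fst p - ?a, snd p) \<in> translate_config ?a X"
    using p(1) unfolding translate_config_def by (rule imageI)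
  ultimately have "cell_count (centred_cell_in UNIV) (translate_config ?a X) \<noteq> 0"
    unfolding cell_count_def points_in_eq_0_iff by blast
  then show ?thesis by blast
qed

text \<open>Instead of invoking stationarity, the convergence result is applied to the constant sequence of a
  translate of \<open>X\<close>, which has the same intensity as \<open>X\<close>. So if the expectation vanished for the unit cube,
  it would vanish for all its integer translates.\<close>

lemma expected_cell_count_pos:
  fixes X :: "'w \<Rightarrow> ((real ^ 'd::{finite,linorder}) \<times> real) set"
  assumes PX: "poisson_process M X (Lambda f)" and int: "intensity DIM(real ^ 'd::{finite,linorder}) f"
    and pos: "0 < (\<integral>\<^sup>+h\<in>{..h0}. ennreal (f h) \<partial>lborel)"
    and r: "\<And>j. 0 \<le> r j" and t: "summable t"
    and tail: "tail_bound DIM(real ^ 'd::{finite,linorder}) (sqrt DIM(real ^ 'd::{finite,linorder})) r s t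
        (Lambda f :: ((real ^ 'd::{finite,linorder}) \<times> real) measure)"
  shows "0 < (\<integral>\<^sup>+\<omega>. cell_count (centred_cell_in UNIV) (X \<omega>) \<partial>M)"
proof (rule ccontr)
  interpret prob_space M using PX sets_Lambda by (rule poisson_prob_space)
  assume "\<not> 0 < (\<integral>\<^sup>+\<omega>. cell_count (centred_cell_in UNIV) (X \<omega>) \<partial>M)"
  then have 0: "(\<integral>\<^sup>+\<omega>. cell_count (centred_cell_in UNIV) (X \<omega>) \<partial>M) = 0" by simp
  have zero: "AE \<omega> in M. cell_count (centred_cell_in UNIV) (translate_config a (X \<omega>)) = 0" for a
  proof -
    let ?Y = "\<lambda>\<omega>. translate_config a (X \<omega>)"
    have PY: "poisson_process M ?Y (Lambda f)" by (rule poisson_process_translate[OF PX intensityD(1)[OF int]])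
    have Y [measurable]: "?Y \<in> M \<rightarrow>\<^sub>M configs" using PY sets_Lambda by (rule poisson_measurable)
    have "(\<lambda>n::nat. \<integral>\<^sup>+\<omega>. cell_count (centred_cell_in UNIV) (?Y \<omega>) \<partial>M) \<longlonglongrightarrow>
        (\<integral>\<^sup>+\<omega>. cell_count (centred_cell_in UNIV) (X \<omega>) \<partial>M)"
    proof (rule expected_cell_count_tendsto(2)[where f="\<lambda>_.
        f", OF PY int PX int _ pos centred_cell_in_hit sets_centred_laguerre_cell _ r t tail tail])
      show "(\<lambda>n. low_power_bound DIM(real ^ 'd::{finite,linorder}) (\<lambda>h. \<bar>f h - f h\<bar>) c L) \<longlonglongrightarrow> 0" for c L
        by (simp add: low_power_bound_def)
    qed auto
    then have "(\<integral>\<^sup>+\<omega>. cell_count (centred_cell_in UNIV) (?Y \<omega>) \<partial>M) = 0"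
      using 0 by (simp add: LIMSEQ_const_iff)
    moreover have "(\<integral>\<^sup>+\<omega>. (if locally_finite_config (?Y \<omega>) then cell_count (centred_cell_in UNIV) (?Y \<omega>) else 0)
        \<partial>M) = (\<integral>\<^sup>+\<omega>. cell_count (centred_cell_in UNIV) (?Y \<omega>) \<partial>M)"
      using poisson_locally_finite[OF PY int] by (intro nn_integral_cong_AE) auto
    moreover have "(\<lambda>\<omega>. if locally_finite_config (?Y \<omega>) then cell_count (centred_cell_in UNIV) (?Y \<omega>) else 0) \<in>
        borel_measurable M"
      by (rule measurable_compose[OF Y borel_measurable_cell_count[OF sets_centred_laguerre_cell]]) simp
    ultimately have "AE \<omega> in M.
        (if locally_finite_config (?Y \<omega>) then cell_count (centred_cell_in UNIV) (?Y \<omega>) else 0) = 0"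
      by (simp add: nn_integral_0_iff_AE)
    with poisson_locally_finite[OF PY int] show ?thesis by eventually_elim simp
  qed
  have "AE \<omega> in M. \<forall>k :: 'd \<Rightarrow> int.
      cell_count (centred_cell_in UNIV) (translate_config (\<chi> i. real_of_int (k i)) (X \<omega>)) = 0"
    unfolding AE_all_countable using zero by blast
  with poisson_regular_config[OF PX int pos] have "AE \<omega> in M. False"
    by eventually_elim (use cell_count_translate_pos in blast)
  then show False using ae_filter_bot by (simp add: eventually_False)
qed

text \<open>Numerator and cell intensity converge separately. The limiting intensity is positive and
  finite, so the quotient converges as well, and from some index on the typical cells have genuine
  probability distributions.\<close>

lemma typical_cell_weakly_converges:
  fixes X :: "nat \<Rightarrow> 'w \<Rightarrow> ((real ^ 'd::{finite,linorder}) \<times> real) set"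
      and Y :: "'v \<Rightarrow> ((real ^ 'd::{finite,linorder}) \<times> real) set"
  assumes PX: "\<And>n. poisson_process (M n) (X n) (Lambda (f n))"
      and intf: "\<And>n. intensity DIM(real ^ 'd::{finite,linorder}) (f n)"
    and PY: "poisson_process N Y (Lambda g)" and intg: "intensity DIM(real ^ 'd::{finite,linorder}) g"
    and conv: "\<And>c L. 0 \<le> c \<Longrightarrow> (\<lambda>n. low_power_bound DIM(real ^ 'd::{finite,linorder}) (\<lambda>h. \<bar>f n h - g h\<bar>) c L) \<longlonglongrightarrow> 0"
    and posf: "\<And>n. 0 < (\<integral>\<^sup>+h\<in>{..h0}. ennreal (f n h) \<partial>lborel)"
    and posg: "0 < (\<integral>\<^sup>+h\<in>{..h0}. ennreal (g h) \<partial>lborel)"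
    and r: "\<And>j. 0 \<le> r j" and t: "summable t"
    and tail: "\<And>n. tail_bound DIM(real ^ 'd::{finite,linorder}) (sqrt DIM(real ^ 'd::{finite,linorder})) r s t
        (Lambda (f n) :: ((real ^ 'd::{finite,linorder}) \<times> real) measure)"
      "tail_bound DIM(real ^ 'd::{finite,linorder}) (sqrt DIM(real ^ 'd::{finite,linorder})) r s t
          (Lambda g :: ((real ^ 'd::{finite,linorder}) \<times> real) measure)"
  shows "weakly_converges (\<lambda>n. typical_cell_distr lex_min_vertex (M n) (\<lambda>\<omega>. laguerre_diagram (X n \<omega>)))
    (typical_cell_distr lex_min_vertex N (\<lambda>\<omega>. laguerre_diagram (Y \<omega>)))"
proof -
  let ?En = "\<lambda>A n. \<integral>\<^sup>+\<omega>. cell_count (centred_cell_in A) (X n \<omega>) \<partial>M n"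
  let ?E = "\<lambda>A. \<integral>\<^sup>+\<omega>. cell_count (centred_cell_in A) (Y \<omega>) \<partial>N"
  note lim = expected_cell_count_tendsto[where f=f, OF PX intf PY intg conv posg centred_cell_in_hit
      sets_centred_laguerre_cell _ r t tail]
  have fin: "?E A < \<infinity>" and conv': "?En A \<longlonglongrightarrow> ?E A" if "A \<in> sets borel" for A
    using that by (intro lim; simp)+
  have \<gamma>: "0 < ?E UNIV" "?E UNIV < \<infinity>"
    using expected_cell_count_pos[OF PY intg posg r t tail(2)] fin[of UNIV] by auto
  have \<gamma>n: "\<forall>\<^sub>F n in sequentially. 0 < ?En UNIV n \<and> ?En UNIV n < \<infinity>"
    using order_tendstoD[OF conv'[of UNIV]] \<gamma> by (intro eventually_conj) auto
  show ?thesis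
  proof (rule weakly_convergesI_setwise)
    show "\<forall>\<^sub>F n in sequentially. prob_space (typical_cell_distr lex_min_vertex (M n) (\<lambda>\<omega>. laguerre_diagram (X n \<omega>)))"
      using \<gamma>n by (rule eventually_mono) (auto intro!: prob_space_typical_cell_distr[OF PX intf posf])
    show "prob_space (typical_cell_distr lex_min_vertex N (\<lambda>\<omega>. laguerre_diagram (Y \<omega>)))"
      by (rule prob_space_typical_cell_distr[OF PY intg posg \<gamma>])
    fix A :: "(real ^ 'd::{finite,linorder}) ncompact set" assume A: "A \<in> sets borel"
    have "(\<lambda>n. inverse (?En UNIV n)) \<longlonglongrightarrow> inverse (?E UNIV)"
      using continuous_on_tendsto_compose[OF continuous_on_inverse_ennreal[OF continuous_on_id, of UNIV]
          conv'[of UNIV]] by simp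
    then have "(\<lambda>n. ?En A n * inverse (?En UNIV n)) \<longlonglongrightarrow> ?E A * inverse (?E UNIV)"
      using conv'[OF A] fin[OF A] \<gamma> by (intro tendsto_mult_ennreal) (auto simp: ennreal_inverse_eq_top_iff)
    then show "(\<lambda>n. emeasure (typical_cell_distr lex_min_vertex (M n) (\<lambda>\<omega>. laguerre_diagram (X n \<omega>))) A)
        \<longlonglongrightarrow> emeasure (typical_cell_distr lex_min_vertex N (\<lambda>\<omega>. laguerre_diagram (Y \<omega>))) A"
      unfolding emeasure_typical_cell_distr[OF PX intf posf A] emeasure_typical_cell_distr[OF PY intg posg A]
          divide_ennreal_def .
  qed simp_all
qed

section \<open>Consequences of the assumptions on the intensities\<close>

definition mass_below :: "(real \<Rightarrow> real) \<Rightarrow> real \<Rightarrow> ennreal" where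
  "mass_below f x = (\<integral>\<^sup>+h\<in>{..x}. ennreal (f h) \<partial>lborel)"

definition moment_below :: "real \<Rightarrow> real \<Rightarrow> (real \<Rightarrow> real) \<Rightarrow> ennreal" where
  "moment_below p a f = (\<integral>\<^sup>+h\<in>{..a}. ennreal (\<bar>h\<bar> powr p * f h) \<partial>lborel)"

lemma mass_below_mono: "x \<le> y \<Longrightarrow> mass_below f x \<le> mass_below f y"
  unfolding mass_below_def by (intro nn_integral_mono) (auto simp: indicator_def)

lemma frac_int_1:
  assumes [measurable]: "f \<in> borel_measurable borel"
  shows "frac_int 1 f x = mass_below f x"
proof -
  have "(\<integral>\<^sup>+t\<in>{..x}. ennreal (f t * (x - t) powr (1 - 1)) \<partial>lborel) = mass_below f x"
    unfolding mass_below_def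
  proof (rule nn_integral_cong_AE)
    \<comment> \<open>At \<open>t = x\<close> the kernel is \<open>0 powr 0\<close>, which is 0
      rather than 1, so the integrands are equal only almost everywhere.\<close>
    show "AE t in lborel. ennreal (f t * (x - t) powr (1 - 1)) * indicator {..x} t =
        ennreal (f t) * indicator {..x} t"
      using AE_lborel_singleton[of x] by eventually_elim auto
  qed
  then show ?thesis by (simp add: frac_int_def)
qed

section \<open>Weights of the paraboloid regions and moments\<close>

lemma power_sum3_le:
  fixes x y z :: real
  assumes "0 \<le> x" "0 \<le> y" "0 \<le> z"
  shows "(x + y + z) ^ d \<le> 3 ^ d * (x ^ d + y ^ d + z ^ d)"
proof -
  let ?m = "max x (max y z)"
  have "(x + y + z) ^ d \<le> (3 * ?m) ^ d" using assms by (intro power_mono) auto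
  also have "\<dots> = 3 ^ d * ?m ^ d" by (rule power_mult_distrib)
  also have "?m ^ d \<le> x ^ d + y ^ d + z ^ d"
  proof -
    have "?m = x \<or> ?m = y \<or> ?m = z" by linarith
    then show ?thesis using assms by auto
  qed
  finally show ?thesis by simp
qed

text \<open>The condition on \<open>d\<close> matters at \<open>x = 0\<close>, where
  \<open>0 powr 0 = 0\<close> but \<open>0 ^ 0 = 1\<close>.\<close>

lemma sqrt_power_eq_powr: "0 < d \<Longrightarrow> 0 \<le> x \<Longrightarrow> sqrt x ^ d = x powr (real d / 2)"
  by (cases "x = 0") (auto simp: powr_half_sqrt[symmetric] powr_powr simp flip: powr_realpow)

lemma low_weight_split:
  assumes "0 \<le> c" "h \<le> L"
  shows "(2 * (c + sqrt (L - h))) ^ d \<le> 6 ^ d * (c ^ d + sqrt \<bar>L\<bar> ^ d + sqrt \<bar>h\<bar> ^ d)"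
proof -
  have "sqrt (L - h) \<le> sqrt (\<bar>L\<bar> + \<bar>h\<bar>)" by simp
  also have "\<dots> \<le> sqrt \<bar>L\<bar> + sqrt \<bar>h\<bar>" by (rule sqrt_add_le_add_sqrt) auto
  finally have "(2 * (c + sqrt (L - h))) ^ d \<le> (2 * (c + sqrt \<bar>L\<bar> + sqrt \<bar>h\<bar>)) ^ d"
    using assms by (intro power_mono) auto
  also have "\<dots> = 2 ^ d * (c + sqrt \<bar>L\<bar> + sqrt \<bar>h\<bar>) ^ d" by (rule power_mult_distrib)
  also have "\<dots> \<le> 2 ^ d * (3 ^ d * (c ^ d + sqrt \<bar>L\<bar> ^ d + sqrt \<bar>h\<bar> ^ d))"
    using assms by (intro mult_left_mono power_sum3_le) auto
  also have "\<dots> = 6 ^ d * (c ^ d + sqrt \<bar>L\<bar> ^ d + sqrt \<bar>h\<bar> ^ d)"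
    by (simp add: power_mult_distrib[symmetric])
  finally show ?thesis .
qed

text \<open>The part of the weight in \<open>low_power_bound\<close> that is bounded independently
  of \<open>h\<close>; deep points are left to the moment below \<open>a\<close>.\<close>

definition low_weight :: "nat \<Rightarrow> real \<Rightarrow> real \<Rightarrow> real \<Rightarrow> real" where
  "low_weight d c a L = 6 ^ d * (c ^ d + 2 * (1 + \<bar>a\<bar> + \<bar>L\<bar>) ^ d)"

lemma low_weight_nonneg: "0 \<le> c \<Longrightarrow> 0 \<le> low_weight d c a L"
  by (simp add: low_weight_def)

lemma sqrt_le_1_plus: "0 \<le> x \<Longrightarrow> sqrt x \<le> 1 + x" for x :: real
  by (intro real_le_lsqrt) (auto simp: power2_eq_square algebra_simps)

text \<open>If \<open>h \<le> a\<close> and \<open>1 \<le> \<bar>h\<bar>\<close>, then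
  \<open>\<bar>h\<bar> powr p\<close> absorbs the growth of order \<open>d / 2\<close>. Otherwise
  \<open>\<bar>h\<bar>\<close> is at most \<open>\<bar>a\<bar> + \<bar>L\<bar>\<close> or less than
  1.\<close>

lemma low_weight_le:
  assumes d: "0 < d" and c: "0 \<le> c" and h: "h \<le> L" and p: "real d / 2 \<le> p"
  shows "(2 * (c + sqrt (L - h))) ^ d \<le> low_weight d c a L + 6 ^ d * (\<bar>h\<bar> powr p * indicator {..a} h)"
proof -
  let ?w = "1 + \<bar>a\<bar> + \<bar>L\<bar>"
  have 1: "sqrt \<bar>L\<bar> ^ d \<le> ?w ^ d"
    using sqrt_le_1_plus[of "\<bar>L\<bar>"] by (intro power_mono) auto
  have 2: "sqrt \<bar>h\<bar> ^ d \<le> ?w ^ d + \<bar>h\<bar> powr p * indicator {..a} h"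
  proof (cases "h \<le> a \<and> 1 \<le> \<bar>h\<bar>")
    case True
    then have "sqrt \<bar>h\<bar> ^ d \<le> \<bar>h\<bar> powr p"
      using d p by (simp add: sqrt_power_eq_powr powr_mono)
    then show ?thesis using True by (simp add: add_increasing)
  next
    case False
    then have "sqrt \<bar>h\<bar> \<le> ?w"
    proof (cases "1 \<le> \<bar>h\<bar>")
      case True
      then have "\<bar>h\<bar> \<le> \<bar>a\<bar> + \<bar>L\<bar>" using False h by linarith
      then show ?thesis using sqrt_le_1_plus[of "\<bar>h\<bar>"] by simp
    next
      case False
      then have "sqrt \<bar>h\<bar> \<le> 1" by simp
      then show ?thesis by linarith
    qed
    then have "sqrt \<bar>h\<bar> ^ d \<le> ?w ^ d" by (intro power_mono) auto
    then show ?thesis by (simp add: add_increasing2)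
  qed
  have "(2 * (c + sqrt (L - h))) ^ d \<le> 6 ^ d * (c ^ d + sqrt \<bar>L\<bar> ^ d + sqrt \<bar>h\<bar> ^ d)"
    by (rule low_weight_split[OF c h])
  also have "\<dots> \<le> 6 ^ d * (c ^ d + ?w ^ d + (?w ^ d + \<bar>h\<bar> powr p * indicator {..a} h))"
    using 1 2 by (intro mult_left_mono add_mono) auto
  also have "\<dots> = low_weight d c a L + 6 ^ d * (\<bar>h\<bar> powr p * indicator {..a} h)"
    by (simp add: low_weight_def algebra_simps)
  finally show ?thesis .
qed

lemma low_power_bound_le:
  assumes [measurable]: "g \<in> borel_measurable borel" and g: "\<And>x. 0 \<le> g x"
    and d: "0 < d" and c: "0 \<le> c" and p: "real d / 2 \<le> p"
  shows "low_power_bound d g c L \<le>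
      ennreal (low_weight d c a L) * mass_below g L + ennreal (6 ^ d) * moment_below p a g"
proof -
  let ?w = "low_weight d c a L"
  have "low_power_bound d g c L \<le>
      (\<integral>\<^sup>+h. ennreal ?w * (ennreal (g h) * indicator {..L} h) +
          ennreal (6 ^ d) * (ennreal (\<bar>h\<bar> powr p * g h) * indicator {..a} h) \<partial>lborel)"
    unfolding low_power_bound_def
  proof (rule nn_integral_mono)
    fix h :: real
    show "ennreal (g h * (2 * (c + sqrt (L - h))) ^ d) * indicator {..L} h
      \<le> ennreal ?w * (ennreal (g h) * indicator {..L} h) +
          ennreal (6 ^ d) * (ennreal (\<bar>h\<bar> powr p * g h) * indicator {..a} h)"
    proof (cases "h \<le> L")
      case True
      have "g h * (2 * (c + sqrt (L - h))) ^ d \<le> g h * (?w + 6 ^ d * (\<bar>h\<bar> powr p * indicator {..a} h))"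
        by (intro mult_left_mono low_weight_le d c True p g)
      then have "ennreal (g h * (2 * (c + sqrt (L - h))) ^ d) \<le>
          ennreal (?w * g h + 6 ^ d * (\<bar>h\<bar> powr p * g h * indicator {..a} h))"
        by (intro ennreal_leI) (simp add: algebra_simps)
      also have "\<dots> = ennreal ?w * ennreal (g h) + ennreal (6 ^ d) * (ennreal (\<bar>h\<bar> powr p * g h) * indicator {..a} h)"
        using g[of h] low_weight_nonneg[OF c, of d a L] by (simp add: ennreal_mult indicator_def)
      finally show ?thesis using True by simp
    qed simp
  qed
  also have "\<dots> = ennreal ?w * mass_below g L + ennreal (6 ^ d) * moment_below p a g"
    unfolding mass_below_def moment_below_def by (simp add: nn_integral_add nn_integral_cmult)
  finally show ?thesis .
qed

lemma intensityI:
  assumes "g \<in> borel_measurable borel" "\<And>x. 0 \<le> g x" "0 < d" "real d / 2 \<le> p"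
    and "\<And>x. mass_below g x < \<infinity>" "moment_below p a g < \<infinity>"
  shows "intensity d g"
  unfolding intensity_def
proof (intro conjI allI impI)
  fix c L :: real assume "0 \<le> c"
  have "ennreal (low_weight d c a L) * mass_below g L + ennreal (6 ^ d) * moment_below p a g < \<infinity>"
    using assms(5)[of L] assms(6) by (simp add: ennreal_mult_less_top)
  then show "low_power_bound d g c L < \<infinity>"
    using low_power_bound_le[OF assms(1,2,3) \<open>0 \<le> c\<close> assms(4)] by (rule le_less_trans[rotated])
qed (use assms in auto)

text \<open>Above \<open>- H\<close> the weight is bounded and the integral of
  \<open>\<bar>f n h - g h\<bar>\<close> tends to 0. Below,
  \<open>\<bar>h\<bar> powr (d / 2)\<close> is at most
  \<open>\<bar>h\<bar> powr p * H powr - \<delta>\<close>, and the uniform moment bound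
  \<open>B\<close> makes this part small before \<open>n\<close> is chosen. This is where the moment
  exponent has to exceed \<open>d / 2\<close>.\<close>

lemma low_power_bound_tendsto_0:
  assumes f: "\<And>n. f n \<in> borel_measurable borel" "\<And>n x. 0 \<le> f n x" and g: "g \<in> borel_measurable borel" "\<And>x. 0 \<le> g x"
    and d: "0 < d" and c: "0 \<le> c" and p: "p = real d / 2 + \<delta>" "0 < \<delta>"
    and conv: "\<And>y. (\<lambda>n. mass_below (\<lambda>h. \<bar>f n h - g h\<bar>) y) \<longlonglongrightarrow> 0"
    and mom: "\<And>n. moment_below p a (f n) \<le> ennreal B" "moment_below p a g \<le> ennreal B" and B: "0 \<le> B"
  shows "(\<lambda>n. low_power_bound d (\<lambda>h. \<bar>f n h - g h\<bar>) c L) \<longlonglongrightarrow> 0"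
proof -
  note [measurable] = f(1) g(1)
  define K where "K = 6 ^ d * (c ^ d + sqrt \<bar>L\<bar> ^ d + 1)"
  have K: "0 \<le> K" using c by (simp add: K_def)
  define W where "W H = (2 * (c + sqrt (L + H))) ^ d" for H
  have bound: "low_power_bound d (\<lambda>h. \<bar>f n h - g h\<bar>) c L \<le>
      ennreal (W H) * mass_below (\<lambda>h. \<bar>f n h - g h\<bar>) L + ennreal (2 * K * B * H powr - \<delta>)"
    if H: "1 \<le> H" "- H \<le> a" "- H \<le> L" for n H
  proof -
    let ?T = "\<lambda>h. ennreal (\<bar>h\<bar> powr p * f n h) * indicator {..a} h + ennreal (\<bar>h\<bar> powr p * g h) * indicator {..a} h"
    have "low_power_bound d (\<lambda>h. \<bar>f n h - g h\<bar>) c L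
      \<le> (\<integral>\<^sup>+h. ennreal (W H) * (ennreal \<bar>f n h - g h\<bar> * indicator {..L} h) + ennreal (K * H powr - \<delta>) * ?T h \<partial>lborel)"
      unfolding low_power_bound_def
    proof (rule nn_integral_mono)
      fix h :: real
      show "ennreal (\<bar>f n h - g h\<bar> * (2 * (c + sqrt (L - h))) ^ d) * indicator {..L} h
        \<le> ennreal (W H) * (ennreal \<bar>f n h - g h\<bar> * indicator {..L} h) + ennreal (K * H powr - \<delta>) * ?T h"
      proof (cases "h \<le> L")
        case hL: True
        show ?thesis
        proof (cases "- H \<le> h")
          case True
          have "(2 * (c + sqrt (L - h))) ^ d \<le> W H"
            unfolding W_def using True c hL by (intro power_mono) auto
          then have "\<bar>f n h - g h\<bar> * (2 * (c + sqrt (L - h))) ^ d \<le> W H * \<bar>f n h - g h\<bar>"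
            by (subst mult.commute) (intro mult_right_mono, auto)
          then have "ennreal (\<bar>f n h - g h\<bar> * (2 * (c + sqrt (L - h))) ^ d) \<le> ennreal (W H) * ennreal \<bar>f n h - g h\<bar>"
            by (subst ennreal_mult''[symmetric]) (auto intro: ennreal_leI)
          then show ?thesis using hL by (simp add: add_increasing2)
        next
          case False
          then have h: "H \<le> \<bar>h\<bar>" "1 \<le> \<bar>h\<bar>" "h \<le> a" using H by auto
          have s1: "1 \<le> sqrt \<bar>h\<bar> ^ d" using h by (intro one_le_power) simp
          have "(2 * (c + sqrt (L - h))) ^ d \<le> 6 ^ d * (c ^ d + sqrt \<bar>L\<bar> ^ d + sqrt \<bar>h\<bar> ^ d)"
            by (rule low_weight_split[OF c hL])
          also have "\<dots> \<le> 6 ^ d * ((c ^ d + sqrt \<bar>L\<bar> ^ d + 1) * sqrt \<bar>h\<bar> ^ d)"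
          proof -
            have "(c ^ d + sqrt \<bar>L\<bar> ^ d) * 1 \<le> (c ^ d + sqrt \<bar>L\<bar> ^ d) * sqrt \<bar>h\<bar> ^ d"
              using s1 c by (intro mult_left_mono) auto
            then show ?thesis by (intro mult_left_mono) (auto simp: distrib_right)
          qed
          also have "\<dots> = K * \<bar>h\<bar> powr (real d / 2)"
            using d by (simp add: K_def sqrt_power_eq_powr)
          also have "\<bar>h\<bar> powr (real d / 2) = \<bar>h\<bar> powr p * \<bar>h\<bar> powr - \<delta>"
            by (simp add: p powr_add[symmetric])
          also have "K * (\<bar>h\<bar> powr p * \<bar>h\<bar> powr - \<delta>) \<le> K * (\<bar>h\<bar> powr p * H powr - \<delta>)"
            using h H p K by (intro mult_left_mono powr_mono2') auto
          finally have "(2 * (c + sqrt (L - h))) ^ d \<le> K * H powr - \<delta> * \<bar>h\<bar> powr p" by (simp add: mult_ac)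
          moreover have "\<bar>f n h - g h\<bar> \<le> f n h + g h" using f(2)[of n h] g(2)[of h] by simp
          ultimately have "\<bar>f n h - g h\<bar> * (2 * (c + sqrt (L - h))) ^ d \<le>
              (f n h + g h) * (K * H powr - \<delta> * \<bar>h\<bar> powr p)"
            using f(2)[of n h] g(2)[of h] c hL by (intro mult_mono) auto
          then have "ennreal (\<bar>f n h - g h\<bar> * (2 * (c + sqrt (L - h))) ^ d) \<le>
              ennreal (K * H powr - \<delta> * (\<bar>h\<bar> powr p * f n h + \<bar>h\<bar> powr p * g h))"
            by (intro ennreal_leI) (simp add: algebra_simps)
          also have "\<dots> = ennreal (K * H powr - \<delta>) * ?T h"
          proof -
            have "ennreal (k * (x + y)) = ennreal k * (ennreal x + ennreal y)" if "0 \<le> k" "0 \<le> x" "0 \<le> y"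
                for k x y :: real
              using that by (simp add: ennreal_mult)
            from this[of "K * H powr - \<delta>" "\<bar>h\<bar> powr p * f n h" "\<bar>h\<bar> powr p * g h"] show ?thesis
              using h K f(2)[of n h] g(2)[of h] by simp
          qed
          finally show ?thesis using hL by (simp add: add_increasing)
        qed
      qed simp
    qed
    also have "\<dots> = ennreal (W H) * mass_below (\<lambda>h. \<bar>f n h - g h\<bar>) L +
        ennreal (K * H powr - \<delta>) * (moment_below p a (f n) + moment_below p a g)"
      unfolding mass_below_def moment_below_def by (simp add: nn_integral_add nn_integral_cmult)
    also have "ennreal (K * H powr - \<delta>) * (moment_below p a (f n) + moment_below p a g) \<le>
        ennreal (K * H powr - \<delta>) * (ennreal B + ennreal B)"
      by (intro mult_left_mono add_mono mom) auto
    also have "\<dots> = ennreal (2 * K * B * H powr - \<delta>)"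
      using K B by (simp add: mult_ac flip: ennreal_plus ennreal_mult)
    finally show ?thesis by (simp add: add_left_mono)
  qed
  show ?thesis
  proof (rule tendsto_zero_ennreal)
    fix e :: real assume e: "0 < e"
    have "((\<lambda>H. 2 * K * B * H powr - \<delta>) \<longlongrightarrow> 2 * K * B * 0) at_top"
      using p(2) by (intro tendsto_intros tendsto_neg_powr filterlim_ident) auto
    then have "\<forall>\<^sub>F H in at_top. 2 * K * B * H powr - \<delta> < e / 2"
      using e by (intro order_tendstoD) auto
    moreover have "\<forall>\<^sub>F H in at_top. 1 \<le> H \<and> - H \<le> a \<and> - H \<le> L"
      using eventually_ge_at_top[of "max 1 (max (- a) (- L))"] by (rule eventually_mono) auto
    ultimately have "\<forall>\<^sub>F H in at_top. 2 * K * B * H powr - \<delta> < e / 2 \<and> 1 \<le> H \<and> - H \<le> a \<and> - H \<le> L"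
      by (rule eventually_conj)
    then obtain H where H: "2 * K * B * H powr - \<delta> < e / 2" "1 \<le> H" "- H \<le> a" "- H \<le> L"
      by (auto simp: eventually_at_top_linorder)
    have "(\<lambda>n. ennreal (W H) * mass_below (\<lambda>h. \<bar>f n h - g h\<bar>) L) \<longlonglongrightarrow> ennreal (W H) * 0"
      by (intro tendsto_mult_ennreal tendsto_const conv) auto
    then have "\<forall>\<^sub>F n in sequentially. ennreal (W H) * mass_below (\<lambda>h. \<bar>f n h - g h\<bar>) L < ennreal (e / 2)"
      using e by (intro order_tendstoD) auto
    then show "\<forall>\<^sub>F n in sequentially. low_power_bound d (\<lambda>h. \<bar>f n h - g h\<bar>) c L < ennreal e"
    proof (rule eventually_mono)
      fix n assume *: "ennreal (W H) * mass_below (\<lambda>h. \<bar>f n h - g h\<bar>) L < ennreal (e / 2)"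
      have "low_power_bound d (\<lambda>h. \<bar>f n h - g h\<bar>) c L \<le>
          ennreal (W H) * mass_below (\<lambda>h. \<bar>f n h - g h\<bar>) L + ennreal (2 * K * B * H powr - \<delta>)"
        by (rule bound[OF H(2-4)])
      also have "\<dots> < ennreal (e / 2) + ennreal (e / 2)"
        using * H(1) e by (intro add_strict_mono ennreal_lessI) auto
      also have "\<dots> = ennreal e" using e by (simp flip: ennreal_plus)
      finally show "low_power_bound d (\<lambda>h. \<bar>f n h - g h\<bar>) c L < ennreal e" .
    qed
  qed
qed

text \<open>On \<open>{- H..a}\<close> the weight is bounded, so convergence of the integrals of
  \<open>\<bar>f n h - g h\<bar>\<close> transfers the bound there. Letting \<open>H\<close> grow,
  monotone convergence gives the full moment: a Fatou argument without pointwise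
  convergence.\<close>

lemma moment_below_limit:
  assumes f: "\<And>n. f n \<in> borel_measurable borel" "\<And>n x. 0 \<le> f n x" and g: "g \<in> borel_measurable borel" "\<And>x. 0 \<le> g x"
    and p: "0 \<le> p" and conv: "(\<lambda>n. mass_below (\<lambda>h. \<bar>f n h - g h\<bar>) a) \<longlonglongrightarrow> 0"
    and mom: "\<And>n. moment_below p a (f n) \<le> B"
  shows "moment_below p a g \<le> B"
proof -
  note [measurable] = f(1) g(1)
  let ?u = "\<lambda>H h. ennreal (\<bar>h\<bar> powr p * g h) * indicator {- real H..a} h"
  have "moment_below p a g = (\<integral>\<^sup>+h. (SUP H. ?u H h) \<partial>lborel)"
    unfolding moment_below_def
  proof (rule nn_integral_cong, rule antisym)
    fix h :: real
    obtain H :: nat where "- h \<le> real H" using real_arch_simple by blast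
    then have "ennreal (\<bar>h\<bar> powr p * g h) * indicator {..a} h \<le> ?u H h" by (auto simp: indicator_def)
    also have "\<dots> \<le> (SUP H. ?u H h)" by (rule SUP_upper) simp
    finally show "ennreal (\<bar>h\<bar> powr p * g h) * indicator {..a} h \<le> (SUP H. ?u H h)" .
    show "(SUP H. ?u H h) \<le> ennreal (\<bar>h\<bar> powr p * g h) * indicator {..a} h"
      by (rule SUP_least) (auto simp: indicator_def)
  qed
  also have "\<dots> = (SUP H. \<integral>\<^sup>+h. ?u H h \<partial>lborel)"
    by (intro nn_integral_monotone_convergence_SUP) (auto simp: incseq_def le_fun_def indicator_def)
  also have "\<dots> \<le> B"
  proof (rule SUP_least)
    fix H :: nat
    let ?M = "(\<bar>a\<bar> + real H) powr p"
    have le: "(\<integral>\<^sup>+h. ?u H h \<partial>lborel) \<le> B + ennreal ?M * mass_below (\<lambda>h. \<bar>f n h - g h\<bar>) a" for n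
    proof -
      have "(\<integral>\<^sup>+h. ?u H h \<partial>lborel) \<le>
          (\<integral>\<^sup>+h. ennreal (\<bar>h\<bar> powr p * f n h) * indicator {..a} h +
              ennreal ?M * (ennreal \<bar>f n h - g h\<bar> * indicator {..a} h) \<partial>lborel)"
      proof (rule nn_integral_mono)
        fix h :: real
        show "?u H h \<le> ennreal (\<bar>h\<bar> powr p * f n h) * indicator {..a} h +
            ennreal ?M * (ennreal \<bar>f n h - g h\<bar> * indicator {..a} h)"
        proof (cases "- real H \<le> h \<and> h \<le> a")
          case True
          have "\<bar>h\<bar> powr p \<le> ?M" using True p by (intro powr_mono2) auto
          then have "\<bar>h\<bar> powr p * \<bar>f n h - g h\<bar> \<le> ?M * \<bar>f n h - g h\<bar>" by (intro mult_right_mono) auto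
          moreover have "\<bar>h\<bar> powr p * g h \<le> \<bar>h\<bar> powr p * (f n h + \<bar>f n h - g h\<bar>)" by (intro mult_left_mono) auto
          ultimately have "\<bar>h\<bar> powr p * g h \<le> \<bar>h\<bar> powr p * f n h + ?M * \<bar>f n h - g h\<bar>" by (simp add: distrib_left)
          then have "ennreal (\<bar>h\<bar> powr p * g h) \<le> ennreal (\<bar>h\<bar> powr p * f n h) + ennreal ?M * ennreal \<bar>f n h - g h\<bar>"
            using f(2)[of n h] by (simp add: ennreal_leI flip: ennreal_plus ennreal_mult)
          then show ?thesis using True by simp
        qed auto
      qed
      also have "\<dots> = moment_below p a (f n) + ennreal ?M * mass_below (\<lambda>h. \<bar>f n h - g h\<bar>) a"
        unfolding mass_below_def moment_below_def by (simp add: nn_integral_add nn_integral_cmult)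
      finally show ?thesis using mom[of n] by (meson add_right_mono order_trans)
    qed
    have "(\<lambda>n. B + ennreal ?M * mass_below (\<lambda>h. \<bar>f n h - g h\<bar>) a) \<longlonglongrightarrow> B + ennreal ?M * 0"
      by (intro tendsto_add tendsto_const tendsto_mult_ennreal conv) auto
    then show "(\<integral>\<^sup>+h. ?u H h \<partial>lborel) \<le> B"
      using le by (intro LIMSEQ_le_const) auto
  qed
  finally show ?thesis .
qed

lemma mass_below_diff_le:
  assumes [measurable]: "f \<in> borel_measurable borel" "g \<in> borel_measurable borel" and g: "\<And>x. 0 \<le> g x"
  shows "mass_below f x \<le> mass_below g x + mass_below (\<lambda>h. \<bar>f h - g h\<bar>) x"
proof -
  have "mass_below f x \<le> (\<integral>\<^sup>+h. ennreal (g h) * indicator {..x} h + ennreal \<bar>f h - g h\<bar> * indicator {..x} h \<partial>lborel)"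
    unfolding mass_below_def
  proof (rule nn_integral_mono)
    fix h
    have "ennreal (f h) \<le> ennreal (g h) + ennreal \<bar>f h - g h\<bar>"
      using g[of h] by (simp add: ennreal_leI flip: ennreal_plus)
    then show "ennreal (f h) * indicator {..x} h \<le>
        ennreal (g h) * indicator {..x} h + ennreal \<bar>f h - g h\<bar> * indicator {..x} h"
      by (auto simp: indicator_def)
  qed
  also have "\<dots> = mass_below g x + mass_below (\<lambda>h. \<bar>f h - g h\<bar>) x"
    unfolding mass_below_def by (rule nn_integral_add) auto
  finally show ?thesis .
qed

lemma mass_below_tendsto:
  assumes f: "\<And>n. f n \<in> borel_measurable borel" "\<And>n x. 0 \<le> f n x" and g: "g \<in> borel_measurable borel" "\<And>x. 0 \<le> g x"
    and conv: "(\<lambda>n. mass_below (\<lambda>h. \<bar>f n h - g h\<bar>) x) \<longlonglongrightarrow> 0" and fin: "mass_below g x < \<infinity>"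
  shows "(\<lambda>n. mass_below (f n) x) \<longlonglongrightarrow> mass_below g x"
proof -
  let ?D = "\<lambda>n. mass_below (\<lambda>h. \<bar>f n h - g h\<bar>) x"
  have 1: "mass_below (f n) x \<le> mass_below g x + ?D n" for n
    by (rule mass_below_diff_le[OF f(1) g])
  have 2: "mass_below g x \<le> mass_below (f n) x + ?D n" for n
    using mass_below_diff_le[OF g(1) f(1) f(2), of x n] by (simp add: abs_minus_commute)
  show ?thesis
  proof (rule tendsto_sandwich)
    show "\<forall>\<^sub>F n in sequentially. mass_below g x - ?D n \<le> mass_below (f n) x"
      using 2 fin by (intro always_eventually allI) (auto simp: ennreal_minus_le_iff add.commute)
    show "\<forall>\<^sub>F n in sequentially. mass_below (f n) x \<le> mass_below g x + ?D n"
      using 1 by simp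
    have "(\<lambda>n. mass_below g x - ?D n) \<longlonglongrightarrow> mass_below g x - 0"
      using fin by (intro tendsto_diff_ennreal tendsto_const conv) auto
    then show "(\<lambda>n. mass_below g x - ?D n) \<longlonglongrightarrow> mass_below g x" by simp
    have "(\<lambda>n. mass_below g x + ?D n) \<longlonglongrightarrow> mass_below g x + 0"
      by (intro tendsto_add tendsto_const conv)
    then show "(\<lambda>n. mass_below g x + ?D n) \<longlonglongrightarrow> mass_below g x" by simp
  qed
qed

text \<open>Choose \<open>k\<close> with \<open>real m + 2 \<le> real k * \<epsilon>\<close>. Since
  \<open>exp u\<close> eventually dominates \<open>u ^ k\<close>, the terms are eventually below a
  multiple of \<open>1 / (real j + 1) ^ 2\<close>.\<close>

lemma summable_power_exp_powr:
  fixes K \<beta> \<epsilon> :: real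
  assumes \<beta>: "0 < \<beta>" and \<epsilon>: "0 < \<epsilon>"
  shows "summable (\<lambda>j. K * (real j + 1) ^ m * exp (- \<beta> * (real j + 1) powr \<epsilon>))"
proof -
  obtain k :: nat where k: "(real m + 2) / \<epsilon> \<le> real k" using real_arch_simple by blast
  have k': "real m + 2 \<le> real k * \<epsilon>" using k \<epsilon> by (simp add: field_simps)
  have "filterlim (\<lambda>j. (real j + 1) powr \<epsilon>) at_top sequentially"
    using \<epsilon> by real_asymp
  then have "filterlim (\<lambda>j. \<beta> * (real j + 1) powr \<epsilon>) at_top sequentially"
    using \<beta> by (intro filterlim_tendsto_pos_mult_at_top[OF tendsto_const])
  then have "(\<lambda>j. (\<beta> * (real j + 1) powr \<epsilon>) ^ k / exp (\<beta> * (real j + 1) powr \<epsilon>)) \<longlonglongrightarrow> 0"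
    by (rule filterlim_compose[OF tendsto_power_div_exp_0])
  then have "\<forall>\<^sub>F j in sequentially. (\<beta> * (real j + 1) powr \<epsilon>) ^ k / exp (\<beta> * (real j + 1) powr \<epsilon>) < 1"
    by (rule order_tendstoD) simp
  then have ev: "\<forall>\<^sub>F j in sequentially. norm (K * (real j + 1) ^ m * exp (- \<beta> * (real j + 1) powr \<epsilon>)) \<le>
      \<bar>K\<bar> / \<beta> ^ k * (1 / (real j + 1) ^ 2)"
  proof (rule eventually_mono)
    fix j :: nat
    let ?u = "real j + 1"
    assume "(\<beta> * ?u powr \<epsilon>) ^ k / exp (\<beta> * ?u powr \<epsilon>) < 1"
    then have "(\<beta> * ?u powr \<epsilon>) ^ k \<le> exp (\<beta> * ?u powr \<epsilon>)" by (simp add: divide_less_eq)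
    moreover have "\<beta> ^ k * ?u ^ (m + 2) \<le> (\<beta> * ?u powr \<epsilon>) ^ k"
    proof -
      have "?u ^ (m + 2) = ?u powr (real m + 2)" by (subst powr_realpow[symmetric]) (auto simp: add.commute)
      also have "\<dots> \<le> ?u powr (real k * \<epsilon>)" using k' by (intro powr_mono) auto
      also have "\<dots> = (?u powr \<epsilon>) ^ k"
        by (subst powr_realpow[symmetric]) (auto simp: powr_powr mult.commute)
      finally show ?thesis using \<beta> by (simp add: power_mult_distrib)
    qed
    ultimately have le: "\<beta> ^ k * ?u ^ (m + 2) \<le> exp (\<beta> * ?u powr \<epsilon>)" by linarith
    have "exp (- \<beta> * ?u powr \<epsilon>) = 1 / exp (\<beta> * ?u powr \<epsilon>)" by (simp add: exp_minus divide_inverse)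
    also have "\<dots> \<le> 1 / (\<beta> ^ k * ?u ^ (m + 2))"
      using le \<beta> by (intro divide_left_mono) auto
    finally have "\<bar>K\<bar> * ?u ^ m * exp (- \<beta> * ?u powr \<epsilon>) \<le> \<bar>K\<bar> * ?u ^ m * (1 / (\<beta> ^ k * ?u ^ (m + 2)))"
      by (intro mult_left_mono) auto
    also have "\<dots> = \<bar>K\<bar> / \<beta> ^ k * (1 / ?u ^ 2)"
    proof -
      have "?u ^ m \<noteq> 0" by simp
      then show ?thesis unfolding power_add by simp
    qed
    finally show "norm (K * ?u ^ m * exp (- \<beta> * ?u powr \<epsilon>)) \<le> \<bar>K\<bar> / \<beta> ^ k * (1 / ?u ^ 2)"
      by (simp add: abs_mult)
  qed
  have "summable (\<lambda>j. 1 / (real j + 1) ^ 2)"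
    using inverse_squares_sums by (simp add: sums_iff add.commute)
  then have "summable (\<lambda>j. \<bar>K\<bar> / \<beta> ^ k * (1 / (real j + 1) ^ 2))" by (rule summable_mult)
  then show ?thesis by (rule summable_comparison_test_ev[OF ev])
qed

section \<open>Summable tail bounds under the two growth conditions\<close>

lemma measure_low_power_le:
  assumes g: "g \<in> borel_measurable borel" "\<And>x. 0 \<le> g x" and c: "0 \<le> c" and p: "real DIM('a) / 2 \<le> p"
    and m: "mass_below g L \<le> ennreal m" "0 \<le> m" and B: "moment_below p a g \<le> ennreal B" "0 \<le> B"
  shows "measure (Lambda g) (low_power c L :: ('a::euclidean_space \<times> real) set) \<le>
      low_weight DIM('a) c a L * m + 6 ^ DIM('a) * B"
proof -
  let ?w = "low_weight DIM('a) c a L"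
  have w: "0 \<le> ?w" using c by (rule low_weight_nonneg)
  have "emeasure (Lambda g) (low_power c L :: ('a \<times> real) set) \<le> low_power_bound DIM('a) g c L"
    by (rule emeasure_Lambda_low_power_le[OF g c])
  also have "\<dots> \<le> ennreal ?w * mass_below g L + ennreal (6 ^ DIM('a)) * moment_below p a g"
    by (rule low_power_bound_le[OF g _ c p]) simp
  also have "\<dots> \<le> ennreal ?w * ennreal m + ennreal (6 ^ DIM('a)) * ennreal B"
    by (intro add_mono mult_left_mono m B) auto
  also have "\<dots> = ennreal (?w * m + 6 ^ DIM('a) * B)"
    using w m B by (simp add: ennreal_mult)
  finally show ?thesis
    unfolding measure_def using w m B by (intro enn2real_leI) auto
qed

lemma measure_column_eq:
  assumes "g \<in> borel_measurable borel" "0 \<le> r"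
  shows "measure (Lambda g) (column_below r s :: ('a::euclidean_space \<times> real) set) =
      (2 * r) ^ DIM('a) * enn2real (mass_below g s)"
  using assms by (simp add: measure_def emeasure_Lambda_column mass_below_def enn2real_mult)

text \<open>Boxes of half-width 1 and top \<open>j0 + j\<close>, for condition (i). With
  \<open>y j\<close> the mass below \<open>j0 + j\<close>, the doubling property bounds the
  paraboloid region of the next box by a multiple of
  \<open>(real j + 1) ^ DIM('a) * (1 + y j)\<close>, against a void probability of at most
  \<open>exp (- y j)\<close>. The lower bound on \<open>y j\<close> gives the stretched exponential
  in \<open>t\<close>.\<close>

lemma tail_bound_growth:
  fixes j0 :: nat
  assumes g: "g \<in> borel_measurable borel" "\<And>x. 0 \<le> g x" and p: "real DIM('a) / 2 \<le> p"
    and B: "moment_below p a g \<le> ennreal B" "0 \<le> B" and fin: "\<And>x. mass_below g x < \<infinity>"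
    and C: "0 < C" and \<alpha>: "0 < \<alpha>" and \<epsilon>: "0 < \<epsilon>" and j0: "1 \<le> j0"
    and dbl: "\<And>j. mass_below g (real (j0 + j) + 4 * real DIM('a) + 2) \<le> ennreal C * mass_below g (real (j0 + j))"
    and low: "\<And>j. ennreal (\<alpha> * real (j0 + j) powr \<epsilon>) \<le> mass_below g (real (j0 + j))"
  shows "tail_bound DIM('a) (sqrt DIM('a)) (\<lambda>_. 1) (\<lambda>j. real (j0 + j))
    (\<lambda>j. 2 * (6 ^ DIM('a) * (sqrt DIM('a) ^ DIM('a) + 2 * (2 + \<bar>a\<bar> + 4 * DIM('a) + j0) ^ DIM('a)) * C +
        6 ^ DIM('a) * B) * (real j + 1) ^ DIM('a) *
      exp (- (\<alpha> / 2) * (real j + 1) powr \<epsilon>))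
    (Lambda g :: ('a::euclidean_space \<times> real) measure)"
proof -
  let ?d = "DIM('a)"
  let ?w = "6 ^ ?d * (sqrt ?d ^ ?d + 2 * (2 + \<bar>a\<bar> + 4 * ?d + j0) ^ ?d) :: real"
  define y where "y j = enn2real (mass_below g (real (j0 + j)))" for j
  have y: "mass_below g (real (j0 + j)) = ennreal (y j)" "0 \<le> y j" for j
    using fin by (auto simp: y_def)
  have y_low: "\<alpha> * (real j + 1) powr \<epsilon> \<le> y j" for j
  proof -
    \<comment> \<open>\<open>j0 \<ge> 1\<close> allows \<open>j + 1\<close> in place of
      \<open>j0 + j\<close>.\<close>
    have "\<alpha> * (real j + 1) powr \<epsilon> \<le> \<alpha> * real (j0 + j) powr \<epsilon>"
      using \<alpha> \<epsilon> j0 by (intro mult_left_mono powr_mono2) auto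
    also have "\<dots> \<le> y j" using low[of j] y(2)[of j] unfolding y(1) by simp
    finally show ?thesis .
  qed
  have col: "measure (Lambda g) (column_below 1 (real (j0 + j)) :: ('a \<times> real) set) = 2 ^ ?d * y j" for j
    using g by (simp add: measure_column_eq y_def)
  have y_col: "y j \<le> 2 ^ ?d * y j" for j
    using mult_right_mono[OF one_le_power[of "2::real" ?d] y(2)[of j]] by simp
  show ?thesis
    unfolding tail_bound_def col
  proof (intro conjI allI)
    have "filterlim (\<lambda>j. \<alpha> * (real j + 1) powr \<epsilon>) at_top sequentially"
      using \<epsilon> \<alpha> by real_asymp
    then show "filterlim (\<lambda>j. 2 ^ ?d * y j) at_top sequentially"
      by (rule filterlim_at_top_mono) (intro always_eventually allI order_trans[OF y_low y_col])
    fix j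
    let ?L = "(sqrt ?d + sqrt ?d * 1)\<^sup>2 + real (j0 + Suc j)"
    have L: "?L = 4 * real ?d + real j0 + real j + 1" by (simp add: power2_eq_square algebra_simps)
    have "mass_below g ?L \<le> mass_below g (real (j0 + j) + 4 * real ?d + 2)"
      unfolding L by (rule mass_below_mono) simp
    also have "\<dots> \<le> ennreal (C * y j)" using dbl[of j] C y by (simp add: ennreal_mult)
    finally have "measure (Lambda g) (low_power (sqrt ?d) ?L :: ('a \<times> real) set) \<le>
        low_weight ?d (sqrt ?d) a ?L * (C * y j) + 6 ^ ?d * B"
      using C y by (intro measure_low_power_le[OF g _ p _ _ B]) auto
    also have "low_weight ?d (sqrt ?d) a ?L \<le> ?w * (real j + 1) ^ ?d"
    proof -
      have 1: "1 \<le> (real j + 1) ^ ?d" by (rule one_le_power) simp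
      have "1 + \<bar>a\<bar> + \<bar>?L\<bar> \<le> (2 + \<bar>a\<bar> + 4 * ?d + j0) * (real j + 1)"
        unfolding L by (simp add: algebra_simps add_increasing)
      then have "(1 + \<bar>a\<bar> + \<bar>?L\<bar>) ^ ?d \<le> ((2 + \<bar>a\<bar> + 4 * ?d + j0) * (real j + 1)) ^ ?d"
        by (intro power_mono) auto
      also have "\<dots> = (2 + \<bar>a\<bar> + 4 * ?d + j0) ^ ?d * (real j + 1) ^ ?d" by (rule power_mult_distrib)
      finally have "sqrt ?d ^ ?d * 1 + 2 * (1 + \<bar>a\<bar> + \<bar>?L\<bar>) ^ ?d \<le>
          sqrt ?d ^ ?d * (real j + 1) ^ ?d + 2 * ((2 + \<bar>a\<bar> + 4 * ?d + j0) ^ ?d * (real j + 1) ^ ?d)"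
        using 1 by (intro add_mono mult_left_mono) auto
      then have "low_weight ?d (sqrt ?d) a ?L \<le>
          6 ^ ?d * (sqrt ?d ^ ?d * (real j + 1) ^ ?d + 2 * ((2 + \<bar>a\<bar> + 4 * ?d + j0) ^ ?d * (real j + 1) ^ ?d))"
        unfolding low_weight_def by (intro mult_left_mono) auto
      then show ?thesis by (simp add: algebra_simps)
    qed
    also have "?w * (real j + 1) ^ ?d * (C * y j) + 6 ^ ?d * B \<le>
        (?w * C + 6 ^ ?d * B) * (real j + 1) ^ ?d * (1 + y j)"
    proof -
      have 1: "1 \<le> (real j + 1) ^ ?d" by (rule one_le_power) simp
      have 2: "0 \<le> ?w" by simp
      have "?w * (real j + 1) ^ ?d * (C * y j) \<le> ?w * C * (real j + 1) ^ ?d * (1 + y j)"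
        using 2 C y(2)[of j] by (simp add: algebra_simps)
      moreover have "6 ^ ?d * B * 1 \<le> 6 ^ ?d * B * ((real j + 1) ^ ?d * (1 + y j))"
        using 1 y(2)[of j] B mult_mono[OF 1, of 1 "1 + y j"] by (intro mult_left_mono) auto
      ultimately show ?thesis by (simp add: algebra_simps)
    qed
    finally have "measure (Lambda g) (low_power (sqrt ?d) ?L :: ('a \<times> real) set) * exp (- (2 ^ ?d * y j))
        \<le> (?w * C + 6 ^ ?d * B) * (real j + 1) ^ ?d * (1 + y j) * exp (- y j)"
      using C y y_col[of j] B
      by (intro mult_mono mult_nonneg_nonneg add_nonneg_nonneg) (auto intro: mult_right_mono)
    \<comment> \<open>Half of the exponent is spent on absorbing the factor \<open>1 + y j\<close>;
      this is the origin of \<open>\<alpha> / 2\<close>.\<close>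
    also have "(1 + y j) * exp (- y j) \<le> 2 * exp (- (\<alpha> / 2) * (real j + 1) powr \<epsilon>)"
    proof -
      have "1 + y j \<le> 2 * exp (y j / 2)"
        using exp_ge_add_one_self[of "y j / 2"] by linarith
      then have "(1 + y j) * exp (- y j) \<le> 2 * exp (y j / 2) * exp (- y j)" by (intro mult_right_mono) auto
      also have "\<dots> = 2 * exp (- (y j / 2))" by (simp add: mult.assoc flip: exp_add)
      also have "\<dots> \<le> 2 * exp (- (\<alpha> / 2) * (real j + 1) powr \<epsilon>)" using y_low[of j] by simp
      finally show ?thesis .
    qed
    then have "(?w * C + 6 ^ ?d * B) * (real j + 1) ^ ?d * ((1 + y j) * exp (- y j))
        \<le> (?w * C + 6 ^ ?d * B) * (real j + 1) ^ ?d * (2 * exp (- (\<alpha> / 2) * (real j + 1) powr \<epsilon>))"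
      using C B by (intro mult_left_mono) auto
    then have "(?w * C + 6 ^ ?d * B) * (real j + 1) ^ ?d * (1 + y j) * exp (- y j)
        \<le> 2 * (?w * C + 6 ^ ?d * B) * (real j + 1) ^ ?d * exp (- (\<alpha> / 2) * (real j + 1) powr \<epsilon>)"
      by (simp only: mult_ac)
    finally show "measure (Lambda g) (low_power (sqrt ?d) ?L :: ('a \<times> real) set) * exp (- (2 ^ ?d * y j))
        \<le> 2 * (?w * C + 6 ^ ?d * B) * (real j + 1) ^ ?d * exp (- (\<alpha> / 2) * (real j + 1) powr \<epsilon>)" .
  qed
qed

text \<open>Boxes of half-width \<open>j + 1\<close> and fixed top \<open>1 / 2\<close>, for
  condition (ii). Their intensity is at least \<open>\<kappa> * (j + 1)\<close>, while the level of
  the next paraboloid region is \<open>d * (j + 3) ^ 2 + 1 / 2\<close>. The square causes the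
  exponent \<open>2 * d\<close>, and \<open>(j + 3) ^ 2 \<le> 9 * (j + 1) ^ 2\<close> the constant
  9.\<close>

lemma tail_bound_finite_mass:
  assumes g: "g \<in> borel_measurable borel" "\<And>x. 0 \<le> g x" and p: "real DIM('a) / 2 \<le> p"
    and B: "moment_below p a g \<le> ennreal B" "0 \<le> B"
    and A: "\<And>x. mass_below g x \<le> ennreal A" "0 \<le> A"
    and \<kappa>: "0 < \<kappa>" "ennreal \<kappa> \<le> mass_below g (1 / 2)"
  shows "tail_bound DIM('a) (sqrt DIM('a)) (\<lambda>j. real j + 1) (\<lambda>j. 1 / 2)
    (\<lambda>j. (6 ^ DIM('a) * (sqrt DIM('a) ^ DIM('a) + 2 * (2 + \<bar>a\<bar> + 9 * DIM('a)) ^ DIM('a)) * A +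
        6 ^ DIM('a) * B) * (real j + 1) ^ (2 * DIM('a)) *
      exp (- \<kappa> * (real j + 1) powr 1))
    (Lambda g :: ('a::euclidean_space \<times> real) measure)"
proof -
  let ?d = "DIM('a)"
  let ?w = "6 ^ ?d * (sqrt ?d ^ ?d + 2 * (2 + \<bar>a\<bar> + 9 * ?d) ^ ?d) :: real"
  define y where "y = enn2real (mass_below g (1 / 2))"
  have "mass_below g (1 / 2) < \<infinity>" using A(1)[of "1 / 2"] by (rule le_less_trans) simp
  then have "ennreal y = mass_below g (1 / 2)" by (simp add: y_def)
  then have y: "\<kappa> \<le> y" using \<kappa>(2) by (simp add: y_def flip: ennreal_le_iff)
  have col: "measure (Lambda g) (column_below (real j + 1) (1 / 2) :: ('a \<times> real) set) =
      (2 * (real j + 1)) ^ ?d * y" for j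
    using g by (simp add: measure_column_eq y_def)
  have col_ge: "\<kappa> * (real j + 1) \<le> (2 * (real j + 1)) ^ ?d * y" for j
  proof -
    have "real j + 1 \<le> (2 * (real j + 1)) ^ 1" by simp
    also have "\<dots> \<le> (2 * (real j + 1)) ^ ?d" using DIM_positive[where 'a='a]
        by (intro power_increasing) (auto simp: Suc_le_eq)
    finally have "(real j + 1) * \<kappa> \<le> (2 * (real j + 1)) ^ ?d * y" using y \<kappa>(1) by (intro mult_mono) auto
    then show ?thesis by (simp add: mult.commute)
  qed
  show ?thesis
    unfolding tail_bound_def col
  proof (intro conjI allI)
    have "filterlim (\<lambda>j. \<kappa> * (real j + 1)) at_top sequentially"
      using \<kappa>(1) by real_asymp
    then show "filterlim (\<lambda>j. (2 * (real j + 1)) ^ ?d * y) at_top sequentially"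
      by (rule filterlim_at_top_mono) (use col_ge in auto)
    fix j
    let ?L = "(sqrt ?d + sqrt ?d * (real (Suc j) + 1))\<^sup>2 + 1 / 2"
    have "?L = (sqrt ?d * (real j + 3))\<^sup>2 + 1 / 2" by (simp add: algebra_simps)
    then have L: "?L = real ?d * (real j + 3)\<^sup>2 + 1 / 2" by (simp add: power_mult_distrib)
    have "measure (Lambda g) (low_power (sqrt ?d) ?L :: ('a \<times> real) set) \<le>
        low_weight ?d (sqrt ?d) a ?L * A + 6 ^ ?d * B"
      by (intro measure_low_power_le[OF g _ p A B]) auto
    also have "low_weight ?d (sqrt ?d) a ?L \<le> ?w * (real j + 1) ^ (2 * ?d)"
    proof -
      have 1: "1 \<le> (real j + 1) ^ (2 * ?d)" by (rule one_le_power) simp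
      have 2: "1 \<le> (real j + 1)\<^sup>2" by (rule one_le_power) simp
      have "(real j + 3)\<^sup>2 \<le> (3 * (real j + 1))\<^sup>2" by (intro power_mono) auto
      also have "\<dots> = 9 * (real j + 1)\<^sup>2" by (simp only: power_mult_distrib) simp
      finally have 3: "real ?d * (real j + 3)\<^sup>2 \<le> real ?d * (9 * (real j + 1)\<^sup>2)"
        by (rule mult_left_mono) simp
      have "(2 + \<bar>a\<bar>) * 1 \<le> (2 + \<bar>a\<bar>) * (real j + 1)\<^sup>2" using 2 by (intro mult_left_mono) auto
      then have 4: "2 + \<bar>a\<bar> \<le> (2 + \<bar>a\<bar>) * (real j + 1)\<^sup>2" by (simp only: mult_1_right)
      have absL: "\<bar>?L\<bar> = real ?d * (real j + 3)\<^sup>2 + 1 / 2" unfolding L by simp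
      have "(2 + \<bar>a\<bar> + 9 * ?d) * (real j + 1)\<^sup>2 = (2 + \<bar>a\<bar>) * (real j + 1)\<^sup>2 + real ?d * (9 * (real j + 1)\<^sup>2)"
        by (simp add: algebra_simps)
      with 3 4 have "1 + \<bar>a\<bar> + \<bar>?L\<bar> \<le> (2 + \<bar>a\<bar> + 9 * ?d) * (real j + 1)\<^sup>2"
        unfolding absL by linarith
      then have "(1 + \<bar>a\<bar> + \<bar>?L\<bar>) ^ ?d \<le> ((2 + \<bar>a\<bar> + 9 * ?d) * (real j + 1)\<^sup>2) ^ ?d"
        by (intro power_mono) auto
      also have "\<dots> = (2 + \<bar>a\<bar> + 9 * ?d) ^ ?d * (real j + 1) ^ (2 * ?d)" by (simp add: power_mult_distrib power_mult)
      finally have "sqrt ?d ^ ?d * 1 + 2 * (1 + \<bar>a\<bar> + \<bar>?L\<bar>) ^ ?d \<le>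
          sqrt ?d ^ ?d * (real j + 1) ^ (2 * ?d) + 2 * ((2 + \<bar>a\<bar> + 9 * ?d) ^ ?d * (real j + 1) ^ (2 * ?d))"
        using 1 by (intro add_mono mult_left_mono) auto
      then have "low_weight ?d (sqrt ?d) a ?L \<le>
          6 ^ ?d * (sqrt ?d ^ ?d * (real j + 1) ^ (2 * ?d) + 2 * ((2 + \<bar>a\<bar> + 9 * ?d) ^ ?d * (real j + 1) ^ (2 * ?d)))"
        unfolding low_weight_def by (intro mult_left_mono) auto
      then show ?thesis by (simp add: algebra_simps)
    qed
    also have "?w * (real j + 1) ^ (2 * ?d) * A + 6 ^ ?d * B \<le> (?w * A + 6 ^ ?d * B) * (real j + 1) ^ (2 * ?d)"
    proof -
      have "6 ^ ?d * B * 1 \<le> 6 ^ ?d * B * (real j + 1) ^ (2 * ?d)" using B by (intro mult_left_mono one_le_power) auto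
      then show ?thesis by (simp add: algebra_simps)
    qed
    finally have le: "measure (Lambda g) (low_power (sqrt ?d) ?L :: ('a \<times> real) set) \<le>
        (?w * A + 6 ^ ?d * B) * (real j + 1) ^ (2 * ?d)"
      using A by (simp add: mult_right_mono)
    show "measure (Lambda g) (low_power (sqrt ?d) ?L :: ('a \<times> real) set) * exp (- ((2 * (real j + 1)) ^ ?d * y))
        \<le> (?w * A + 6 ^ ?d * B) * (real j + 1) ^ (2 * ?d) * exp (- \<kappa> * (real j + 1) powr 1)"
      using col_ge[of j] A B by (intro mult_mono le) auto
  qed
qed

section \<open>Consequences of admissibility\<close>

lemma admissible_measurable: "admissible d E f \<Longrightarrow> f \<in> borel_measurable borel"
  and admissible_nonneg: "admissible d E f \<Longrightarrow> 0 \<le> f x"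
  by (auto simp: admissible_def L1loc_plus_def)

lemma admissible_finite:
  assumes "admissible d E f" "t \<in> E"
  shows "(\<integral>\<^sup>+s\<in>{..t}. ennreal (f s * (t - s) powr (real d / 2)) \<partial>lborel) < \<infinity>"
proof -
  have "frac_int (real d / 2 + 1) f t < \<infinity>" using assms by (simp add: admissible_def)
  moreover have "0 < Gamma (real d / 2 + 1)" by (intro Gamma_real_pos) simp
  ultimately show ?thesis
    unfolding frac_int_def by (auto simp: ennreal_mult_less_top)
qed

text \<open>For \<open>s \<le> x\<close> the kernel at \<open>s\<close> is at least
  \<open>(t - x) powr (real d / 2)\<close>, which is positive because \<open>x < t\<close>.\<close>

lemma admissible_mass_below_finite:
  assumes adm: "admissible d E f" and t: "t \<in> E" "x < t"
  shows "mass_below f x < \<infinity>"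
proof -
  note [measurable] = admissible_measurable[OF adm]
  have "ennreal ((t - x) powr (real d / 2)) * mass_below f x =
      (\<integral>\<^sup>+s. ennreal ((t - x) powr (real d / 2)) * (ennreal (f s) * indicator {..x} s) \<partial>lborel)"
    unfolding mass_below_def by (simp add: nn_integral_cmult)
  also have "\<dots> \<le> (\<integral>\<^sup>+s\<in>{..t}. ennreal (f s * (t - s) powr (real d / 2)) \<partial>lborel)"
  proof (rule nn_integral_mono)
    fix s
    show "ennreal ((t - x) powr (real d / 2)) * (ennreal (f s) * indicator {..x} s) \<le>
        ennreal (f s * (t - s) powr (real d / 2)) * indicator {..t} s"
    proof (cases "s \<le> x")
      case True
      then have "(t - x) powr (real d / 2) \<le> (t - s) powr (real d / 2)" using t by (intro powr_mono2) auto
      then have "(t - x) powr (real d / 2) * f s \<le> f s * (t - s) powr (real d / 2)"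
        using admissible_nonneg[OF adm, of s] by (subst mult.commute) (rule mult_left_mono)
      then show ?thesis
        using True t admissible_nonneg[OF adm, of s] by (simp add: ennreal_leI flip: ennreal_mult)
    qed simp
  qed
  also have "\<dots> < \<infinity>" by (rule admissible_finite[OF adm t(1)])
  finally show ?thesis
    using t(2) by (auto simp: ennreal_mult_less_top)
qed

text \<open>If the mass were finite, the fractional integral would stay bounded up to
  \<open>b\<close>: for \<open>s \<le> b - 2\<close> one has
  \<open>y - s \<le> 2 * (b - 1 - s)\<close>, which compares with the finite integral at
  \<open>b - 1\<close>, and for larger \<open>s\<close> the kernel is at most
  \<open>2 powr (real d / 2)\<close>. This contradicts the growth demanded at the points
  \<open>b - 1 / n\<close>.\<close>

lemma admissible_bounded_above_mass:
  assumes adm: "admissible d {..<b} f"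
  shows "mass_below f b = \<infinity>"
proof (rule ccontr)
  assume "mass_below f b \<noteq> \<infinity>"
  then have fin: "mass_below f b < \<infinity>" by (simp add: less_top)
  note [measurable] = admissible_measurable[OF adm]
  let ?q = "real d / 2"
  let ?J = "\<lambda>t. \<integral>\<^sup>+s\<in>{..t}. ennreal (f s * (t - s) powr ?q) \<partial>lborel"
  let ?Q = "ennreal (1 / Gamma (?q + 1)) * (ennreal (2 powr ?q) * ?J (b - 1) + ennreal (2 powr ?q) * mass_below f b)"
  have le: "frac_int (?q + 1) f y \<le> ?Q" if y: "y < b" for y
    unfolding frac_int_def
  proof (rule mult_left_mono)
    have "(\<integral>\<^sup>+t\<in>{..y}. ennreal (f t * (y - t) powr (?q + 1 - 1)) \<partial>lborel)
      \<le> (\<integral>\<^sup>+s. ennreal (2 powr ?q) * (ennreal (f s * (b - 1 - s) powr ?q) * indicator {..b - 1} s) +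
          ennreal (2 powr ?q) * (ennreal (f s) * indicator {..b} s) \<partial>lborel)"
    proof (rule nn_integral_mono)
      fix s
      have fs: "0 \<le> f s" by (rule admissible_nonneg[OF adm])
      show "ennreal (f s * (y - s) powr (?q + 1 - 1)) * indicator {..y} s \<le>
        ennreal (2 powr ?q) * (ennreal (f s * (b - 1 - s) powr ?q) * indicator {..b - 1} s) +
            ennreal (2 powr ?q) * (ennreal (f s) * indicator {..b} s)"
      proof (cases "s \<le> y")
        case sy: True
        show ?thesis
        proof (cases "s \<le> b - 2")
          case True
          have "(y - s) powr ?q \<le> (2 * (b - 1 - s)) powr ?q" using sy y True by (intro powr_mono2) auto
          also have "\<dots> = 2 powr ?q * (b - 1 - s) powr ?q" by (rule powr_mult)
          finally have "f s * (y - s) powr ?q \<le> f s * (2 powr ?q * (b - 1 - s) powr ?q)"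
            using fs by (rule mult_left_mono)
          then have "f s * (y - s) powr ?q \<le> 2 powr ?q * (f s * (b - 1 - s) powr ?q)"
            by (simp only: mult.left_commute)
          then have "ennreal (f s * (y - s) powr ?q) \<le> ennreal (2 powr ?q) * ennreal (f s * (b - 1 - s) powr ?q)"
            using fs by (simp add: ennreal_leI flip: ennreal_mult)
          then show ?thesis using sy True by (simp add: add_increasing2)
        next
          case False
          have "(y - s) powr ?q \<le> 2 powr ?q" using sy y False by (intro powr_mono2) auto
          then have "f s * (y - s) powr ?q \<le> f s * 2 powr ?q" using fs by (rule mult_left_mono)
          then have "f s * (y - s) powr ?q \<le> 2 powr ?q * f s" by (simp only: mult.commute)
          then have "ennreal (f s * (y - s) powr ?q) \<le> ennreal (2 powr ?q) * ennreal (f s)"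
            using fs by (simp add: ennreal_leI flip: ennreal_mult)
          then show ?thesis using sy y by (simp add: add_increasing)
        qed
      qed simp
    qed
    also have "\<dots> = ennreal (2 powr ?q) * ?J (b - 1) + ennreal (2 powr ?q) * mass_below f b"
      unfolding mass_below_def by (simp add: nn_integral_add nn_integral_cmult)
    finally show "(\<integral>\<^sup>+t\<in>{..y}. ennreal (f t * (y - t) powr (?q + 1 - 1)) \<partial>lborel) \<le>
        ennreal (2 powr ?q) * ?J (b - 1) + ennreal (2 powr ?q) * mass_below f b" .
  qed simp
  have "?Q < \<infinity>"
    using admissible_finite[OF adm, of "b - 1"] fin by (simp add: ennreal_mult_less_top)
  then obtain q where q: "?Q = ennreal q" "0 \<le> q" by (cases ?Q) auto
  obtain \<epsilon> n0 where \<epsilon>: "0 < \<epsilon>" and n0: "\<And>n::nat. n0 < n \<Longrightarrow>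
      ennreal (real n powr \<epsilon>) \<le> frac_int (?q + 1) f (b - 1 / real n)"
    using adm unfolding admissible_def by blast
  have "filterlim (\<lambda>n. real n powr \<epsilon>) at_top sequentially" using \<epsilon> by real_asymp
  then have "\<forall>\<^sub>F n in sequentially. q < real n powr \<epsilon>" by (simp add: filterlim_at_top_dense)
  then have "\<forall>\<^sub>F n in sequentially. q < real n powr \<epsilon> \<and> n0 < n"
    using eventually_gt_at_top[of n0] by (rule eventually_conj)
  then obtain n where n: "q < real n powr \<epsilon>" "n0 < n" by (auto simp: eventually_sequentially)
  have "ennreal (real n powr \<epsilon>) \<le> ennreal q"
    using n0[OF n(2)] le[of "b - 1 / real n"] n(2) unfolding q(1) by (auto intro: order_trans)
  then show False using n(1) q(2) by simp
qed

lemma admissible_unbounded_above: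
  assumes adm: "admissible d E f" and fin: "\<And>x. mass_below f x < \<infinity>"
  shows "\<exists>y'\<ge>y. y' \<in> E"
proof -
  have "E \<noteq> {..<b}" for b
    using admissible_bounded_above_mass[of d b f] adm fin[of b] by auto
  then consider a where "E = {a..}" | "E = UNIV"
    using adm by (auto simp: admissible_def)
  then show ?thesis
  proof cases
    case (1 a)
    then show ?thesis by (intro exI[of _ "max a y"]) auto
  qed auto
qed

text \<open>Supplies the room above \<open>x\<close> that
  \<open>admissible_mass_below_finite\<close> asks for.\<close>

lemma admissible_open_above:
  assumes adm: "admissible d E f" and x: "x \<in> E"
  shows "\<exists>t>x. t \<in> E"
proof -
  consider a where "E = {a..}" | b where "E = {..<b}" | "E = UNIV"
    using adm by (auto simp: admissible_def)
  then show ?thesis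
  proof cases
    case 1
    then show ?thesis using x by (intro exI[of _ "x + 1"]) auto
  next
    case 2
    then show ?thesis using x dense[of x b] by auto
  next
    case 3
    then show ?thesis by (intro exI[of _ "x + 1"]) auto
  qed
qed

text \<open>Finiteness at \<open>x0\<close> propagates upwards in steps of length
  \<open>s\<close>.\<close>

lemma mass_below_finite_of_doubling:
  assumes "mass_below g x0 < \<infinity>" "0 < s"
    and dbl: "\<And>x. x0 \<le> x \<Longrightarrow> mass_below g (x + s) \<le> ennreal C * mass_below g x"
  shows "mass_below g x < \<infinity>"
proof -
  have "mass_below g (x0 + real k * s) < \<infinity>" for k
  proof (induction k)
    case (Suc k)
    have "mass_below g (x0 + real k * s + s) \<le> ennreal C * mass_below g (x0 + real k * s)"
      using assms(2) by (intro dbl) auto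
    also have "\<dots> < \<infinity>" using Suc by (simp add: ennreal_mult_less_top)
    finally show ?case by (simp add: algebra_simps)
  qed (use assms in simp)
  moreover obtain k where "(x - x0) / s \<le> real k" using real_arch_simple by blast
  then have "x \<le> x0 + real k * s" using assms(2) by (simp add: field_simps)
  ultimately show ?thesis
    using mass_below_mono[of x "x0 + real k * s" g] by (blast intro: le_less_trans)
qed

theorem theorem3p13:
  fixes En :: "nat \<Rightarrow> real set" and E :: "real set"
    and fn :: "nat \<Rightarrow> real \<Rightarrow> real" and f :: "real \<Rightarrow> real"
    and Mn :: "nat \<Rightarrow> 'w measure" and M :: "'v measure"
    and \<eta>n :: "nat \<Rightarrow> 'w \<Rightarrow> ((real ^ 'd::{finite,linorder}) \<times> real) set"
    and \<eta> :: "'v \<Rightarrow> ((real ^ 'd::{finite,linorder}) \<times> real) set"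
  assumes dim: "CARD('d) \<ge> 2"
    and adm_n: "\<And>n. admissible CARD('d) (En n) (fn n)"
    and En_mono: "incseq En" and En_union: "(\<Union>n. En n) = E"
    and adm: "admissible CARD('d) E f"
    and f_pos: "frac_int 1 f (1 / 2) > 0"
    and L1_conv: "\<And>y. y \<in> E \<Longrightarrow>
      (\<lambda>n. \<integral>\<^sup>+h\<in>{..y}. ennreal \<bar>fn n h - f h\<bar> \<partial>lborel) \<longlonglongrightarrow> 0"
    and moment: "\<exists>x0' \<delta>. \<delta> > 0 \<and>
      (SUP n. \<integral>\<^sup>+h\<in>{..x0'}. ennreal (\<bar>h\<bar> powr (real CARD('d) / 2 + \<delta>) * fn n h) \<partial>lborel) < \<infinity>"
    and nontriv_n: "\<And>n. emeasure (Lambda (fn n)) (cbox (0 :: real ^ 'd::{finite,linorder}) One \<times> UNIV) > 0"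
    and nontriv: "emeasure (Lambda f) (cbox (0 :: real ^ 'd::{finite,linorder}) One \<times> UNIV) > 0"
    and poisson_n: "\<And>n. poisson_process (Mn n) (\<eta>n n) (Lambda (fn n))"
    and poisson: "poisson_process M \<eta> (Lambda f)"
    and growth:
      "(\<exists>n0 C \<alpha> \<epsilon> x0. 0 < C \<and> 0 < \<alpha> \<and> 0 < \<epsilon> \<and> x0 \<in> E \<and>
          (\<forall>n\<ge>n0. \<forall>x\<ge>x0.
             frac_int 1 (fn n) (x + 4 * real CARD('d) + 2) \<le> ennreal C * frac_int 1 (fn n) x \<and>
             (0 \<le> x \<longrightarrow> ennreal (\<alpha> * x powr \<epsilon>) \<le> frac_int 1 (fn n) x)))
       \<or> (\<exists>p>1. (\<forall>n. integrable lborel (fn n)) \<and>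
            bdd_above (range (\<lambda>n. (\<integral>x. fn n x \<partial>lborel) powr p)))"
  shows "weakly_converges
    (\<lambda>n. typical_cell_distr lex_min_vertex (Mn n) (\<lambda>\<omega>. laguerre_diagram (\<eta>n n \<omega>)))
    (typical_cell_distr lex_min_vertex M (\<lambda>\<omega>. laguerre_diagram (\<eta> \<omega>)))"
proof -
  let ?d = "DIM(real ^ 'd::{finite,linorder})"
  have d: "CARD('d) = ?d" by simp
  note fn = admissible_measurable[OF adm_n] admissible_nonneg[OF adm_n]
  note f = admissible_measurable[OF adm] admissible_nonneg[OF adm]
  note growth' = growth[unfolded frac_int_1[OF fn(1)] d]

  \<comment> \<open>Under (i) this is obtained only from some index on, since \<open>x0\<close> need
    not lie in the first sets \<open>En n\<close>; hence the shift of the sequence at the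
    end.\<close>
  have "\<exists>k. \<forall>n\<ge>k. \<forall>x. mass_below (fn n) x < \<infinity>"
    using growth'
  proof (elim disjE exE conjE)
    fix n0 C \<alpha> \<epsilon> x0
    assume x0: "x0 \<in> E" and dbl:
        "\<forall>n\<ge>n0. \<forall>x\<ge>x0. mass_below (fn n) (x + 4 * real ?d + 2) \<le> ennreal C * mass_below (fn n) x \<and>
             (0 \<le> x \<longrightarrow> ennreal (\<alpha> * x powr \<epsilon>) \<le> mass_below (fn n) x)"
    obtain n1 where n1: "x0 \<in> En n1" using x0 En_union by blast
    show ?thesis
    proof (intro exI[of _ "max n0 n1"] allI impI)
      fix n x assume n: "max n0 n1 \<le> n"
      then have "x0 \<in> En n" using n1 En_mono by (auto simp: incseq_def)
      then obtain t where "t > x0" "t \<in> En n" using admissible_open_above[OF adm_n] by blast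
      then have "mass_below (fn n) x0 < \<infinity>" using admissible_mass_below_finite[OF adm_n] by blast
      then show "mass_below (fn n) x < \<infinity>"
        by (rule mass_below_finite_of_doubling[where s="4 * real ?d + 2" and C=C])
          (use dbl n in \<open>auto simp: add.assoc[symmetric]\<close>)
    qed
  next
    fix p assume int: "\<forall>n. integrable lborel (fn n)"
    have "mass_below (fn n) x < \<infinity>" for n x
    proof -
      have "mass_below (fn n) x \<le> (\<integral>\<^sup>+h. ennreal (fn n h) \<partial>lborel)"
        unfolding mass_below_def by (intro nn_integral_mono) (auto simp: indicator_def)
      also have "\<dots> = ennreal (\<integral>h. fn n h \<partial>lborel)"
        using int fn(2) by (intro nn_integral_eq_integral) auto
      finally show ?thesis by (rule le_less_trans) simp
    qed
    then show ?thesis by blast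
  qed
  then obtain k0 where fin_n: "\<And>n x. k0 \<le> n \<Longrightarrow> mass_below (fn n) x < \<infinity>" by blast

  have conv: "(\<lambda>n. mass_below (\<lambda>h. \<bar>fn n h - f h\<bar>) y) \<longlonglongrightarrow> 0" for y
  proof -
    \<comment> \<open>\<open>L1_conv\<close> speaks of points of \<open>E\<close> only. Finite mass
      forces \<open>En k0\<close>, and with it \<open>E\<close>, to reach above every
      \<open>y\<close>.\<close>
    obtain y' where y': "y \<le> y'" "y' \<in> En k0"
      using admissible_unbounded_above[OF adm_n fin_n] by blast
    then have "y' \<in> E" using En_union by blast
    then have "(\<lambda>n. mass_below (\<lambda>h. \<bar>fn n h - f h\<bar>) y') \<longlonglongrightarrow> 0"
      using L1_conv unfolding mass_below_def by blast
    from tendsto_sandwich[OF _ _ tendsto_const this] show ?thesis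
      using mass_below_mono[OF y'(1)] by simp
  qed
  \<comment> \<open>A single late member of the sequence whose integrated distance from
    \<open>f\<close> below \<open>x\<close> is less than 1 suffices.\<close>
  have fin: "mass_below f x < \<infinity>" for x
  proof -
    have "\<forall>\<^sub>F n in sequentially. mass_below (\<lambda>h. \<bar>fn n h - f h\<bar>) x < 1"
      by (rule order_tendstoD[OF conv]) simp
    then have "\<forall>\<^sub>F n in sequentially. mass_below (\<lambda>h. \<bar>fn n h - f h\<bar>) x < 1 \<and> k0 \<le> n"
      using eventually_ge_at_top[of k0] by (rule eventually_conj)
    then obtain n where n: "mass_below (\<lambda>h. \<bar>fn n h - f h\<bar>) x < 1" "k0 \<le> n" by (auto simp: eventually_sequentially)
    have "mass_below f x \<le> mass_below (fn n) x + mass_below (\<lambda>h. \<bar>f h - fn n h\<bar>) x"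
      by (rule mass_below_diff_le[OF f(1) fn])
    also have "\<dots> < \<infinity>" using n fin_n[OF n(2), of x] less_trans[OF n(1) ennreal_one_less_top]
        by (simp add: abs_minus_commute)
    finally show ?thesis .
  qed
  have conv_mass: "(\<lambda>n. mass_below (fn n) x) \<longlonglongrightarrow> mass_below f x" for x
    by (rule mass_below_tendsto[OF fn f conv fin])

  obtain a \<delta> where \<delta>: "\<delta> > 0" and sup: "(SUP n. moment_below (real ?d / 2 + \<delta>) a (fn n)) < \<infinity>"
    using moment unfolding moment_below_def d by blast
  define p where "p = real ?d / 2 + \<delta>"
  define B where "B = enn2real (SUP n. moment_below p a (fn n))"
  have B: "0 \<le> B" "ennreal B = (SUP n. moment_below p a (fn n))" using sup by (auto simp: B_def p_def)
  have mom_n: "moment_below p a (fn n) \<le> ennreal B" for n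
    unfolding B(2) by (rule SUP_upper) simp
  have p: "0 \<le> p" "real ?d / 2 \<le> p" using \<delta> by (auto simp: p_def)
  have mom: "moment_below p a f \<le> ennreal B"
    by (rule moment_below_limit[OF fn f p(1) conv mom_n])
  have int_n: "intensity ?d (fn n)" if "k0 \<le> n" for n
    by (rule intensityI[OF fn _ p(2) fin_n[OF that] le_less_trans[OF mom_n]]) auto
  have int: "intensity ?d f"
    by (rule intensityI[OF f _ p(2) fin le_less_trans[OF mom]]) auto
  have conv_low: "(\<lambda>n. low_power_bound ?d (\<lambda>h. \<bar>fn n h - f h\<bar>) c L) \<longlonglongrightarrow> 0" if "0 \<le> c" for c L
    by (rule low_power_bound_tendsto_0[OF fn f _ that p_def \<delta> conv mom_n mom B(1)]) simp

  \<comment> \<open>Half of the mass of \<open>f\<close> below \<open>1 / 2\<close>: the strict gap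
    lets all but finitely many \<open>fn n\<close> have more than \<open>\<kappa>\<close>
    there.\<close>
  define \<kappa> where "\<kappa> = enn2real (mass_below f (1 / 2)) / 2"
  have "0 < mass_below f (1 / 2)" using f_pos by (simp add: frac_int_1[OF f(1)])
  then have \<kappa>: "0 < \<kappa>" "ennreal \<kappa> < mass_below f (1 / 2)"
  proof -
    have "0 < enn2real (mass_below f (1 / 2))"
      using fin[of "1 / 2"] \<open>0 < mass_below f (1 / 2)\<close> by (simp add: enn2real_positive_iff)
    then show "0 < \<kappa>" by (simp add: \<kappa>_def)
    have "ennreal \<kappa> < ennreal (enn2real (mass_below f (1 / 2)))"
      using \<open>0 < enn2real (mass_below f (1 / 2))\<close> by (intro ennreal_lessI) (auto simp: \<kappa>_def)
    then show "ennreal \<kappa> < mass_below f (1 / 2)" using fin[of "1 / 2"] by simp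
  qed
  have "\<forall>\<^sub>F n in sequentially. ennreal \<kappa> < mass_below (fn n) (1 / 2)"
    by (rule order_tendstoD(1)[OF conv_mass \<kappa>(2)])
  then obtain k1 where k1: "\<And>n. k1 \<le> n \<Longrightarrow> ennreal \<kappa> < mass_below (fn n) (1 / 2)"
    by (auto simp: eventually_sequentially)

  \<comment> \<open>The boxes and the series \<open>t\<close> must serve \<open>f\<close> and all
    late \<open>fn n\<close> at the same time.\<close>
  have "\<exists>k r s t. (\<forall>j. 0 \<le> r j) \<and> summable t \<and>
      tail_bound ?d (sqrt ?d) r s t (Lambda f :: ((real ^ 'd::{finite,linorder}) \<times> real) measure) \<and>
      (\<forall>n\<ge>k. tail_bound ?d (sqrt ?d) r s t (Lambda (fn n) :: ((real ^ 'd::{finite,linorder}) \<times> real) measure))"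
    using growth'
  proof (elim disjE exE conjE)
    fix n0 C \<alpha> \<epsilon> x0
    assume C: "0 < C" and \<alpha>: "0 < \<alpha>" and \<epsilon>: "0 < \<epsilon>"
      and gr: "\<forall>n\<ge>n0. \<forall>x\<ge>x0. mass_below (fn n) (x + 4 * real ?d + 2) \<le> ennreal C * mass_below (fn n) x \<and>
             (0 \<le> x \<longrightarrow> ennreal (\<alpha> * x powr \<epsilon>) \<le> mass_below (fn n) x)"
    have dbl_n: "mass_below (fn n) (x + 4 * real ?d + 2) \<le> ennreal C * mass_below (fn n) x"
      and low_n: "0 \<le> x \<Longrightarrow> ennreal (\<alpha> * x powr \<epsilon>) \<le> mass_below (fn n) x" if "n0 \<le> n" "x0 \<le> x" for n x
      using gr that by blast+
    \<comment> \<open>Both inequalities of (i) are non-strict, so they pass to the limit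
      \<open>f\<close>.\<close>
    have dbl: "mass_below f (x + 4 * real ?d + 2) \<le> ennreal C * mass_below f x" if "x0 \<le> x" for x
    proof (rule LIMSEQ_le[OF conv_mass])
      show "(\<lambda>n. ennreal C * mass_below (fn n) x) \<longlonglongrightarrow> ennreal C * mass_below f x"
        by (rule ennreal_tendsto_cmult[OF _ conv_mass]) simp
    qed (use dbl_n[OF _ that] in blast)
    have low: "ennreal (\<alpha> * x powr \<epsilon>) \<le> mass_below f x" if "x0 \<le> x" "0 \<le> x" for x
      by (rule LIMSEQ_le_const[OF conv_mass]) (use low_n[OF _ that] in blast)
    \<comment> \<open>All integer tops from \<open>j0\<close> on are at least \<open>x0\<close>, so
      (i) applies to them, and at least 1, as \<open>tail_bound_growth\<close> demands.\<close>
    obtain j0 :: nat where "max 1 x0 \<le> real j0" using real_arch_simple by blast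
    then have j0: "1 \<le> j0" "\<And>j. x0 \<le> real (j0 + j)" by auto
    define t where "t j = 2 * (6 ^ ?d * (sqrt ?d ^ ?d + 2 * (2 + \<bar>a\<bar> + 4 * ?d + j0) ^ ?d) * C + 6 ^ ?d * B) *
        (real j + 1) ^ ?d *
      exp (- (\<alpha> / 2) * (real j + 1) powr \<epsilon>)" for j
    have "summable t"
      unfolding t_def by (rule summable_power_exp_powr[OF half_gt_zero[OF \<alpha>] \<epsilon>])
    moreover have "tail_bound ?d (sqrt ?d) (\<lambda>_. 1) (\<lambda>j.
        real (j0 + j)) t (Lambda f :: ((real ^ 'd::{finite,linorder}) \<times> real) measure)"
      unfolding t_def
      by (rule tail_bound_growth[OF f p(2) mom B(1) fin C \<alpha> \<epsilon> j0(1) dbl[OF j0(2)] low[OF j0(2) of_nat_0_le_iff]])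
    moreover have "tail_bound ?d (sqrt ?d) (\<lambda>_. 1) (\<lambda>j.
        real (j0 + j)) t (Lambda (fn n) :: ((real ^ 'd::{finite,linorder}) \<times> real) measure)"
      if "max k0 n0 \<le> n" for n
    proof -
      have n: "k0 \<le> n" "n0 \<le> n" using that by auto
      show ?thesis
        unfolding t_def
        by (rule tail_bound_growth[OF fn p(2) mom_n B(1) fin_n[OF n(1)] C \<alpha> \<epsilon> j0(1) dbl_n[OF n(2) j0(2)]
            low_n[OF n(2) j0(2) of_nat_0_le_iff]])
    qed
    ultimately show ?thesis
      by (intro exI[of _ "max k0 n0"] exI[of _ "\<lambda>_. 1"] exI[of _ "\<lambda>j. real (j0 + j)"] exI[of _ t]) simp
  next
    fix q :: real assume q: "1 < q" and int': "\<forall>n. integrable lborel (fn n)"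
      and bdd: "bdd_above (range (\<lambda>n. (\<integral>x. fn n x \<partial>lborel) powr q))"
    obtain A0 where A0: "\<And>n. (\<integral>x. fn n x \<partial>lborel) powr q \<le> A0" using bdd by (auto simp: bdd_above_def)
    \<comment> \<open>\<open>y powr q\<close> dominates \<open>y\<close> only for
      \<open>y \<ge> 1\<close>, hence the maximum with 1.\<close>
    define A where "A = max 1 A0"
    have A: "(\<integral>x. fn n x \<partial>lborel) \<le> A" for n
    proof (cases "1 \<le> (\<integral>x. fn n x \<partial>lborel)")
      case True
      then have "(\<integral>x. fn n x \<partial>lborel) powr 1 \<le> (\<integral>x. fn n x \<partial>lborel) powr q" using q by (intro powr_mono) auto
      then show ?thesis using A0[of n] True by (simp add: A_def)
    qed (simp add: A_def)
    have mass_n: "mass_below (fn n) x \<le> ennreal A" for n x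
    proof -
      have "mass_below (fn n) x \<le> (\<integral>\<^sup>+h. ennreal (fn n h) \<partial>lborel)"
        unfolding mass_below_def by (intro nn_integral_mono) (auto simp: indicator_def)
      also have "\<dots> = ennreal (\<integral>h. fn n h \<partial>lborel)"
        using int' fn(2) by (intro nn_integral_eq_integral) auto
      also have "\<dots> \<le> ennreal A" by (intro ennreal_leI A)
      finally show ?thesis .
    qed
    have mass: "mass_below f x \<le> ennreal A" for x
      by (rule LIMSEQ_le_const2[OF conv_mass]) (use mass_n in blast)
    have A_pos: "0 \<le> A" by (simp add: A_def)
    define t where "t j = (6 ^ ?d * (sqrt ?d ^ ?d + 2 * (2 + \<bar>a\<bar> + 9 * ?d) ^ ?d) * A + 6 ^ ?d * B) * (real j +
        1) ^ (2 * ?d) *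
      exp (- \<kappa> * (real j + 1) powr 1)" for j
    have "summable t"
      unfolding t_def by (rule summable_power_exp_powr[OF \<kappa>(1) zero_less_one])
    moreover have "tail_bound ?d (sqrt ?d) (\<lambda>j. real j +
        1) (\<lambda>_. 1 / 2) t (Lambda f :: ((real ^ 'd::{finite,linorder}) \<times> real) measure)"
      unfolding t_def
      by (rule tail_bound_finite_mass[OF f p(2) mom B(1) mass A_pos \<kappa>(1) less_imp_le[OF \<kappa>(2)]])
    moreover have "tail_bound ?d (sqrt ?d) (\<lambda>j. real j +
        1) (\<lambda>_. 1 / 2) t (Lambda (fn n) :: ((real ^ 'd::{finite,linorder}) \<times> real) measure)"
      if "k1 \<le> n" for n
      unfolding t_def
      by (rule tail_bound_finite_mass[OF fn p(2) mom_n B(1) mass_n A_pos \<kappa>(1) less_imp_le[OF k1[OF that]]])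
    ultimately show ?thesis
      by (intro exI[of _ k1] exI[of _ "\<lambda>j. real j + 1"] exI[of _ "\<lambda>_. 1 / 2"] exI[of _ t]) simp
  qed
  then obtain k2 r s t where r: "\<And>j. 0 \<le> r j" and t: "summable t"
    and tail: "tail_bound ?d (sqrt ?d) r s t (Lambda f :: ((real ^ 'd::{finite,linorder}) \<times> real) measure)"
      "\<And>n. k2 \<le> n \<Longrightarrow> tail_bound ?d (sqrt ?d) r s t (Lambda (fn n) :: ((real ^ 'd::{finite,linorder}) \<times> real) measure)"
    by blast

  define k where "k = max k0 (max k1 k2)"
  have k: "k0 \<le> n + k" "k1 \<le> n + k" "k2 \<le> n + k" for n by (auto simp: k_def)
  have "weakly_converges
    (\<lambda>n. typical_cell_distr lex_min_vertex (Mn (n + k)) (\<lambda>\<omega>. laguerre_diagram (\<eta>n (n + k) \<omega>)))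
    (typical_cell_distr lex_min_vertex M (\<lambda>\<omega>. laguerre_diagram (\<eta> \<omega>)))"
  proof (rule typical_cell_weakly_converges[where ?h0.0="1 / 2"
      and f="\<lambda>n. fn (n + k)", OF poisson_n int_n[OF k(1)] poisson int _ _ _ r t tail(2)[OF k(3)] tail(1)])
    show "(\<lambda>n. low_power_bound ?d (\<lambda>h. \<bar>fn (n + k) h - f h\<bar>) c L) \<longlonglongrightarrow> 0" if "0 \<le> c" for c L
      using LIMSEQ_ignore_initial_segment[OF conv_low[OF that]] .
    show "0 < (\<integral>\<^sup>+h\<in>{..1 / 2}. ennreal (fn (n + k) h) \<partial>lborel)" for n
      using k1[OF k(2)[of n]] unfolding mass_below_def by (rule le_less_trans[rotated]) simp
    show "0 < (\<integral>\<^sup>+h\<in>{..1 / 2}. ennreal (f h) \<partial>lborel)"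
      using \<kappa>(2) unfolding mass_below_def by (rule le_less_trans[rotated]) simp
  qed
  then show ?thesis by (rule weakly_converges_offset)
qed

end
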